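(* Let $d\in\mathbb{N}$ and $L\in\{2,3,\ldots\}$. (i) For every $a>1$ there exists an isometry-invariant kernel $J$ on $\mathbb{H}^d_L$ satisfying $J\sim aL^d n^{-2d}\log\log n$ such that $\mathbb{P}_J(|K_0|=\infty)>0$. (ii) If $J$ is an isometry-invariant kernel on $\mathbb{H}^d_L$ such that \[\limsup_{n\to\infty}\frac{L^{-d}(L^n)^{2d}}{\log\log(L^n)}J(L^n)\le1,\] then $\mathbb{P}_J(|K_0|=\infty)=0$.
   Context: The hierarchical lattice $\mathbb{H}^d_L$ is the group $\bigoplus_{i=1}^\infty(\mathbb{Z}/L\mathbb{Z})^d$ with ultrametric $\|x-y\|=L^{\max\{i:x_i\neq y_i\}}$ for $x\neq y$. Edges are unordered pairs $e=\{x,y\}$ of distinct vertices, with length $|e|=\|x-y\|$. For a kernel $J:E\to[0,\infty)$, $\mathbb{P}_J$ is the law of the random graph where each edge $e$ is open independently with probability $1-\exp(-J(e))$; $K_0$ is the open cluster of the origin. $J$ is isometry-invariant if $J(e)=J(f)$ whenever $|e|=|f|$; such a kernel is regarded as a function on $\{L,L^2,\ldots\}$ via $J(|e|)=J(e)$. For $f:\mathbb{N}\to[0,\infty)$, $J\sim f$ means $\lim_{|e|\to\infty}J(e)/f(|e|)=1$. *)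

theory Defs
  imports "HOL-Probability.Probability"
begin

text \<open>Vertices of the hierarchical lattice H^d_L: finitely supported sequences
  x = (x_1, x_2, ...) with x_i in (Z/LZ)^d. A vertex is encoded as a function
  x :: nat => nat => nat, where x i j (for i >= 1, j < d) is the j-th coordinate of
  x_i, represented by its residue in {0..<L}; x 0 and coordinates j >= d are 0.\<close>

type_synonym hvertex = "nat \<Rightarrow> nat \<Rightarrow> nat"

definition hvert :: "nat \<Rightarrow> nat \<Rightarrow> hvertex set" where
  "hvert d L = {x. (\<forall>i j. x i j < L \<and> (d \<le> j \<longrightarrow> x i j = 0) \<and> (i = 0 \<longrightarrow> x i j = 0))
                    \<and> finite {i. x i \<noteq> (\<lambda>_. 0)}}"

definition horigin :: hvertex where
  "horigin = (\<lambda>_ _. 0)"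

definition hedges :: "nat \<Rightarrow> nat \<Rightarrow> hvertex set set" where
  "hedges d L = {{x, y} | x y. x \<in> hvert d L \<and> y \<in> hvert d L \<and> x \<noteq> y}"

text \<open>Level of an edge e = {x,y}: the largest i with x_i ~= y_i, so that |e| = L ^ elevel e.\<close>
definition elevel :: "hvertex set \<Rightarrow> nat" where
  "elevel e = Max {i. \<exists>x\<in>e. \<exists>y\<in>e. x i \<noteq> y i}"

text \<open>An isometry-invariant kernel is regarded (as in the paper) as a function on
  {L, L^2, ...}; we encode it by j :: nat => real with j n = J(L^n) (n >= 1).
  The percolation measure: each edge e open independently with probability
  1 - exp(- J(e)).\<close>
definition perc :: "nat \<Rightarrow> nat \<Rightarrow> (nat \<Rightarrow> real) \<Rightarrow> (hvertex set \<Rightarrow> bool) measure" where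
  "perc d L j = PiM (hedges d L)
      (\<lambda>e. measure_pmf (bernoulli_pmf (1 - exp (- j (elevel e)))))"

definition cluster0 :: "nat \<Rightarrow> nat \<Rightarrow> (hvertex set \<Rightarrow> bool) \<Rightarrow> hvertex set" where
  "cluster0 d L \<omega> = {y. (horigin, y) \<in>
      {(x, y). x \<in> hvert d L \<and> y \<in> hvert d L \<and> x \<noteq> y \<and> \<omega> {x, y}}\<^sup>*}"

definition perc_event :: "nat \<Rightarrow> nat \<Rightarrow> (nat \<Rightarrow> real) \<Rightarrow> (hvertex set \<Rightarrow> bool) set" where
  "perc_event d L j = {\<omega> \<in> space (perc d L j). infinite (cluster0 d L \<omega>)}"

end

theory Submission
  imports Defs "HOL-Real_Asymp.Real_Asymp"
begin

text \<open>Write \<open>N = L ^ d\<close>. An \<open>n\<close>-block has no open edge to its complement with probability about \<open>n powr - a\<close>, and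
  \<open>a = 1\<close> is the threshold for summability over \<open>n\<close>.

  If the limsup is at most 1, vertices that are isolated inside the block of the origin cannot help its cluster
  to escape. They have positive density, so the exponent of the relevant isolation event is strictly smaller
  than 1. Restricting these events to disjoint ranges of scales makes them independent while their
  probabilities still add up to infinity, so some block confines the cluster.

  If \<open>a > 1\<close>, let \<open>x\<close> be the density of the cluster of a vertex in its \<open>n\<close>-block and call the vertex alive as long as
  \<open>x\<close> has stayed above a small constant. The expectation of \<open>n powr - (q * x)\<close> over alive vertices is shown
  inductively to be at most \<open>n powr - r\<close> with \<open>1 < r < q < a\<close>: a union bound over the set of large sibling
  clusters that get absorbed reduces the induction step to an elementary inequality for cut energies. The step
  needs sibling blocks in which most vertices are alive, and a recursion for the variance of the fraction of
  dead vertices shows that other blocks are rare. Hence the probability of dying at level \<open>n\<close> is summable. Finitely many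
  small scales are made almost fully connected by enlarging the kernel there.\<close>

section \<open>Finite Bernoulli configurations\<close>

text \<open>Put \<lambda> = ln (ln (L ^ n)). The factor \<open>N\<close> in the kernel is a
  normalisation: a vertex sends edges to level l at rate about a * \<lambda> * (N - 1) / N^l, these
  rates telescope over l > n to a * \<lambda> / N^n, and the N^n vertices of a block give the
  exponent a * \<lambda>. Both directions must break a tie. For limsup 1 the exponent alone would be
  1 up to an arbitrarily small error; useless vertices, whose density can be bounded below before
  that error is chosen, make it smaller than 1. In the other direction, an exponent q * x that is
  linear in the density x only reproduces itself over one level if q = a and nothing is absorbed:
  the cost a * (1 - 1/N) * x of staying alone plus the exponent q * x / N of the diluted cluster.
  The gain thus comes from q < a, or else from the absorbed mass. A second obstacle is circularity:
  the step for one cluster needs most vertices of other blocks to be alive. Therefore the bounds on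
  one cluster, on its death and on the variance of the dead fraction are carried through a single
  induction, uniformly in the vertex.\<close>

definition bernoulli_weight :: "('e \<Rightarrow> real) \<Rightarrow> 'e set \<Rightarrow> 'e set \<Rightarrow> real" where
  "bernoulli_weight J A X = (\<Prod>e\<in>X. 1 - exp (- J e)) * (\<Prod>e\<in>A - X. exp (- J e))"

text \<open>A finite sum in place of an integral: conditioning on part of the edges becomes iterated
  summation, free of measurability conditions.\<close>

definition bernoulli_ex :: "('e \<Rightarrow> real) \<Rightarrow> 'e set \<Rightarrow> ('e set \<Rightarrow> real) \<Rightarrow> real" where
  "bernoulli_ex J A f = (\<Sum>X\<in>Pow A. bernoulli_weight J A X * f X)"

definition depends_on :: "'e set \<Rightarrow> ('e set \<Rightarrow> 'b) \<Rightarrow> bool" where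
  "depends_on A f \<longleftrightarrow> (\<forall>X. f X = f (X \<inter> A))"

lemma depD: "depends_on A f \<Longrightarrow> f (X \<inter> A) = f X"
  by (simp add: depends_on_def)

lemma depends_on_mono: "depends_on A f \<Longrightarrow> A \<subseteq> B \<Longrightarrow> depends_on B f"
  unfolding depends_on_def by (metis Int_absorb1 inf_assoc inf_commute)

lemma bernoulli_ex_add: "bernoulli_ex J A (\<lambda>X. f X + g X) = bernoulli_ex J A f + bernoulli_ex J A g"
  by (simp add: bernoulli_ex_def algebra_simps sum.distrib)

lemma bernoulli_ex_diff: "bernoulli_ex J A (\<lambda>X. f X - g X) = bernoulli_ex J A f - bernoulli_ex J A g"
  by (simp add: bernoulli_ex_def algebra_simps sum_subtractf)

lemma bernoulli_ex_cmult: "bernoulli_ex J A (\<lambda>X. c * f X) = c * bernoulli_ex J A f"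
  by (simp add: bernoulli_ex_def sum_distrib_left algebra_simps)

lemma bernoulli_ex_cdiv: "bernoulli_ex J A (\<lambda>X. f X / c) = bernoulli_ex J A f / c"
  using bernoulli_ex_cmult[of J A "1/c" f] by simp

lemma bernoulli_ex_sum: "bernoulli_ex J A (\<lambda>X. \<Sum>i\<in>I. f i X) = (\<Sum>i\<in>I. bernoulli_ex J A (f i))"
  unfolding bernoulli_ex_def by (simp add: sum_distrib_left) (rule sum.swap)

lemma bernoulli_ex_cong: "(\<And>X. X \<subseteq> A \<Longrightarrow> f X = g X) \<Longrightarrow> bernoulli_ex J A f = bernoulli_ex J A g"
  unfolding bernoulli_ex_def by (rule sum.cong) auto

lemma bernoulli_weight_nonneg:
  assumes "\<And>e. 0 \<le> J e" shows "0 \<le> bernoulli_weight J A X"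
  unfolding bernoulli_weight_def by (intro mult_nonneg_nonneg prod_nonneg) (use assms in auto)

lemma bernoulli_ex_mono:
  assumes "\<And>e. 0 \<le> J e" "\<And>X. X \<subseteq> A \<Longrightarrow> f X \<le> g X"
  shows "bernoulli_ex J A f \<le> bernoulli_ex J A g"
  unfolding bernoulli_ex_def by (intro sum_mono mult_left_mono bernoulli_weight_nonneg) (use assms in auto)

lemma bernoulli_ex_const:
  assumes "finite A" shows "bernoulli_ex J A (\<lambda>_. c) = c"
proof -
  have "(\<Sum>X\<in>Pow A. bernoulli_weight J A X) = (\<Prod>e\<in>A. (1 - exp (- J e)) + exp (- J e))"
    unfolding bernoulli_weight_def using prod_add[OF assms, of "\<lambda>e. 1 - exp (- J e)" "\<lambda>e. exp (- J e)"] by simp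
  then show ?thesis by (simp add: bernoulli_ex_def sum_distrib_right[symmetric])
qed

lemma bernoulli_ex_le_const:
  assumes "finite A" "\<And>e. 0 \<le> J e" "\<And>X. X \<subseteq> A \<Longrightarrow> f X \<le> c"
  shows "bernoulli_ex J A f \<le> c"
  using bernoulli_ex_mono[of J A f "\<lambda>_. c"] assms bernoulli_ex_const[OF assms(1), of J c] by simp

text \<open>Fubini for independent edges: the union map on \<open>Pow A \<times> Pow B\<close> is a
  bijection and the weight factors along it. Used as conditioning on the configuration in
  \<open>A\<close>.\<close>

lemma bernoulli_ex_Un:
  assumes "finite A" "finite B" "A \<inter> B = {}"
  shows "bernoulli_ex J (A \<union> B) f = bernoulli_ex J A (\<lambda>X. bernoulli_ex J B (\<lambda>Y. f (X \<union> Y)))"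
proof -
  have wt: "bernoulli_weight J (A \<union> B) (X \<union> Y) = bernoulli_weight J A X * bernoulli_weight J B Y" if "X \<subseteq> A" "Y \<subseteq> B" for X Y
  proof -
    have "finite X" "finite Y" "X \<inter> Y = {}" using that assms finite_subset by blast+
    moreover have "A \<union> B - (X \<union> Y) = (A - X) \<union> (B - Y)" using that assms(3) by blast
    moreover have "(A - X) \<inter> (B - Y) = {}" using assms(3) by blast
    ultimately show ?thesis using assms(1,2)
      by (simp add: bernoulli_weight_def prod.union_disjoint)
  qed
  have "bij_betw (\<lambda>(X,Y). X \<union> Y) (Pow A \<times> Pow B) (Pow (A \<union> B))"
    by (rule bij_betwI[where g = "\<lambda>Z. (Z \<inter> A, Z \<inter> B)"]) (use assms(3) in auto)
  then have "bernoulli_ex J (A \<union> B) f = (\<Sum>(X,Y)\<in>Pow A \<times> Pow B. bernoulli_weight J (A \<union> B) (X \<union> Y) * f (X \<union> Y))"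
    unfolding bernoulli_ex_def by (subst sum.reindex_bij_betw[symmetric]) (auto simp: case_prod_unfold)
  also have "\<dots> = (\<Sum>X\<in>Pow A. \<Sum>Y\<in>Pow B. bernoulli_weight J A X * (bernoulli_weight J B Y * f (X \<union> Y)))"
    by (subst sum.cartesian_product[symmetric]) (intro sum.cong refl, use wt in auto)
  finally show ?thesis by (simp add: bernoulli_ex_def sum_distrib_left)
qed

text \<open>The remaining edges sum out to 1. Hence an event has the same probability in every
  finite box containing its edges, which lets the box grow with the scale.\<close>

lemma bernoulli_ex_depends_on:
  assumes "finite B" "A \<subseteq> B" "depends_on A f"
  shows "bernoulli_ex J B f = bernoulli_ex J A f"
proof -
  have f: "finite A" "finite (B - A)" and d: "A \<inter> (B - A) = {}" using assms finite_subset by auto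
  have "B = A \<union> (B - A)" using assms by auto
  then have "bernoulli_ex J B f = bernoulli_ex J A (\<lambda>X. bernoulli_ex J (B - A) (\<lambda>Y. f (X \<union> Y)))"
    using bernoulli_ex_Un[OF f d, of J f] by simp
  also have "\<dots> = bernoulli_ex J A (\<lambda>X. bernoulli_ex J (B - A) (\<lambda>Y. f X))"
  proof (intro bernoulli_ex_cong)
    fix X Y assume "X \<subseteq> A" "Y \<subseteq> B - A"
    then have "(X \<union> Y) \<inter> A = X" by auto
    then show "f (X \<union> Y) = f X" using depD[OF assms(3), of "X \<union> Y"] by simp
  qed
  finally show ?thesis by (simp add: bernoulli_ex_const f)
qed

lemma bernoulli_ex_indep:
  assumes "finite C" "A \<subseteq> C" "B \<subseteq> C" "A \<inter> B = {}" "depends_on A f" "depends_on B g"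
  shows "bernoulli_ex J C (\<lambda>X. f X * g X) = bernoulli_ex J C f * bernoulli_ex J C g"
proof -
  have fin: "finite A" "finite B" using assms(1-3) finite_subset by blast+
  have "depends_on (A \<union> B) (\<lambda>X. f X * g X)"
    using depends_on_mono[OF assms(5), of "A \<union> B"] depends_on_mono[OF assms(6), of "A \<union> B"]
    unfolding depends_on_def by auto
  then have "bernoulli_ex J C (\<lambda>X. f X * g X) = bernoulli_ex J (A \<union> B) (\<lambda>X. f X * g X)"
    using assms by (intro bernoulli_ex_depends_on) auto
  also have "\<dots> = bernoulli_ex J A (\<lambda>X. bernoulli_ex J B (\<lambda>Y. f (X \<union> Y) * g (X \<union> Y)))"
    by (rule bernoulli_ex_Un) (use fin assms in auto)
  also have "\<dots> = bernoulli_ex J A (\<lambda>X. bernoulli_ex J B (\<lambda>Y. f X * g Y))"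
  proof (intro bernoulli_ex_cong)
    fix X Y assume "X \<subseteq> A" "Y \<subseteq> B"
    then have "(X \<union> Y) \<inter> A = X" "(X \<union> Y) \<inter> B = Y" using assms(4) by auto
    then show "f (X \<union> Y) * g (X \<union> Y) = f X * g Y"
      using depD[OF assms(5), of "X \<union> Y"] depD[OF assms(6), of "X \<union> Y"] by simp
  qed
  also have "\<dots> = bernoulli_ex J A f * bernoulli_ex J B g"
    by (simp add: bernoulli_ex_cmult) (simp add: bernoulli_ex_cmult mult.commute[of _ "bernoulli_ex J B g"])
  finally show ?thesis using bernoulli_ex_depends_on[OF assms(1,2,5)] bernoulli_ex_depends_on[OF assms(1,3,6)] by simp
qed

lemma bernoulli_ex_closed:
  assumes "finite A" "S \<subseteq> A"
  shows "bernoulli_ex J A (\<lambda>X. of_bool (X \<inter> S = {})) = exp (- (\<Sum>e\<in>S. J e))"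
proof -
  have fS: "finite S" using assms finite_subset by auto
  have "bernoulli_ex J A (\<lambda>X. of_bool (X \<inter> S = {})) = bernoulli_ex J S (\<lambda>X. of_bool (X \<inter> S = {}))"
    by (rule bernoulli_ex_depends_on) (use assms in \<open>auto simp: depends_on_def\<close>)
  also have "\<dots> = (\<Sum>X\<in>Pow S. if X = {} then bernoulli_weight J S {} else 0)"
    unfolding bernoulli_ex_def by (rule sum.cong) auto
  also have "\<dots> = bernoulli_weight J S {}" using fS by simp
  also have "\<dots> = exp (- (\<Sum>e\<in>S. J e))"
    by (simp add: bernoulli_weight_def sum_negf[symmetric] exp_sum fS)
  finally show ?thesis .
qed

lemma bernoulli_ex_open_le:
  assumes "finite A" "S \<subseteq> A" "\<And>e. 0 \<le> J e"
  shows "bernoulli_ex J A (\<lambda>X. of_bool (X \<inter> S \<noteq> {})) \<le> (\<Sum>e\<in>S. J e)"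
proof -
  have "bernoulli_ex J A (\<lambda>X. of_bool (X \<inter> S \<noteq> {})) = bernoulli_ex J A (\<lambda>X. 1 - of_bool (X \<inter> S = {}))"
    by (rule bernoulli_ex_cong) auto
  also have "\<dots> = 1 - exp (- (\<Sum>e\<in>S. J e))"
    by (simp only: bernoulli_ex_diff bernoulli_ex_const[OF assms(1)] bernoulli_ex_closed[OF assms(1,2)])
  also have "\<dots> \<le> (\<Sum>e\<in>S. J e)"
    using exp_ge_add_one_self[of "- (\<Sum>e\<in>S. J e)"] by simp
  finally show ?thesis .
qed

text \<open>Jensen's inequality: integrate the tangent of \<open>exp\<close> at the mean.\<close>
lemma bernoulli_ex_exp_ge:
  assumes "finite A" "\<And>e. 0 \<le> J e"
  shows "exp (- bernoulli_ex J A f) \<le> bernoulli_ex J A (\<lambda>X. exp (- f X))"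
proof -
  define m where "m = bernoulli_ex J A f"
  have "exp (- m) = bernoulli_ex J A (\<lambda>X. exp (- m) * ((1 + m) - f X))"
    by (simp only: bernoulli_ex_cmult bernoulli_ex_diff bernoulli_ex_const[OF assms(1)]) (simp add: m_def)
  also have "\<dots> \<le> bernoulli_ex J A (\<lambda>X. exp (- f X))"
  proof (rule bernoulli_ex_mono[OF assms(2)])
    fix X
    have "exp (- m) * (1 + (m - f X)) \<le> exp (- m) * exp (m - f X)"
      by (intro mult_left_mono exp_ge_add_one_self) auto
    then show "exp (- m) * ((1 + m) - f X) \<le> exp (- f X)"
      by (simp add: mult_exp_exp algebra_simps)
  qed
  finally show ?thesis by (simp add: m_def)
qed

lemma bernoulli_ex_nonneg:
  assumes "\<And>e. 0 \<le> J e" "\<And>X. X \<subseteq> A \<Longrightarrow> 0 \<le> f X"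
  shows "0 \<le> bernoulli_ex J A f"
  unfolding bernoulli_ex_def by (intro sum_nonneg mult_nonneg_nonneg bernoulli_weight_nonneg) (use assms in auto)

section \<open>Blocks and clusters\<close>

text \<open>Paths are confined to \<open>B\<close>, so in a finite block the cluster is decided by
  finitely many edges; the cluster in the whole lattice is recovered as the increasing union over
  blocks.\<close>

definition cluster_in :: "'v set set \<Rightarrow> 'v set \<Rightarrow> 'v \<Rightarrow> 'v set" where
  "cluster_in X B v = {y. (v, y) \<in> {(x, y). x \<in> B \<and> y \<in> B \<and> {x, y} \<in> X}\<^sup>*}"

lemma cluster_in_refl [simp]: "v \<in> cluster_in X B v"
  by (simp add: cluster_in_def)

lemma cluster_in_step: "u \<in> cluster_in X B v \<Longrightarrow> u \<in> B \<Longrightarrow> w \<in> B \<Longrightarrow> {u, w} \<in> X \<Longrightarrow> w \<in> cluster_in X B v"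
  unfolding cluster_in_def mem_Collect_eq by (erule rtrancl_into_rtrancl) simp

lemma cluster_in_induct [consumes 1, case_names base step]:
  assumes "y \<in> cluster_in X B v" "P v"
    "\<And>u w. u \<in> cluster_in X B v \<Longrightarrow> P u \<Longrightarrow> u \<in> B \<Longrightarrow> w \<in> B \<Longrightarrow> {u, w} \<in> X \<Longrightarrow> P w"
  shows "P y"
proof -
  have "(v, y) \<in> {(x, y). x \<in> B \<and> y \<in> B \<and> {x, y} \<in> X}\<^sup>*" using assms(1) by (simp add: cluster_in_def)
  then show ?thesis
  proof (induction rule: rtrancl_induct)
    case base then show ?case by (rule assms(2))
  next
    case (step y z)
    then show ?case by (intro assms(3)[of y z]) (auto simp: cluster_in_def)
  qed
qed

lemma cluster_in_subset: "v \<in> B \<Longrightarrow> cluster_in X B v \<subseteq> B"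
proof
  fix y assume v: "v \<in> B" and y: "y \<in> cluster_in X B v"
  from y show "y \<in> B"
  proof (induction rule: cluster_in_induct)
    case base show ?case by (rule v)
  next
    case (step u w) show ?case by (rule \<open>w \<in> B\<close>)
  qed
qed

lemma cluster_in_mono: "X \<subseteq> Y \<Longrightarrow> B \<subseteq> C \<Longrightarrow> cluster_in X B v \<subseteq> cluster_in Y C v"
proof
  assume "X \<subseteq> Y" "B \<subseteq> C"
  then have "{(x, y). x \<in> B \<and> y \<in> B \<and> {x, y} \<in> X}\<^sup>* \<subseteq> {(x, y). x \<in> C \<and> y \<in> C \<and> {x, y} \<in> Y}\<^sup>*"
    by (intro rtrancl_mono) auto
  then show "\<And>y. y \<in> cluster_in X B v \<Longrightarrow> y \<in> cluster_in Y C v" unfolding cluster_in_def by blast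
qed

lemma cluster_in_sym: "w \<in> cluster_in X B v \<longleftrightarrow> v \<in> cluster_in X B w"
proof -
  have "sym {(x, y). x \<in> B \<and> y \<in> B \<and> {x, y} \<in> X}"
    by (auto simp: sym_def insert_commute)
  then have "sym ({(x, y). x \<in> B \<and> y \<in> B \<and> {x, y} \<in> X}\<^sup>*)" by (rule sym_rtrancl)
  then show ?thesis unfolding cluster_in_def sym_def by blast
qed

lemma cluster_in_trans: "u \<in> cluster_in X B v \<Longrightarrow> w \<in> cluster_in X B u \<Longrightarrow> w \<in> cluster_in X B v"
  unfolding cluster_in_def mem_Collect_eq by (rule rtrancl_trans)

lemma cluster_in_eq: "w \<in> cluster_in X B v \<Longrightarrow> cluster_in X B w = cluster_in X B v"
  using cluster_in_trans[of w X B v] cluster_in_trans[of v X B w] cluster_in_sym[of w X B v] by blast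

lemma depends_on_cluster_in: "depends_on {e. e \<subseteq> B} (\<lambda>X. cluster_in X B v)"
  unfolding depends_on_def
proof
  fix X
  have "{(x, y). x \<in> B \<and> y \<in> B \<and> {x, y} \<in> X} = {(x, y). x \<in> B \<and> y \<in> B \<and> {x, y} \<in> X \<inter> {e. e \<subseteq> B}}"
    by auto
  then show "cluster_in X B v = cluster_in (X \<inter> {e. e \<subseteq> B}) B v" unfolding cluster_in_def by simp
qed

section \<open>Blocks, which are the closed balls of the ultrametric, and levels of edges\<close>

definition block :: "nat \<Rightarrow> nat \<Rightarrow> nat \<Rightarrow> hvertex \<Rightarrow> hvertex set" where
  "block d L n v = {w \<in> hvert d L. \<forall>i>n. w i = v i}"

definition subblocks :: "nat \<Rightarrow> nat \<Rightarrow> nat \<Rightarrow> hvertex \<Rightarrow> hvertex set set" where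
  "subblocks d L n v = block d L n ` block d L (Suc n) v"

definition edges_in :: "nat \<Rightarrow> nat \<Rightarrow> hvertex set \<Rightarrow> hvertex set set" where
  "edges_in d L B = {e \<in> hedges d L. e \<subseteq> B}"

lemma block_hvert: "w \<in> block d L n v \<Longrightarrow> w \<in> hvert d L"
  by (simp add: block_def)

lemma block_self [simp]: "v \<in> hvert d L \<Longrightarrow> v \<in> block d L n v"
  by (simp add: block_def)

lemma block_eq: "w \<in> block d L n v \<Longrightarrow> block d L n w = block d L n v"
  by (auto simp: block_def)

lemma block_sym: "v \<in> hvert d L \<Longrightarrow> w \<in> block d L n v \<Longrightarrow> v \<in> block d L n w"
  by (auto simp: block_def)

lemma block_disjoint: "block d L n v \<noteq> block d L n w \<Longrightarrow> block d L n v \<inter> block d L n w = {}"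
  by (metis block_eq disjoint_iff)

lemma block_mono: "n \<le> m \<Longrightarrow> block d L n v \<subseteq> block d L m v"
  by (auto simp: block_def)

lemma edges_in_mono: "B \<subseteq> C \<Longrightarrow> edges_in d L B \<subseteq> edges_in d L C"
  by (auto simp: edges_in_def)

lemma depends_on_edges_in: "depends_on {e. e \<subseteq> B} f \<Longrightarrow> (\<And>X. f X = f (X \<inter> hedges d L)) \<Longrightarrow> depends_on (edges_in d L B) f"
  unfolding depends_on_def
proof
  fix X assume d: "\<forall>X. f X = f (X \<inter> {e. e \<subseteq> B})" and h: "\<And>X. f X = f (X \<inter> hedges d L)"
  have "X \<inter> edges_in d L B = (X \<inter> hedges d L) \<inter> {e. e \<subseteq> B}" by (auto simp: edges_in_def)
  then show "f X = f (X \<inter> edges_in d L B)" using d h by metis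
qed

lemma edge_iff: "{u, w} \<in> hedges d L \<longleftrightarrow> u \<in> hvert d L \<and> w \<in> hvert d L \<and> u \<noteq> w"
  by (auto simp: hedges_def doubleton_eq_iff)

text \<open>Bridge from the \<open>Max\<close> in \<open>elevel\<close> to membership in a ball.
  Finite support of the vertices and \<open>u \<noteq> w\<close> make the set under
  \<open>Max\<close> finite and nonempty.\<close>

lemma elevel_le_iff:
  assumes "u \<in> hvert d L" "w \<in> hvert d L" "u \<noteq> w"
  shows "elevel {u, w} \<le> n \<longleftrightarrow> w \<in> block d L n u"
proof -
  have eq: "{i. \<exists>x\<in>{u,w}. \<exists>y\<in>{u,w}. x i \<noteq> y i} = {i. u i \<noteq> w i}" by auto
  have "{i. u i \<noteq> w i} \<subseteq> {i. u i \<noteq> (\<lambda>_. 0)} \<union> {i. w i \<noteq> (\<lambda>_. 0)}" by auto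
  moreover have "finite ({i. u i \<noteq> (\<lambda>_. 0)} \<union> {i. w i \<noteq> (\<lambda>_. 0)})"
    using assms by (simp add: hvert_def)
  ultimately have fin: "finite {i. u i \<noteq> w i}" by (rule finite_subset)
  have ne: "{i. u i \<noteq> w i} \<noteq> {}" using assms(3) by auto
  have "elevel {u, w} \<le> n \<longleftrightarrow> (\<forall>i\<in>{i. u i \<noteq> w i}. i \<le> n)"
    unfolding elevel_def eq using fin ne by (rule Max_le_iff)
  also have "\<dots> \<longleftrightarrow> w \<in> block d L n u"
    using assms by (auto simp: block_def not_le[symmetric])
  finally show ?thesis .
qed

lemma elevel_edges_in: "e \<in> edges_in d L (block d L n v) \<Longrightarrow> elevel e \<le> n"
proof -
  assume e: "e \<in> edges_in d L (block d L n v)"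
  then obtain x y where xy: "e = {x, y}" "x \<in> hvert d L" "y \<in> hvert d L" "x \<noteq> y"
    by (auto simp: edges_in_def hedges_def)
  then have "x \<in> block d L n v" "y \<in> block d L n v" using e by (auto simp: edges_in_def)
  then have "y \<in> block d L n x" using block_eq by blast
  then show ?thesis using xy elevel_le_iff by simp
qed

lemma elevel_Suc:
  assumes "w \<in> block d L (Suc n) u" "u \<in> hvert d L" "w \<notin> block d L n u"
  shows "elevel {u, w} = Suc n"
proof -
  have "u \<noteq> w" using assms by auto
  then have "elevel {u, w} \<le> Suc n" "\<not> elevel {u, w} \<le> n"
    using elevel_le_iff[of u d L w] assms block_hvert[OF assms(1)] by auto
  then show ?thesis by simp
qed

definition digits :: "nat \<Rightarrow> nat \<Rightarrow> (nat \<Rightarrow> nat) set" where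
  "digits d L = {g. \<forall>j. g j < L \<and> (d \<le> j \<longrightarrow> g j = 0)}"

lemma card_digits: "2 \<le> L \<Longrightarrow> finite (digits d L) \<and> card (digits d L) = L ^ d"
proof -
  assume L: "2 \<le> L"
  have b: "bij_betw (\<lambda>g. restrict g {..<d}) (digits d L) (PiE {..<d} (\<lambda>_. {..<L}))"
  proof (rule bij_betwI[where g = "\<lambda>h j. if j < d then h j else 0"])
    show "(\<lambda>g. restrict g {..<d}) \<in> digits d L \<rightarrow> PiE {..<d} (\<lambda>_. {..<L})"
      by (auto simp: digits_def)
    show "(\<lambda>h j. if j < d then h j else 0) \<in> PiE {..<d} (\<lambda>_. {..<L}) \<rightarrow> digits d L"
      using L by (auto simp: PiE_def Pi_def digits_def)
  qed (auto simp: fun_eq_iff not_less PiE_def extensional_def digits_def)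
  show ?thesis using bij_betw_same_card[OF b] bij_betw_finite[OF b] by (simp add: card_PiE finite_PiE)
qed

lemma upd_hvert:
  assumes "v \<in> hvert d L" "t \<in> digits d L"
  shows "v(Suc n := t) \<in> hvert d L"
proof -
  have "{i. (v(Suc n := t)) i \<noteq> (\<lambda>_. 0)} \<subseteq> insert (Suc n) {i. v i \<noteq> (\<lambda>_. 0)}" by auto
  moreover have "finite (insert (Suc n) {i. v i \<noteq> (\<lambda>_. 0)})" using assms by (simp add: hvert_def)
  ultimately have "finite {i. (v(Suc n := t)) i \<noteq> (\<lambda>_. 0)}" by (rule finite_subset)
  moreover have "(v(Suc n := t)) i j < L \<and> (d \<le> j \<longrightarrow> (v(Suc n := t)) i j = 0)
      \<and> (i = 0 \<longrightarrow> (v(Suc n := t)) i j = 0)" for i j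
    using assms by (cases "i = Suc n") (simp_all add: hvert_def digits_def)
  ultimately show ?thesis unfolding hvert_def by blast
qed

lemma block_Suc_fibre: "block d L (Suc n) v = (\<Union>t\<in>digits d L. block d L n (v(Suc n := t)))"
proof (intro equalityI subsetI)
  fix w assume w: "w \<in> block d L (Suc n) v"
  then have "w (Suc n) \<in> digits d L" by (simp add: block_def hvert_def digits_def)
  moreover have "w \<in> block d L n (v(Suc n := w (Suc n)))" using w by (auto simp: block_def)
  ultimately show "w \<in> (\<Union>t\<in>digits d L. block d L n (v(Suc n := t)))" by blast
next
  fix w assume "w \<in> (\<Union>t\<in>digits d L. block d L n (v(Suc n := t)))"
  then obtain t where "w \<in> block d L n (v(Suc n := t))" by blast
  then show "w \<in> block d L (Suc n) v" by (simp add: block_def)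
qed

lemma card_block:
  assumes "2 \<le> L" "v \<in> hvert d L"
  shows "finite (block d L n v) \<and> card (block d L n v) = (L ^ d) ^ n"
  using assms(2)
proof (induction n arbitrary: v)
  case 0
  have "block d L 0 v = {v}"
  proof (intro equalityI subsetI)
    fix w assume w: "w \<in> block d L 0 v"
    have "w 0 = v 0" using w 0 by (auto simp: block_def hvert_def)
    then have "w i = v i" for i using w by (cases i) (auto simp: block_def)
    then show "w \<in> {v}" by auto
  qed (use 0 in auto)
  then show ?case by simp
next
  case (Suc n)
  note D = card_digits[OF assms(1), of d]
  have IH: "finite (block d L n (v(Suc n := t))) \<and> card (block d L n (v(Suc n := t))) = (L ^ d) ^ n"
    if "t \<in> digits d L" for t
    by (rule Suc.IH[OF upd_hvert[OF Suc.prems that]])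
  have "card (\<Union>t\<in>digits d L. block d L n (v(Suc n := t))) = (\<Sum>t\<in>digits d L. card (block d L n (v(Suc n := t))))"
  proof (rule card_UN_disjoint)
    show "\<forall>i\<in>digits d L. \<forall>k\<in>digits d L. i \<noteq> k \<longrightarrow> block d L n (v(Suc n := i)) \<inter> block d L n (v(Suc n := k)) = {}"
      by (auto simp: block_def)
  qed (use D IH in auto)
  also have "\<dots> = (\<Sum>t\<in>digits d L. (L ^ d) ^ n)" by (rule sum.cong) (use IH in blast)+
  also have "\<dots> = (L ^ d) ^ Suc n" using D by simp
  finally have c: "card (block d L (Suc n) v) = (L ^ d) ^ Suc n" unfolding block_Suc_fibre[of d L n v] .
  have "finite (block d L (Suc n) v)" unfolding block_Suc_fibre[of d L n v] using D IH by blast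
  then show ?case using c by blast
qed

section \<open>Volumes of blocks and exhaustion of the lattice\<close>

locale hier_lattice =
  fixes d L :: nat
  assumes d1: "1 \<le> d" and L2: "2 \<le> L"
begin

abbreviation "V \<equiv> hvert d L"
abbreviation "B \<equiv> block d L"
abbreviation "E \<equiv> \<lambda>n v. edges_in d L (block d L n v)"
abbreviation "N \<equiv> real L ^ d"

lemma N2: "2 \<le> N"
proof -
  have "(2::real) \<le> real L" using L2 by simp
  also have "\<dots> \<le> N" using d1 L2 by (intro self_le_power) auto
  finally show ?thesis .
qed

lemma N0: "0 < N" using N2 by linarith

lemma finite_B [simp]: "v \<in> V \<Longrightarrow> finite (B n v)"
  and card_B: "v \<in> V \<Longrightarrow> real (card (B n v)) = N ^ n"
  using card_block[OF L2, of v d n] by auto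

lemma finite_E [simp]: "v \<in> V \<Longrightarrow> finite (E n v)"
  by (rule finite_subset[of _ "Pow (B n v)"]) (auto simp: edges_in_def)

lemma horigin_V [simp]: "horigin \<in> V"
  using L2 by (auto simp: hvert_def horigin_def)

lemma subblocks_props:
  assumes "v \<in> V"
  shows "finite (subblocks d L n v)" "\<Union>(subblocks d L n v) = B (Suc n) v"
    "\<And>c c'. c \<in> subblocks d L n v \<Longrightarrow> c' \<in> subblocks d L n v \<Longrightarrow> c \<noteq> c' \<Longrightarrow> c \<inter> c' = {}"
    "\<And>c. c \<in> subblocks d L n v \<Longrightarrow> finite c \<and> real (card c) = N ^ n"
    "real (card (subblocks d L n v)) = N"
    "B n v \<in> subblocks d L n v"
proof -
  show f: "finite (subblocks d L n v)" using assms by (simp add: subblocks_def)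
  show u: "\<Union>(subblocks d L n v) = B (Suc n) v"
  proof (intro equalityI subsetI)
    fix w assume "w \<in> \<Union>(subblocks d L n v)"
    then obtain x where x: "x \<in> B (Suc n) v" "w \<in> B n x" by (auto simp: subblocks_def)
    have "w \<in> B (Suc n) x" using x(2) block_mono[of n "Suc n"] by auto
    then show "w \<in> B (Suc n) v" using block_eq[OF x(1)] by simp
  next
    fix w assume "w \<in> B (Suc n) v"
    then show "w \<in> \<Union>(subblocks d L n v)" by (auto simp: subblocks_def intro!: bexI[of _ w] dest: block_hvert)
  qed
  show dj: "\<And>c c'. c \<in> subblocks d L n v \<Longrightarrow> c' \<in> subblocks d L n v \<Longrightarrow> c \<noteq> c' \<Longrightarrow> c \<inter> c' = {}"
    unfolding subblocks_def using block_disjoint by blast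
  show c: "\<And>c. c \<in> subblocks d L n v \<Longrightarrow> finite c \<and> real (card c) = N ^ n"
    by (auto simp: subblocks_def card_B dest: block_hvert)
  \<comment> \<open>Dividing the volumes of the two kinds of blocks yields the number of subblocks,
    without exhibiting a bijection with \<open>digits d L\<close>.\<close>
  have "real (card (B (Suc n) v)) = (\<Sum>c\<in>subblocks d L n v. real (card c))"
    unfolding u[symmetric] using f c dj by (subst card_Union_disjoint) (auto simp: pairwise_def disjnt_def)
  also have "\<dots> = real (card (subblocks d L n v)) * N ^ n" using c by simp
  finally show "real (card (subblocks d L n v)) = N"
    using card_B[OF assms, of "Suc n"] N0
    by (metis mult_cancel_right power_Suc zero_less_power less_numeral_extra(3))
  show "B n v \<in> subblocks d L n v" using assms by (auto simp: subblocks_def)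
qed

text \<open>Decompose the annulus into spheres: \<open>elevel {x, y}\<close> is constantly
  \<open>l\<close> on \<open>B l x - B (l - 1) x\<close>, which has
  \<open>N ^ l - N ^ (l - 1)\<close> points.\<close>

lemma sum_annulus:
  assumes "x \<in> V" "m \<le> M"
  shows "(\<Sum>y\<in>B M x - B m x. f (elevel {x, y})) = (\<Sum>l\<in>{Suc m..M}. (N ^ l - N ^ (l - 1)) * f l)"
  using assms(2)
proof (induction M rule: dec_induct)
  case base then show ?case by simp
next
  case (step M)
  have sub: "B m x \<subseteq> B M x" "B M x \<subseteq> B (Suc M) x" using step block_mono by auto
  then have un: "B (Suc M) x - B m x = (B M x - B m x) \<union> (B (Suc M) x - B M x)" by auto
  have "(\<Sum>y\<in>B (Suc M) x - B m x. f (elevel {x, y}))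
     = (\<Sum>y\<in>B M x - B m x. f (elevel {x, y})) + (\<Sum>y\<in>B (Suc M) x - B M x. f (elevel {x, y}))"
    unfolding un using assms(1) by (intro sum.union_disjoint) auto
  also have "(\<Sum>y\<in>B (Suc M) x - B M x. f (elevel {x, y})) = (\<Sum>y\<in>B (Suc M) x - B M x. f (Suc M))"
    using elevel_Suc assms(1) by (intro sum.cong) auto
  also have "\<dots> = (N ^ Suc M - N ^ M) * f (Suc M)"
    using assms(1) sub by (simp add: card_Diff_subset of_nat_diff card_mono card_B)
  finally show ?case using step by simp
qed

lemma V_exhaust:
  assumes "finite S" "S \<subseteq> V" "v \<in> V" shows "\<exists>n. S \<subseteq> B n v"
  using assms
proof (induction S)
  case empty then show ?case by simp
next
  case (insert w S)
  then obtain n where n: "S \<subseteq> B n v" by auto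
  have "\<exists>m. w \<in> B m v"
  proof (cases "w = v")
    case False
    then have "w \<in> B (elevel {v, w}) v" using elevel_le_iff[of v d L w "elevel {v, w}"] insert.prems by auto
    then show ?thesis by blast
  qed (use insert in auto)
  then obtain m where "w \<in> B m v" by blast
  then have "insert w S \<subseteq> B (max n m) v"
    using n block_mono[of n "max n m" d L v] block_mono[of m "max n m" d L v] by auto
  then show ?case by blast
qed

text \<open>A path is finite and so lies in some block; blocks are finite and exhaust the lattice,
  so a cluster is infinite exactly if no block contains it. In this form the event is a countable
  combination of events on finite edge sets.\<close>

lemma cluster0_infinite_iff:
  fixes \<omega> :: "hvertex set \<Rightarrow> bool"
  defines "X \<equiv> {e \<in> hedges d L. \<omega> e}"
  shows "infinite (cluster0 d L \<omega>) \<longleftrightarrow> (\<forall>T. \<exists>n. \<not> cluster_in X (B n horigin) horigin \<subseteq> B T horigin)"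
proof -
  have rel: "{(x, y). x \<in> V \<and> y \<in> V \<and> x \<noteq> y \<and> \<omega> {x, y}} = {(x, y). x \<in> V \<and> y \<in> V \<and> {x, y} \<in> X}"
    by (auto simp: X_def edge_iff)
  have c0: "cluster0 d L \<omega> = cluster_in X V horigin"
    unfolding cluster0_def cluster_in_def rel ..
  have un: "cluster_in X V horigin = (\<Union>n. cluster_in X (B n horigin) horigin)"
  proof (intro equalityI subsetI)
    fix y assume "y \<in> cluster_in X V horigin"
    then show "y \<in> (\<Union>n. cluster_in X (B n horigin) horigin)"
    proof (induction rule: cluster_in_induct)
      case base then show ?case by simp
    next
      case (step u w)
      then obtain n where n: "u \<in> cluster_in X (B n horigin) horigin" by auto
      obtain m where m: "{u, w} \<subseteq> B m horigin" using V_exhaust[of "{u,w}" horigin] step by auto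
      have "u \<in> cluster_in X (B (max n m) horigin) horigin"
        using n cluster_in_mono[of X X "B n horigin" "B (max n m) horigin"] block_mono[of n "max n m"] by auto
      moreover have "{u, w} \<subseteq> B (max n m) horigin" using m block_mono[of m "max n m" d L horigin] by auto
      ultimately have "w \<in> cluster_in X (B (max n m) horigin) horigin"
        using \<open>{u, w} \<in> X\<close> cluster_in_step[of u X "B (max n m) horigin" horigin w] by blast
      then show ?case by blast
    qed
  next
    fix y assume "y \<in> (\<Union>n. cluster_in X (B n horigin) horigin)"
    then obtain n where "y \<in> cluster_in X (B n horigin) horigin" by blast
    moreover have "B n horigin \<subseteq> V" using block_hvert by blast
    ultimately show "y \<in> cluster_in X V horigin" using cluster_in_mono[of X X "B n horigin" V horigin] by blast
  qed
  have sV: "cluster_in X V horigin \<subseteq> V" by (rule cluster_in_subset) simp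
  have "finite (cluster_in X V horigin) \<longleftrightarrow> (\<exists>T. cluster_in X V horigin \<subseteq> B T horigin)"
  proof
    assume "finite (cluster_in X V horigin)"
    then show "\<exists>T. cluster_in X V horigin \<subseteq> B T horigin" by (rule V_exhaust[OF _ sV horigin_V])
  next
    assume "\<exists>T. cluster_in X V horigin \<subseteq> B T horigin"
    then obtain T where "cluster_in X V horigin \<subseteq> B T horigin" ..
    then show "finite (cluster_in X V horigin)" by (rule finite_subset) simp
  qed
  then show ?thesis unfolding c0 un UN_subset_iff by simp
qed

end

section \<open>Cylinder events\<close>

locale hier_percolation = hier_lattice +
  fixes j :: "nat \<Rightarrow> real"
  assumes j0: "0 \<le> j n"
begin

abbreviation "J \<equiv> \<lambda>e. j (elevel e)"
abbreviation "ex \<equiv> bernoulli_ex (\<lambda>e. j (elevel e))"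
abbreviation "opn \<equiv> \<lambda>\<omega>. {e \<in> hedges d L. \<omega> e}"

lemma J0: "0 \<le> J e" by (rule j0)

text \<open>The event is a finite disjoint union of cylinders, one for each configuration
  \<open>X \<subseteq> A\<close> with \<open>P X\<close>, and the cylinder of \<open>X\<close> has
  measure \<open>bernoulli_weight J A X\<close>. This is the passage from the product measure to
  finite sums.\<close>

lemma prob_link:
  assumes A: "finite A" "A \<subseteq> hedges d L" and depends_on: "depends_on A P"
  shows "{\<omega> \<in> space (perc d L j). P (opn \<omega>)} \<in> sets (perc d L j)"
    and "measure (perc d L j) {\<omega> \<in> space (perc d L j). P (opn \<omega>)} = ex A (\<lambda>X. of_bool (P X))"
proof -
  let ?M = "\<lambda>e. measure_pmf (bernoulli_pmf (1 - exp (- j (elevel e))))"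
  interpret PP: product_prob_space ?M "hedges d L"
    by unfold_locales
  have M: "perc d L j = PiM (hedges d L) ?M" by (simp add: perc_def)
  define cyl where "cyl X = {\<omega> \<in> space (perc d L j). \<forall>e\<in>A. \<omega> e \<in> {e \<in> X}}" for X
  have cyl_sets: "cyl X \<in> sets (perc d L j)" for X
    unfolding cyl_def M
  proof (rule sets.sets_Collect_finite_All[OF _ A(1)])
    fix e assume "e \<in> A"
    then have "e \<in> hedges d L" using A by auto
    then show "{\<omega> \<in> space (PiM (hedges d L) ?M). \<omega> e \<in> {e \<in> X}} \<in> sets (PiM (hedges d L) ?M)"
      by (intro sets_Collect_single') auto
  qed
  have cyl_meas: "measure (perc d L j) (cyl X) = bernoulli_weight J A X" if "X \<subseteq> A" for X
  proof -
    have "emeasure (perc d L j) (cyl X) = (\<Prod>e\<in>A. emeasure (?M e) {e \<in> X})"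
      unfolding cyl_def M using A by (intro PP.emeasure_PiM_Collect) auto
    also have "\<dots> = (\<Prod>e\<in>A. ennreal (if e \<in> X then 1 - exp (- J e) else exp (- J e)))"
    proof (rule prod.cong[OF refl])
      fix e
      have "0 \<le> 1 - exp (- J e)" "1 - exp (- J e) \<le> 1" using j0[of "elevel e"] by auto
      then show "emeasure (?M e) {e \<in> X} = ennreal (if e \<in> X then 1 - exp (- J e) else exp (- J e))"
        by (auto simp: emeasure_pmf_single)
    qed
    also have "\<dots> = ennreal (\<Prod>e\<in>A. if e \<in> X then 1 - exp (- J e) else exp (- J e))"
      using j0 by (intro prod_ennreal) auto
    finally have "measure (perc d L j) (cyl X) = (\<Prod>e\<in>A. if e \<in> X then 1 - exp (- J e) else exp (- J e))"
      using j0 by (simp add: measure_def prod_nonneg)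
    also have "\<dots> = (\<Prod>e\<in>X. 1 - exp (- J e)) * (\<Prod>e\<in>A - X. exp (- J e))"
      using A(1) that by (simp add: prod.If_cases Int_absorb1 Diff_eq)
    finally show ?thesis by (simp add: bernoulli_weight_def)
  qed
  let ?S = "{X \<in> Pow A. P X}"
  have eq: "{\<omega> \<in> space (perc d L j). P (opn \<omega>)} = (\<Union>X\<in>?S. cyl X)"
  proof (intro equalityI subsetI)
    fix \<omega> assume w: "\<omega> \<in> {\<omega> \<in> space (perc d L j). P (opn \<omega>)}"
    define X where "X = opn \<omega> \<inter> A"
    have "P X" using w depD[OF depends_on, of "opn \<omega>"] by (simp add: X_def)
    moreover have "\<omega> \<in> cyl X" using w A by (auto simp: cyl_def X_def)
    moreover have "X \<subseteq> A" by (simp add: X_def)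
    ultimately show "\<omega> \<in> (\<Union>X\<in>?S. cyl X)" by blast
  next
    fix \<omega> assume "\<omega> \<in> (\<Union>X\<in>?S. cyl X)"
    then obtain X where X: "X \<subseteq> A" "P X" "\<omega> \<in> cyl X" by blast
    then have "opn \<omega> \<inter> A = X" using A by (auto simp: cyl_def)
    then have "P (opn \<omega>)" using X depD[OF depends_on, of "opn \<omega>"] by simp
    then show "\<omega> \<in> {\<omega> \<in> space (perc d L j). P (opn \<omega>)}" using X by (auto simp: cyl_def)
  qed
  have fS: "finite ?S" using A by simp
  show "{\<omega> \<in> space (perc d L j). P (opn \<omega>)} \<in> sets (perc d L j)"
    unfolding eq using fS cyl_sets by (intro sets.finite_UN) auto
  have "prob_space (perc d L j)" unfolding M by (rule PP.prob_space_axioms)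
  then interpret Q: prob_space "perc d L j" .
  have "measure (perc d L j) (\<Union>X\<in>?S. cyl X) = (\<Sum>X\<in>?S. measure (perc d L j) (cyl X))"
  proof (rule Q.finite_measure_finite_Union[OF fS])
    show "disjoint_family_on cyl ?S"
      by (auto simp: disjoint_family_on_def cyl_def set_eq_iff subset_eq)
  qed (use cyl_sets in auto)
  also have "\<dots> = (\<Sum>X\<in>?S. bernoulli_weight J A X)" using cyl_meas by (intro sum.cong) auto
  also have "\<dots> = ex A (\<lambda>X. of_bool (P X))"
    unfolding bernoulli_ex_def using A by (intro sum.mono_neutral_cong_left) auto
  finally show "measure (perc d L j) {\<omega> \<in> space (perc d L j). P (opn \<omega>)} = ex A (\<lambda>X. of_bool (P X))"
    unfolding eq .
qed

lemma prob_space_perc: "prob_space (perc d L j)"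
  unfolding perc_def by (intro prob_space_PiM) (rule measure_pmf.prob_space_axioms)

section \<open>The percolation event as a limit of events in finite blocks\<close>

lemma E_hedges: "E n v \<subseteq> hedges d L"
  by (auto simp: edges_in_def)

lemma depends_on_cluster_in_E: "depends_on (edges_in d L C) (\<lambda>X. cluster_in (X \<inter> hedges d L) C v)"
proof (rule depends_on_edges_in)
  show "depends_on {e. e \<subseteq> C} (\<lambda>X. cluster_in (X \<inter> hedges d L) C v)"
    unfolding depends_on_def
  proof
    fix X
    have "X \<inter> hedges d L \<inter> {e. e \<subseteq> C} = X \<inter> {e. e \<subseteq> C} \<inter> hedges d L" by blast
    then show "cluster_in (X \<inter> hedges d L) C v = cluster_in (X \<inter> {e. e \<subseteq> C} \<inter> hedges d L) C v"
      using depD[OF depends_on_cluster_in[of C v], of "X \<inter> hedges d L"] by simp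
  qed
qed (simp only: Int_assoc Int_absorb)

text \<open>Intersecting with \<open>hedges d L\<close> discards sets that are not edges, such as
  singletons, so that the event literally depends on \<open>E n horigin\<close> only.\<close>

definition leaves :: "nat \<Rightarrow> nat \<Rightarrow> hvertex set set \<Rightarrow> bool" where
  "leaves T n X \<longleftrightarrow> \<not> cluster_in (X \<inter> hedges d L) (B n horigin) horigin \<subseteq> B T horigin"

lemma depends_on_leaves: "depends_on (E n horigin) (leaves T n)"
  using depends_on_cluster_in_E[of "B n horigin" horigin] unfolding depends_on_def leaves_def by metis

lemma leaves_mono: "n \<le> m \<Longrightarrow> leaves T n X \<Longrightarrow> leaves T m X"
  unfolding leaves_def using cluster_in_mono[OF subset_refl block_mono, of n m] by blast

lemma perc_event_eq:
  "perc_event d L j = (\<Inter>T. \<Union>n. {\<omega> \<in> space (perc d L j). leaves T n (opn \<omega>)})"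
proof -
  have "opn \<omega> \<inter> hedges d L = opn \<omega>" for \<omega> by auto
  then show ?thesis
    unfolding perc_event_def leaves_def by (auto simp: cluster0_infinite_iff)
qed

lemma perc_event_sets: "perc_event d L j \<in> sets (perc d L j)"
  unfolding perc_event_eq
  using prob_link(1)[OF finite_E[OF horigin_V] E_hedges depends_on_leaves]
  by (intro sets.countable_INT sets.countable_UN) auto

text \<open>The events increase with the box, so a bound uniform in \<open>n\<close> survives the
  limit; escape from one block \<open>B T horigin\<close> is implied by an infinite cluster, so a
  single \<open>T\<close> suffices.\<close>

lemma perc_event_le:
  assumes "\<And>n. ex (E n horigin) (\<lambda>X. of_bool (leaves T n X)) \<le> \<eta>"
  shows "measure (perc d L j) (perc_event d L j) \<le> \<eta>"
proof -
  interpret Q: prob_space "perc d L j" by (rule prob_space_perc)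
  define A where "A n = {\<omega> \<in> space (perc d L j). leaves T n (opn \<omega>)}" for n
  note link = prob_link[OF finite_E[OF horigin_V] E_hedges depends_on_leaves]
  have m: "range A \<subseteq> sets (perc d L j)" using link(1) by (auto simp: A_def)
  have inc: "incseq A" unfolding incseq_def A_def using leaves_mono by blast
  have "measure (perc d L j) (perc_event d L j) \<le> measure (perc d L j) (\<Union>n. A n)"
    by (rule Q.finite_measure_mono) (use m in \<open>auto simp: perc_event_eq A_def\<close>)
  also have "\<dots> \<le> \<eta>"
    by (rule LIMSEQ_le_const2[OF Q.finite_Lim_measure_incseq[OF m inc]])
      (use assms in \<open>auto simp: A_def link(2)\<close>)
  finally show ?thesis .
qed

text \<open>Continuity from above along the decreasing events \<open>P n\<close>, whose intersection
  forces an infinite cluster.\<close>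

lemma perc_event_ge:
  assumes depends_on: "\<And>n. depends_on (E n horigin) (P n)" and dec: "\<And>n X. P (Suc n) X \<Longrightarrow> P n X"
    and inf: "\<And>X T. (\<And>n. P n X) \<Longrightarrow> \<exists>n. leaves T n X"
    and ge: "\<And>n. \<eta> \<le> ex (E n horigin) (\<lambda>X. of_bool (P n X))"
  shows "\<eta> \<le> measure (perc d L j) (perc_event d L j)"
proof -
  interpret Q: prob_space "perc d L j" by (rule prob_space_perc)
  define A where "A n = {\<omega> \<in> space (perc d L j). P n (opn \<omega>)}" for n
  note link = prob_link[OF finite_E[OF horigin_V] E_hedges depends_on]
  have m: "range A \<subseteq> sets (perc d L j)" using link(1) by (auto simp: A_def)
  have dc: "decseq A" unfolding decseq_Suc_iff A_def using dec by blast
  have "\<eta> \<le> measure (perc d L j) (\<Inter>n. A n)"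
    by (rule LIMSEQ_le_const[OF Q.finite_Lim_measure_decseq[OF m dc]])
      (use ge in \<open>auto simp: A_def link(2)\<close>)
  also have "\<dots> \<le> measure (perc d L j) (perc_event d L j)"
    by (rule Q.finite_measure_mono[OF _ perc_event_sets]) (use inf in \<open>auto simp: perc_event_eq A_def\<close>)
  finally show ?thesis .
qed

end

section \<open>Subcritical kernels\<close>

definition edges_between :: "'v set \<Rightarrow> 'v set \<Rightarrow> 'v set set" where
  "edges_between U W = (\<lambda>(u, w). {u, w}) ` (U \<times> W)"

lemma inj_on_edges_between: "U \<inter> W = {} \<Longrightarrow> inj_on (\<lambda>(u, w). {u, w}) (U \<times> W)"
  by (auto simp: inj_on_def doubleton_eq_iff)

lemma sum_edges_between:
  assumes "U \<inter> W = {}"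
  shows "(\<Sum>e\<in>edges_between U W. f e) = (\<Sum>u\<in>U. \<Sum>w\<in>W. f {u, w})"
  unfolding edges_between_def
  by (subst sum.reindex[OF inj_on_edges_between[OF assms]]) (simp add: sum.cartesian_product case_prod_unfold)

context hier_percolation
begin

abbreviation "O0 \<equiv> horigin"

text \<open>The sum of \<open>J\<close> over all edges of level \<open>l\<close> at a fixed vertex;
  at \<open>l = 0\<close> truncated subtraction makes it 0.\<close>

definition level_rate :: "nat \<Rightarrow> real" where
  "level_rate l = (N ^ l - N ^ (l - 1)) * j l"

lemma level_rate_nonneg: "0 \<le> level_rate l"
  unfolding level_rate_def using j0 N2 by (intro mult_nonneg_nonneg) (auto intro: power_increasing)

lemma B_0: "x \<in> V \<Longrightarrow> B 0 x = {x}"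
  using card_block[OF L2, of x d 0] block_self[of x d L 0]
  by (metis card_1_singletonE power_0 singletonD)

lemma sum_level_rate: "x \<in> V \<Longrightarrow> m \<le> M \<Longrightarrow> (\<Sum>y\<in>B M x - B m x. J {x, y}) = (\<Sum>l\<in>{Suc m..M}. level_rate l)"
  by (simp add: sum_annulus level_rate_def)

lemma sum_edges_between_annulus:
  assumes "U \<subseteq> B n v" "n \<le> m" "m \<le> M" "v \<in> V"
  shows "(\<Sum>e\<in>edges_between U (B M v - B m v). J e) = real (card U) * (\<Sum>l\<in>{Suc m..M}. level_rate l)"
proof -
  have sub: "U \<subseteq> B m v" using assms(1) block_mono[OF assms(2)] by blast
  then have "(\<Sum>e\<in>edges_between U (B M v - B m v). J e) = (\<Sum>u\<in>U. \<Sum>w\<in>B M v - B m v. J {u, w})"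
    by (intro sum_edges_between) auto
  also have "\<dots> = (\<Sum>u\<in>U. \<Sum>l\<in>{Suc m..M}. level_rate l)"
  proof (rule sum.cong[OF refl])
    fix u assume u: "u \<in> U"
    have 1: "u \<in> B m v" using u sub by blast
    have 2: "u \<in> B M v" using 1 block_mono[OF assms(3)] by blast
    show "(\<Sum>w\<in>B M v - B m v. J {u, w}) = (\<Sum>l\<in>{Suc m..M}. level_rate l)"
      using sum_level_rate[OF block_hvert[OF 1] assms(3)] unfolding block_eq[OF 1] block_eq[OF 2] .
  qed
  finally show ?thesis by simp
qed

definition dead :: "nat \<Rightarrow> nat \<Rightarrow> hvertex set set \<Rightarrow> hvertex set" where
  "dead m n X = {x \<in> B n O0 - B m O0. \<forall>y\<in>B n O0 - {x}. {x, y} \<notin> X}"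

text \<open>On \<open>good m n m'\<close> every open edge from \<open>B n O0\<close> to the rest of \<open>B m' O0\<close> starts at a vertex that is isolated inside
  \<open>B n O0\<close>, hence is useless for leaving \<open>B n O0\<close>. The origin lies in \<open>B m O0\<close> and so is never dead; removing
  \<open>B m O0\<close> makes these events independent for disjoint ranges of scales.\<close>
definition good :: "nat \<Rightarrow> nat \<Rightarrow> nat \<Rightarrow> hvertex set set \<Rightarrow> bool" where
  "good m n m' X \<longleftrightarrow> X \<inter> edges_between (B n O0 - dead m n X) (B m' O0 - B n O0) = {}"

lemma edges_between_subset_E:
  assumes "U \<subseteq> B n O0" "n \<le> m'"
  shows "edges_between U (B m' O0 - B n O0) \<subseteq> E m' O0"
proof
  fix e assume "e \<in> edges_between U (B m' O0 - B n O0)"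
  then obtain u w where e: "e = {u, w}" "u \<in> U" "w \<in> B m' O0" "w \<notin> B n O0" by (auto simp: edges_between_def)
  have u: "u \<in> B n O0" using e assms by blast
  then have "u \<in> B m' O0" using block_mono[OF assms(2)] by blast
  then show "e \<in> E m' O0" using e u by (auto simp: edges_in_def edge_iff block_hvert)
qed

lemma dead_inter:
  assumes "E n O0 - E m O0 \<subseteq> A"
  shows "dead m n (X \<inter> A) = dead m n X"
proof -
  have "{x, y} \<in> A" if "x \<in> B n O0 - B m O0" "y \<in> B n O0 - {x}" for x y
    using assms that by (auto simp: edges_in_def edge_iff block_hvert)
  then show ?thesis unfolding dead_def by blast
qed

lemma depends_on_good:
  assumes "n \<le> m'"
  shows "depends_on ((E n O0 - E m O0) \<union> edges_between (B n O0) (B m' O0 - B n O0)) (good m n m')"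
proof -
  let ?A = "(E n O0 - E m O0) \<union> edges_between (B n O0) (B m' O0 - B n O0)"
  have "edges_between (B n O0 - dead m n X) (B m' O0 - B n O0) \<subseteq> ?A" for X by (auto simp: edges_between_def)
  then show ?thesis unfolding depends_on_def good_def by (subst dead_inter) auto
qed

text \<open>The edge sets \<open>E m' O0 - E m O0\<close> are disjoint along a chain of scales,
  which is what makes the attempts to confine the cluster independent.\<close>

lemma depends_on_good':
  assumes "m \<le> n" "n \<le> m'"
  shows "depends_on (E m' O0 - E m O0) (good m n m')"
proof (rule depends_on_mono[OF depends_on_good[OF assms(2)]])
  have "edges_between (B n O0) (B m' O0 - B n O0) \<inter> E m O0 = {}"
    using block_mono[OF assms(1), of d L O0] by (auto simp: edges_between_def edges_in_def)
  moreover have "E n O0 \<subseteq> E m' O0" using block_mono[OF assms(2)] by (rule edges_in_mono)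
  ultimately show "(E n O0 - E m O0) \<union> edges_between (B n O0) (B m' O0 - B n O0) \<subseteq> E m' O0 - E m O0"
    using edges_between_subset_E[OF subset_refl assms(2)] by blast
qed

text \<open>Since \<open>x\<close> is outside \<open>B m O0\<close>, no edge at \<open>x\<close>
  lies in \<open>E m O0\<close>; the whole star of \<open>x\<close> in the block is still available
  and must be closed.\<close>

lemma dead_prob:
  assumes x: "x \<in> B n O0 - B m O0"
  shows "ex (E n O0 - E m O0) (\<lambda>X. of_bool (x \<in> dead m n X)) = exp (- (\<Sum>l\<in>{1..n}. level_rate l))"
proof -
  let ?S = "edges_between {x} (B n O0 - {x})"
  have xV: "x \<in> V" and xB: "B n x = B n O0" using x block_hvert block_eq by blast+
  have S: "?S \<subseteq> E n O0 - E m O0" using x by (auto simp: edges_between_def edges_in_def edge_iff block_hvert)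
  have "(\<Sum>e\<in>?S. J e) = (\<Sum>y\<in>B n O0 - {x}. J {x, y})" by (subst sum_edges_between) auto
  also have "\<dots> = (\<Sum>l\<in>{1..n}. level_rate l)"
    using sum_level_rate[OF xV, of 0 n] by (simp add: B_0[OF xV] xB)
  finally have s: "(\<Sum>e\<in>?S. J e) = (\<Sum>l\<in>{1..n}. level_rate l)" .
  have "ex (E n O0 - E m O0) (\<lambda>X. of_bool (x \<in> dead m n X))
      = ex (E n O0 - E m O0) (\<lambda>X. of_bool (X \<inter> ?S = {}))"
  proof (rule bernoulli_ex_cong)
    fix X
    have "x \<in> dead m n X \<longleftrightarrow> X \<inter> ?S = {}" using x by (auto simp: dead_def edges_between_def)
    then show "of_bool (x \<in> dead m n X) = (of_bool (X \<inter> ?S = {}) :: real)" by simp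
  qed
  also have "\<dots> = exp (- (\<Sum>e\<in>?S. J e))" by (rule bernoulli_ex_closed) (use S in auto)
  finally show ?thesis using s by simp
qed

text \<open>Condition on the edges inside \<open>B n O0\<close>: the edges leaving it are
  independent of the dead set, and they must be closed at the vertices that are not dead. Jensen's
  inequality replaces the random number of these vertices by its mean, which is at most
  \<open>(1 - q / 2) * N ^ n\<close>.\<close>

lemma good_prob:
  assumes mn: "m < n" "n \<le> m'" and q: "q \<le> exp (- (\<Sum>l\<in>{1..n}. level_rate l))" "0 \<le> q"
  defines "\<tau> \<equiv> \<Sum>l\<in>{Suc n..m'}. level_rate l"
  shows "exp (- ((1 - q / 2) * N ^ n * \<tau>)) \<le> ex (E m' O0) (\<lambda>X. of_bool (good m n m' X))"
proof -
  let ?A1 = "E n O0 - E m O0" and ?A2 = "edges_between (B n O0) (B m' O0 - B n O0)"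
  have f: "finite ?A1" "finite ?A2" by (auto simp: edges_between_def)
  have dj: "?A1 \<inter> ?A2 = {}" by (auto simp: edges_between_def edges_in_def)
  have sub: "?A1 \<union> ?A2 \<subseteq> E m' O0"
    using edges_between_subset_E[OF subset_refl mn(2)] edges_in_mono[OF block_mono[OF mn(2), of d L O0], of d L] by blast
  have tau0: "0 \<le> \<tau>" unfolding \<tau>_def by (intro sum_nonneg level_rate_nonneg)
  have "ex (E m' O0) (\<lambda>X. of_bool (good m n m' X)) = ex (?A1 \<union> ?A2) (\<lambda>X. of_bool (good m n m' X))"
    by (rule bernoulli_ex_depends_on[OF _ sub]) (use depends_on_good[OF mn(2), of m] in \<open>auto simp: depends_on_def\<close>)
  also have "\<dots> = ex ?A1 (\<lambda>X. ex ?A2 (\<lambda>Y. of_bool (good m n m' (X \<union> Y))))"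
    by (rule bernoulli_ex_Un[OF f dj])
  also have "\<dots> = ex ?A1 (\<lambda>X. exp (- (real (card (B n O0 - dead m n X)) * \<tau>)))"
  proof (rule bernoulli_ex_cong)
    fix X assume X: "X \<subseteq> ?A1"
    let ?S = "edges_between (B n O0 - dead m n X) (B m' O0 - B n O0)"
    have S: "?S \<subseteq> ?A2" by (auto simp: edges_between_def)
    have "ex ?A2 (\<lambda>Y. of_bool (good m n m' (X \<union> Y))) = ex ?A2 (\<lambda>Y. of_bool (Y \<inter> ?S = {}))"
    proof (rule bernoulli_ex_cong)
      fix Y assume Y: "Y \<subseteq> ?A2"
      have "(X \<union> Y) \<inter> ?A1 = X" using X Y dj by blast
      then have "dead m n (X \<union> Y) = dead m n X" using dead_inter[of n m ?A1 "X \<union> Y"] by simp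
      moreover have "X \<inter> ?S = {}" using X S dj by blast
      ultimately have "good m n m' (X \<union> Y) \<longleftrightarrow> Y \<inter> ?S = {}" unfolding good_def by auto
      then show "of_bool (good m n m' (X \<union> Y)) = (of_bool (Y \<inter> ?S = {}) :: real)" by simp
    qed
    also have "\<dots> = exp (- (\<Sum>e\<in>?S. J e))" by (rule bernoulli_ex_closed[OF f(2) S])
    also have "(\<Sum>e\<in>?S. J e) = real (card (B n O0 - dead m n X)) * \<tau>"
      unfolding \<tau>_def by (rule sum_edges_between_annulus[of _ n]) (use mn in auto)
    finally show "ex ?A2 (\<lambda>Y. of_bool (good m n m' (X \<union> Y))) = exp (- (real (card (B n O0 - dead m n X)) * \<tau>))" .
  qed
  finally have eq: "ex (E m' O0) (\<lambda>X. of_bool (good m n m' X)) = \<dots>" .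
  have mean: "ex ?A1 (\<lambda>X. real (card (B n O0 - dead m n X)) * \<tau>) \<le> (1 - q / 2) * N ^ n * \<tau>"
  proof -
    have c: "real (card (B n O0 - dead m n X)) = N ^ n - (\<Sum>x\<in>B n O0 - B m O0. of_bool (x \<in> dead m n X))" for X
    proof -
      have s: "dead m n X \<subseteq> B n O0 - B m O0" by (auto simp: dead_def)
      have "(\<Sum>x\<in>B n O0 - B m O0. of_bool (x \<in> dead m n X)) = real (card ((B n O0 - B m O0) \<inter> dead m n X))"
        by (simp add: Int_def)
      moreover have "(B n O0 - B m O0) \<inter> dead m n X = dead m n X" using s by blast
      moreover have "real (card (B n O0 - dead m n X)) = real (card (B n O0)) - real (card (dead m n X))"
      proof -
        have s': "dead m n X \<subseteq> B n O0" using s by blast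
        then show ?thesis
          using finite_subset[OF s'] card_mono[OF _ s'] by (simp add: card_Diff_subset of_nat_diff)
      qed
      ultimately show ?thesis by (simp add: card_B)
    qed
    have le: "B m O0 \<subseteq> B n O0" using mn by (intro block_mono) auto
    have cd: "real (card (B n O0 - B m O0)) = N ^ n - N ^ m"
      using le by (simp add: card_Diff_subset of_nat_diff card_mono card_B)
    \<comment> \<open>The factor 1/2 in \<open>q / 2\<close> pays for the excluded block
      \<open>B m O0\<close>, which fills at most half of \<open>B n O0\<close> because
      \<open>m < n\<close> and \<open>2 \<le> N\<close>.\<close>
    have "N * N ^ m = N ^ Suc m" by simp
    also have "\<dots> \<le> N ^ n" using mn N2 by (intro power_increasing) auto
    finally have "2 * N ^ m \<le> N ^ n" using N2 mult_right_mono[of 2 N "N ^ m"] by simp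
    then have half: "N ^ n / 2 \<le> N ^ n - N ^ m" by simp
    have "ex ?A1 (\<lambda>X. real (card (B n O0 - dead m n X))) = N ^ n - (N ^ n - N ^ m) * exp (- (\<Sum>l\<in>{1..n}. level_rate l))"
      unfolding c by (simp only: bernoulli_ex_diff bernoulli_ex_const[OF f(1)] bernoulli_ex_sum) (simp add: dead_prob cd)
    also have "\<dots> \<le> N ^ n - N ^ n / 2 * q"
    proof -
      have "0 < N ^ n" using N0 by simp
      then have "0 \<le> N ^ n - N ^ m" using half by linarith
      from mult_mono[OF half q(1) this q(2)] show ?thesis by simp
    qed
    finally have "ex ?A1 (\<lambda>X. real (card (B n O0 - dead m n X))) \<le> (1 - q / 2) * N ^ n"
      by (simp add: algebra_simps)
    then have "\<tau> * ex ?A1 (\<lambda>X. real (card (B n O0 - dead m n X))) \<le> \<tau> * ((1 - q / 2) * N ^ n)"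
      using tau0 by (rule mult_left_mono)
    then show ?thesis by (simp only: bernoulli_ex_cmult[symmetric]) (simp add: mult.commute mult.assoc)
  qed
  have "exp (- ((1 - q / 2) * N ^ n * \<tau>)) \<le> exp (- ex ?A1 (\<lambda>X. real (card (B n O0 - dead m n X)) * \<tau>))"
    using mean by simp
  also have "\<dots> \<le> ex ?A1 (\<lambda>X. exp (- (real (card (B n O0 - dead m n X)) * \<tau>)))"
    by (rule bernoulli_ex_exp_ge[OF f(1) J0])
  finally show ?thesis unfolding eq .
qed

text \<open>By induction along a path, the cluster stays in \<open>B n O0 - dead m n X\<close>,
  which is stronger than the claim. From such a vertex a step out of the block is excluded by
  goodness up to \<open>B m' O0\<close> and by the last assumption beyond it; a step to a dead
  vertex would be an open edge of the latter inside \<open>B n O0\<close>.\<close>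

lemma good_confines:
  assumes "m \<le> n" "good m n m' X" "X \<inter> edges_between (B n O0) (B M O0 - B m' O0) = {}"
  shows "cluster_in (X \<inter> hedges d L) (B M O0) O0 \<subseteq> B n O0"
proof
  fix y assume "y \<in> cluster_in (X \<inter> hedges d L) (B M O0) O0"
  then have "y \<in> B n O0 - dead m n X"
  proof (induction rule: cluster_in_induct)
    case base then show ?case by (simp add: dead_def)
  next
    case (step u w)
    have e: "{u, w} \<in> X" "u \<noteq> w" "w \<in> B M O0" "u \<in> B n O0 - dead m n X"
      using step by (auto simp: edge_iff)
    have "w \<in> B m' O0" using assms(3) e by (auto simp: edges_between_def)
    moreover have "w \<notin> B m' O0 - B n O0" using assms(2) e unfolding good_def edges_between_def by blast
    ultimately have w: "w \<in> B n O0" by blast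
    have "{w, u} \<in> X" using e by (simp add: insert_commute)
    then show ?case using w e by (auto simp: dead_def)
  qed
  then show "y \<in> B n O0" by blast
qed

text \<open>Independence of successive attempts. The dependence statement is part of the induction
  because it is what splits off the next factor.\<close>

lemma no_good_prob:
  assumes mn: "\<And>i. m i < n i" "\<And>i. n i \<le> m (Suc i)"
    and p: "\<And>i. i < k \<Longrightarrow> p \<le> ex (E (m (Suc i)) O0) (\<lambda>X. of_bool (good (m i) (n i) (m (Suc i)) X))" "p \<le> 1"
  shows "ex (E (m k) O0) (\<lambda>X. \<Prod>i<k. 1 - of_bool (good (m i) (n i) (m (Suc i)) X)) \<le> (1 - p) ^ k
    \<and> depends_on (E (m k) O0) (\<lambda>X. \<Prod>i<k. 1 - of_bool (good (m i) (n i) (m (Suc i)) X) :: real)"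
  using p(1)
proof (induction k)
  case 0 then show ?case by (simp add: bernoulli_ex_const depends_on_def)
next
  case (Suc k)
  let ?g = "\<lambda>i X. 1 - of_bool (good (m i) (n i) (m (Suc i)) X) :: real"
  have IH: "ex (E (m k) O0) (\<lambda>X. \<Prod>i<k. ?g i X) \<le> (1 - p) ^ k" "depends_on (E (m k) O0) (\<lambda>X. \<Prod>i<k. ?g i X)"
    using Suc by auto
  have le: "m k \<le> n k" "n k \<le> m (Suc k)" using mn[of k] by auto
  have sub: "E (m k) O0 \<subseteq> E (m (Suc k)) O0" using le by (intro edges_in_mono block_mono) auto
  have dg: "depends_on (E (m (Suc k)) O0 - E (m k) O0) (?g k)"
    using depends_on_good'[OF le] by (auto simp: depends_on_def)
  have "ex (E (m (Suc k)) O0) (\<lambda>X. (\<Prod>i<k. ?g i X) * ?g k X)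
      = ex (E (m (Suc k)) O0) (\<lambda>X. \<Prod>i<k. ?g i X) * ex (E (m (Suc k)) O0) (?g k)"
    by (rule bernoulli_ex_indep[OF _ sub _ _ IH(2) dg]) auto
  also have "ex (E (m (Suc k)) O0) (\<lambda>X. \<Prod>i<k. ?g i X) = ex (E (m k) O0) (\<lambda>X. \<Prod>i<k. ?g i X)"
    by (rule bernoulli_ex_depends_on[OF _ sub IH(2)]) auto
  also have "ex (E (m (Suc k)) O0) (?g k) = 1 - ex (E (m (Suc k)) O0) (\<lambda>X. of_bool (good (m k) (n k) (m (Suc k)) X))"
    by (simp add: bernoulli_ex_diff bernoulli_ex_const)
  also have "ex (E (m k) O0) (\<lambda>X. \<Prod>i<k. ?g i X) * \<dots> \<le> (1 - p) ^ k * (1 - p)"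
  proof (rule mult_mono[OF IH(1)])
    show "0 \<le> 1 - ex (E (m (Suc k)) O0) (\<lambda>X. of_bool (good (m k) (n k) (m (Suc k)) X))"
      using bernoulli_ex_le_const[of "E (m (Suc k)) O0" J "\<lambda>X. of_bool (good (m k) (n k) (m (Suc k)) X)" 1] J0 by simp
  qed (use Suc.prems[of k] p(2) in auto)
  finally have 1: "ex (E (m (Suc k)) O0) (\<lambda>X. \<Prod>i<Suc k. ?g i X) \<le> (1 - p) ^ Suc k" by (simp add: mult.commute)
  have "depends_on (E (m (Suc k)) O0) (\<lambda>X. \<Prod>i<k. ?g i X)" using depends_on_mono[OF IH(2) sub] .
  moreover have "depends_on (E (m (Suc k)) O0) (?g k)" using depends_on_mono[OF dg] by blast
  ultimately have "depends_on (E (m (Suc k)) O0) (\<lambda>X. \<Prod>i<Suc k. ?g i X)"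
    unfolding depends_on_def by simp
  then show ?case using 1 by blast
qed

text \<open>If an attempt is good and no edge jumps from \<open>B (n i) O0\<close> past
  \<open>B (m (Suc i)) O0\<close>, the cluster is confined. So escape requires that all
  \<open>k\<close> attempts fail or that one of \<open>k\<close> sets of long edges contains an open
  edge, each with probability at most \<open>F\<close>.\<close>

lemma leaves_prob:
  assumes mn: "\<And>i. m i < n i" "\<And>i. n i \<le> m (Suc i)"
    and p: "\<And>i. i < k \<Longrightarrow> p \<le> ex (E (m (Suc i)) O0) (\<lambda>X. of_bool (good (m i) (n i) (m (Suc i)) X))" "p \<le> 1"
    and F: "\<And>i M. i < k \<Longrightarrow> m (Suc i) \<le> M \<Longrightarrow> N ^ n i * (\<Sum>l\<in>{Suc (m (Suc i))..M}. level_rate l) \<le> F"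
    and F0: "0 \<le> F"
  shows "ex (E M O0) (\<lambda>X. of_bool (leaves (m k) M X)) \<le> (1 - p) ^ k + real k * F"
proof (cases "m k \<le> M")
  case False
  have "\<not> leaves (m k) M X" for X
    using cluster_in_subset[of O0 "B M O0" "X \<inter> hedges d L"] block_mono[of M "m k" d L O0] False
    by (auto simp: leaves_def)
  then show ?thesis using p F0 by (simp add: bernoulli_ex_const)
next
  case True
  let ?g = "\<lambda>i X. 1 - of_bool (good (m i) (n i) (m (Suc i)) X) :: real"
  let ?F = "\<lambda>i. edges_between (B (n i) O0) (B M O0 - B (m (Suc i)) O0)"
  have minc: "m i \<le> m i'" if "i \<le> i'" for i i'
    by (rule lift_Suc_mono_le[OF _ that]) (use mn in \<open>meson less_imp_le order_trans\<close>)
  have ng: "ex (E (m k) O0) (\<lambda>X. \<Prod>i<k. ?g i X) \<le> (1 - p) ^ k" "depends_on (E (m k) O0) (\<lambda>X. \<Prod>i<k. ?g i X)"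
    using no_good_prob[of m n k p, OF mn p] by auto
  have pt: "of_bool (leaves (m k) M X) \<le> (\<Prod>i<k. ?g i X) + (\<Sum>i<k. of_bool (X \<inter> ?F i \<noteq> {}))" for X
  proof (cases "\<exists>i<k. good (m i) (n i) (m (Suc i)) X \<and> X \<inter> ?F i = {}")
    case True
    then obtain i where i: "i < k" "good (m i) (n i) (m (Suc i)) X" "X \<inter> ?F i = {}" by blast
    have "cluster_in (X \<inter> hedges d L) (B M O0) O0 \<subseteq> B (n i) O0"
      by (rule good_confines[OF _ i(2,3)]) (use mn(1)[of i] in auto)
    moreover have "n i \<le> m k" using mn(2)[of i] minc[of "Suc i" k] i by linarith
    ultimately have "\<not> leaves (m k) M X" using block_mono[of "n i" "m k" d L O0] by (auto simp: leaves_def)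
    then show ?thesis by (auto intro!: add_nonneg_nonneg prod_nonneg sum_nonneg)
  next
    case False
    show ?thesis
    proof (cases "\<exists>i<k. X \<inter> ?F i \<noteq> {}")
      case True
      then obtain i where i: "i < k" "X \<inter> ?F i \<noteq> {}" by blast
      then have "1 \<le> (\<Sum>i<k. of_bool (X \<inter> ?F i \<noteq> {}) :: real)"
        using member_le_sum[of i "{..<k}" "\<lambda>i. of_bool (X \<inter> ?F i \<noteq> {}) :: real"] by simp
      moreover have "0 \<le> (\<Prod>i<k. ?g i X)" by (intro prod_nonneg) auto
      moreover have "of_bool (leaves (m k) M X) \<le> (1::real)" by simp
      ultimately show ?thesis by linarith
    next
      case no: False
      then have "\<forall>i<k. \<not> good (m i) (n i) (m (Suc i)) X" using False by blast
      then have "(\<Prod>i<k. ?g i X) = 1" by (intro prod.neutral) auto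
      moreover have "0 \<le> (\<Sum>i<k. of_bool (X \<inter> ?F i \<noteq> {}) :: real)" by (intro sum_nonneg) auto
      moreover have "of_bool (leaves (m k) M X) \<le> (1::real)" by simp
      ultimately show ?thesis by linarith
    qed
  qed
  have far: "ex (E M O0) (\<lambda>X. of_bool (X \<inter> ?F i \<noteq> {})) \<le> F" if "i < k" for i
  proof -
    have ml: "m (Suc i) \<le> M" using minc[of "Suc i" k] that True by simp
    have sub: "?F i \<subseteq> E M O0"
    proof
      fix e assume "e \<in> ?F i"
      then obtain u w where e: "e = {u, w}" "u \<in> B (n i) O0" "w \<in> B M O0" "w \<notin> B (m (Suc i)) O0"
        by (auto simp: edges_between_def)
      have u: "u \<in> B (m (Suc i)) O0" using e block_mono[OF mn(2)[of i]] by blast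
      then have "u \<in> B M O0" using block_mono[OF ml] by blast
      then show "e \<in> E M O0" using e u by (auto simp: edges_in_def edge_iff block_hvert)
    qed
    have "ex (E M O0) (\<lambda>X. of_bool (X \<inter> ?F i \<noteq> {})) \<le> (\<Sum>e\<in>?F i. J e)"
      by (rule bernoulli_ex_open_le[OF _ sub J0]) simp
    also have "\<dots> = N ^ n i * (\<Sum>l\<in>{Suc (m (Suc i))..M}. level_rate l)"
      by (subst sum_edges_between_annulus[of _ "n i"]) (use mn(2)[of i] ml in \<open>auto simp: card_B\<close>)
    also have "\<dots> \<le> F" by (rule F[OF that ml])
    finally show ?thesis .
  qed
  have sub: "E (m k) O0 \<subseteq> E M O0" using True by (intro edges_in_mono block_mono)
  have "ex (E M O0) (\<lambda>X. of_bool (leaves (m k) M X))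
      \<le> ex (E M O0) (\<lambda>X. (\<Prod>i<k. ?g i X) + (\<Sum>i<k. of_bool (X \<inter> ?F i \<noteq> {})))"
    by (rule bernoulli_ex_mono[OF J0 pt])
  also have "\<dots> = ex (E (m k) O0) (\<lambda>X. \<Prod>i<k. ?g i X) + (\<Sum>i<k. ex (E M O0) (\<lambda>X. of_bool (X \<inter> ?F i \<noteq> {})))"
    using bernoulli_ex_depends_on[OF finite_E[OF horigin_V] sub ng(2), of J] by (simp only: bernoulli_ex_add bernoulli_ex_sum)
  also have "\<dots> \<le> (1 - p) ^ k + (\<Sum>i<k. F)"
    using ng(1) far by (intro add_mono sum_mono) auto
  finally show ?thesis by simp
qed

end

section \<open>Elementary sums and limits for the choice of scales\<close>

lemma sum_lin_geo:
  fixes N :: real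
  assumes "2 \<le> N" "m \<le> M"
  shows "(\<Sum>l\<in>{Suc m..M}. real l / N ^ l) \<le> (real m + 2) / N ^ m - (real M + 2) / N ^ M"
  using assms(2)
proof (induction M rule: dec_induct)
  case base then show ?case by simp
next
  case (step M)
  \<comment> \<open>The claimed bound telescopes exactly for N = 2, where the tail of l / 2^l from m
    + 1 on equals (m + 2) / 2^m; larger N leaves a surplus with the factor N - 2.\<close>
  have "(real M + 2) / N ^ M - (real M + 3) / N ^ Suc M - real (Suc M) / N ^ Suc M
      = ((N - 2) * (real M + 2)) / N ^ Suc M"
    using assms(1) by (simp add: field_simps)
  also have "\<dots> \<ge> 0" using assms(1) by auto
  finally show ?case using step by (simp add: algebra_simps)
qed

lemma sum_lin_geo_le:
  fixes N :: real
  assumes "2 \<le> N"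
  shows "(\<Sum>l\<in>{Suc m..M}. real l / N ^ l) \<le> (real m + 2) / N ^ m"
proof (cases "m \<le> M")
  case True
  have "0 \<le> (real M + 2) / N ^ M" using assms by simp
  then show ?thesis using sum_lin_geo[OF assms True] by linarith
qed (use assms in auto)

lemma sum_geo_le:
  fixes N :: real
  assumes "2 \<le> N" "m \<le> M"
  shows "(\<Sum>l\<in>{Suc m..M}. (N - 1) / N ^ l) = 1 / N ^ m - 1 / N ^ M"
  using assms(2)
proof (induction M rule: dec_induct)
  case base then show ?case by simp
next
  case (step M)
  have "(N - 1) / N ^ Suc M = 1 / N ^ M - 1 / N ^ Suc M" using assms(1) by (simp add: field_simps)
  then show ?case using step by (simp del: power_Suc)
qed

text \<open>There are 2^r attempts at scales of order r * 2^r, so the expected number of successes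
  is about 2^r times the power -(1 - \<delta>) of r * 2^r and diverges. The long edges contribute
  order r * 4^r / 8^r, which vanishes.\<close>

lemma blocks_asymp:
  fixes c C \<delta> :: real
  assumes "0 < c" "0 < \<delta>"
  shows "(\<lambda>r. exp (- (2 ^ r * exp (- ((1 - \<delta>) * ln (8 * real r * 2 ^ r * c)))))
      + 2 ^ r * (C * (8 * real r * 2 ^ r + 2) / 8 ^ r)) \<longlonglongrightarrow> 0"
proof -
  have "filterlim (\<lambda>r::nat. real r * ln 2 - (1 - \<delta>) * (ln (8 * c) + ln (real r) + real r * ln 2)) at_top sequentially"
    using assms by real_asymp
  moreover have "eventually (\<lambda>r. real r * ln 2 - (1 - \<delta>) * (ln (8 * c) + ln (real r) + real r * ln 2)
      = ln (2 ^ r * exp (- ((1 - \<delta>) * ln (8 * real r * 2 ^ r * c)))))  sequentially"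
    using eventually_gt_at_top[of 0]
  proof eventually_elim
    case (elim r)
    then have "ln (8 * real r * 2 ^ r * c) = ln (8 * c) + ln (real r) + real r * ln 2"
      using assms(1) by (simp add: ln_mult ln_realpow)
    then show ?case by (simp add: ln_mult ln_realpow)
  qed
  ultimately have "filterlim (\<lambda>r. ln (2 ^ r * exp (- ((1 - \<delta>) * ln (8 * real r * 2 ^ r * c))))) at_top sequentially"
    by (rule filterlim_cong[OF refl refl, THEN iffD1, rotated])
  then have "filterlim (\<lambda>r. exp (ln (2 ^ r * exp (- ((1 - \<delta>) * ln (8 * real r * 2 ^ r * c)))))) at_top sequentially"
    by (rule filterlim_compose[OF exp_at_top])
  then have "filterlim (\<lambda>r. 2 ^ r * exp (- ((1 - \<delta>) * ln (8 * real r * 2 ^ r * c)))) at_top sequentially"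
    by simp
  then have "filterlim (\<lambda>r. - (2 ^ r * exp (- ((1 - \<delta>) * ln (8 * real r * 2 ^ r * c))))) at_bot sequentially"
    by (simp add: filterlim_uminus_at_bot)
  then have 1: "(\<lambda>r. exp (- (2 ^ r * exp (- ((1 - \<delta>) * ln (8 * real r * 2 ^ r * c)))))) \<longlonglongrightarrow> 0"
    by (rule filterlim_compose[OF exp_at_bot])
  have 2: "(\<lambda>r::nat. 2 ^ r * (C * (8 * real r * 2 ^ r + 2) / 8 ^ r)) \<longlonglongrightarrow> 0"
  proof -
    have "(\<lambda>r::nat. 2 ^ r * ((8 * real r * 2 ^ r + 2) / 8 ^ r) :: real) = (\<lambda>r. 8 * (real r / 2 ^ r) + 2 / 4 ^ r)"
    proof
      fix r :: nat
      have e: "(8::real) ^ r = 2 ^ r * 4 ^ r" "(4::real) ^ r = 2 ^ r * 2 ^ r"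
        by (simp_all add: power_mult_distrib[symmetric])
      show "2 ^ r * ((8 * real r * 2 ^ r + 2) / 8 ^ r) = 8 * (real r / 2 ^ r) + 2 / (4::real) ^ r"
        unfolding e by (simp add: field_simps)
    qed
    moreover have "(\<lambda>r::nat. 8 * (real r / 2 ^ r) + 2 / 4 ^ r :: real) \<longlonglongrightarrow> 0" by real_asymp
    ultimately have "(\<lambda>r::nat. 2 ^ r * ((8 * real r * 2 ^ r + 2) / 8 ^ r) :: real) \<longlonglongrightarrow> 0" by simp
    then have "(\<lambda>r::nat. C * (2 ^ r * ((8 * real r * 2 ^ r + 2) / 8 ^ r)) :: real) \<longlonglongrightarrow> C * 0"
      by (rule tendsto_mult_left)
    then show ?thesis by (simp add: mult_ac)
  qed
  show ?thesis using tendsto_add[OF 1 2] by simp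
qed

context hier_lattice
begin

lemma lnL: "0 < ln (real L)"
  using L2 by simp

text \<open>For \<open>n \<ge> 1\<close> this is \<open>ln (n * ln L)\<close>, so
  \<open>exp (- (c * loglog n))\<close> is a constant multiple of \<open>n powr - c\<close>.\<close>

definition loglog :: "nat \<Rightarrow> real" where
  "loglog n = ln (ln (real L ^ n))"

lemma loglog_eq: "loglog n = ln (real n * ln (real L))"
  using L2 by (simp add: loglog_def ln_realpow)

lemma loglog_mono: "1 \<le> n \<Longrightarrow> n \<le> m \<Longrightarrow> loglog n \<le> loglog m"
  unfolding loglog_eq using lnL by (subst ln_le_cancel_iff) auto

lemma loglog_le: "1 \<le> n \<Longrightarrow> loglog n \<le> real n * ln (real L)"
  unfolding loglog_eq using lnL by (intro ln_bound) auto

end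

context hier_percolation
begin

text \<open>The hypothesis is used twice. With \<epsilon> = 1 it gives a crude bound, enough for a
  lower bound \<open>q\<close> on the isolation probability of a vertex and for the long edges.
  Since \<open>q\<close> does not depend on later choices, \<epsilon> may then be
  \<open>x = q / 2\<close>, and the exponent becomes (1 - x) * (1 + x) = 1 - x^2 < 1.\<close>

lemma no_percolation:
  assumes H: "\<And>\<epsilon>. 0 < \<epsilon> \<Longrightarrow> eventually (\<lambda>n. j n \<le> (1 + \<epsilon>) * N * loglog n / N ^ (2 * n)) sequentially"
  shows "measure (perc d L j) (perc_event d L j) = 0"
proof -
  obtain l0 where l0: "\<And>l. l0 \<le> l \<Longrightarrow> j l \<le> (1 + 1) * N * loglog l / N ^ (2 * l)"
    using H[of 1] by (auto simp: eventually_sequentially)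
  \<comment> \<open>The first summand serves the tail, through
    \<open>loglog l \<le> l * ln L\<close>; the sum absorbs the finitely many small scales, where
    the kernel is arbitrary.\<close>
  define C where "C = 2 * N * ln (real L) + (\<Sum>i<l0. j i * N ^ (2 * i))"
  have S0: "0 \<le> (\<Sum>i<l0. j i * N ^ (2 * i))" using j0 N0 by (intro sum_nonneg) auto
  have C0: "0 < C" unfolding C_def using S0 N0 lnL by (intro add_pos_nonneg) auto
  have jC: "j l \<le> C * real l / N ^ (2 * l)" if l: "1 \<le> l" for l
  proof (cases "l0 \<le> l")
    case True
    have "j l \<le> 2 * N * loglog l / N ^ (2 * l)" using l0[OF True] by simp
    also have "\<dots> \<le> 2 * N * (real l * ln (real L)) / N ^ (2 * l)"
      using loglog_le[OF l] N0 by (intro divide_right_mono mult_left_mono) auto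
    also have "\<dots> \<le> C * real l / N ^ (2 * l)"
    proof (rule divide_right_mono)
      have "2 * N * ln (real L) * real l \<le> C * real l"
        using S0 by (intro mult_right_mono) (auto simp: C_def)
      then show "2 * N * (real l * ln (real L)) \<le> C * real l" by (simp add: mult_ac)
    qed (use N0 in auto)
    finally show ?thesis .
  next
    case False
    have "j l * N ^ (2 * l) \<le> (\<Sum>i<l0. j i * N ^ (2 * i))"
      using False j0 N0 by (intro member_le_sum[of l "{..<l0}" "\<lambda>i. j i * N ^ (2 * i)"]) auto
    also have "\<dots> \<le> C * 1" unfolding C_def using N0 lnL by auto
    also have "\<dots> \<le> C * real l" using C0 l by (intro mult_left_mono) auto
    finally show ?thesis using N0 by (simp add: pos_le_divide_eq)
  qed
  have sigC: "level_rate l \<le> C * (real l / N ^ l)" if "1 \<le> l" for l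
  proof -
    have "level_rate l \<le> N ^ l * j l" unfolding level_rate_def using j0 N0 by (intro mult_right_mono) auto
    also have "\<dots> \<le> N ^ l * (C * real l / N ^ (2 * l))" using jC[OF that] N0 by (intro mult_left_mono) auto
    also have "\<dots> = C * (real l / N ^ l)" using N0 unfolding mult_2 power_add by (simp add: field_simps)
    finally show ?thesis .
  qed
  have sumC: "(\<Sum>l\<in>{Suc m..M}. level_rate l) \<le> C * ((real m + 2) / N ^ m)" for m M
  proof -
    have "(\<Sum>l\<in>{Suc m..M}. level_rate l) \<le> (\<Sum>l\<in>{Suc m..M}. C * (real l / N ^ l))" by (intro sum_mono sigC) auto
    also have "\<dots> \<le> C * ((real m + 2) / N ^ m)"
      unfolding sum_distrib_left[symmetric] using C0 sum_lin_geo_le[OF N2] by (intro mult_left_mono) auto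
    finally show ?thesis .
  qed
  \<comment> \<open>\<open>2 * C\<close> is the case \<open>m = 0\<close> of \<open>sumC\<close>, a
    bound for the total rate of all edges at one vertex.\<close>
  define q where "q = exp (- (2 * C))"
  have q: "0 < q" "q \<le> 1" using C0 by (auto simp: q_def)
  have qsum: "q \<le> exp (- (\<Sum>l\<in>{1..n}. level_rate l))" for n
    using sumC[of 0 n] by (simp add: q_def)
  define x where "x = q / 2"
  have x: "0 < x" "x < 1" using q by (auto simp: x_def)
  obtain l1 where l1: "\<And>l. l1 \<le> l \<Longrightarrow> j l \<le> (1 + x) * N * loglog l / N ^ (2 * l)"
    using H[OF x(1)] by (auto simp: eventually_sequentially)
  \<comment> \<open>On the range of levels used, \<open>loglog l\<close> is replaced by its upper
    bound \<Lambda>; the remaining geometric sum telescopes to at most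
    \<open>1 / N ^ n\<close>.\<close>
  have rate: "N ^ n * (\<Sum>l\<in>{Suc n..m'}. level_rate l) \<le> (1 + x) * \<Lambda>"
    if n: "l1 \<le> n" "n \<le> m'" and \<Lambda>: "loglog m' \<le> \<Lambda>" "0 \<le> \<Lambda>" for n m' \<Lambda>
  proof -
    have "level_rate l \<le> (1 + x) * \<Lambda> * ((N - 1) / N ^ l)" if l: "l \<in> {Suc n..m'}" for l
    proof -
      have NN: "N ^ l = N * N ^ (l - 1)" using l by (cases l) auto
      have "loglog l \<le> \<Lambda>" using loglog_mono[of l m'] l \<Lambda> by auto
      then have "(1 + x) * N * loglog l / N ^ (2 * l) \<le> (1 + x) * N * \<Lambda> / N ^ (2 * l)"
        using x N0 by (intro divide_right_mono mult_left_mono) auto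
      then have "j l \<le> (1 + x) * N * \<Lambda> / N ^ (2 * l)" using l1[of l] l n by auto
      then have "level_rate l \<le> (N ^ l - N ^ (l - 1)) * ((1 + x) * N * \<Lambda> / N ^ (2 * l))"
        unfolding level_rate_def using N2 by (intro mult_left_mono) (auto intro: power_increasing)
      also have "\<dots> = (1 + x) * \<Lambda> * ((N - 1) / N ^ l)"
      proof -
        have "(b * a - a) * ((1 + x) * b * \<Lambda> / (b * a * (b * a))) = (1 + x) * \<Lambda> * ((b - 1) / (b * a))"
          if "a \<noteq> 0" "b \<noteq> 0" for a b :: real
          using that by (simp add: divide_simps) (simp add: algebra_simps)
        note al = this
        show ?thesis unfolding mult_2 power_add NN by (rule al) (use N0 in auto)
      qed
      finally show ?thesis .
    qed
    then have "(\<Sum>l\<in>{Suc n..m'}. level_rate l) \<le> (\<Sum>l\<in>{Suc n..m'}. (1 + x) * \<Lambda> * ((N - 1) / N ^ l))"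
      by (rule sum_mono)
    also have "\<dots> = (1 + x) * \<Lambda> * (1 / N ^ n - 1 / N ^ m')"
      unfolding sum_distrib_left[symmetric] sum_geo_le[OF N2 n(2)] ..
    also have "\<dots> \<le> (1 + x) * \<Lambda> * (1 / N ^ n)"
      using x \<Lambda> N0 by (intro mult_left_mono) auto
    finally have "N ^ n * (\<Sum>l\<in>{Suc n..m'}. level_rate l) \<le> N ^ n * ((1 + x) * \<Lambda> * (1 / N ^ n))"
      using N0 by (intro mult_left_mono) auto
    moreover have "b * ((1 + x) * \<Lambda> * (1 / b)) = (1 + x) * \<Lambda>" if "b \<noteq> 0" for b :: real
      using that by simp
    then have "N ^ n * ((1 + x) * \<Lambda> * (1 / N ^ n)) = (1 + x) * \<Lambda>"
      by this (use zero_less_power[OF N0, of n] in linarith)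
    ultimately show ?thesis by linarith
  qed
  define \<Lambda> where "\<Lambda> r = ln (8 * real r * 2 ^ r * ln (real L))" for r :: nat
  define h where "h r = exp (- (2 ^ r * exp (- ((1 - x\<^sup>2) * \<Lambda> r)))) + 2 ^ r * (C * (8 * real r * 2 ^ r + 2) / 8 ^ r)" for r :: nat
  have bound: "measure (perc d L j) (perc_event d L j) \<le> h r" if r: "1 \<le> r" "l1 \<le> r" "0 \<le> \<Lambda> r" for r
  proof -
    \<comment> \<open>The gap \<open>3 * r\<close> above \<open>n i\<close> makes longer edges negligible, and the \<open>2 ^ r\<close> attempts, all at scales
      of order \<open>r * 2 ^ r\<close>, each succeed with probability at least the scale to a fixed power greater than \<open>-1\<close>.\<close>
    define m where "m i = 4 * r * (2 ^ r + i)" for i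
    define n where "n i = m i + r" for i
    have mn: "m i < n i" "n i \<le> m (Suc i)" "m (Suc i) = n i + 3 * r" for i
      using r by (auto simp: n_def m_def algebra_simps)
    have mtop: "m (Suc i) \<le> 8 * r * 2 ^ r" if "i < 2 ^ r" for i
    proof -
      have "4 * r * (2 ^ r + Suc i) \<le> 4 * r * (2 ^ r + 2 ^ r)" using that by (intro mult_left_mono) auto
      also have "\<dots> = 8 * r * 2 ^ r" by simp
      finally show ?thesis unfolding m_def .
    qed
    define p where "p = exp (- ((1 - x\<^sup>2) * \<Lambda> r))"
    have p1: "p \<le> 1" using r x by (simp add: p_def power_le_one mult_nonneg_nonneg)
    have pg: "p \<le> ex (E (m (Suc i)) O0) (\<lambda>X. of_bool (good (m i) (n i) (m (Suc i)) X))" if i: "i < 2 ^ r" for i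
    proof -
      let ?\<tau> = "\<Sum>l\<in>{Suc (n i)..m (Suc i)}. level_rate l"
      have "loglog (m (Suc i)) \<le> loglog (8 * r * 2 ^ r)" using mtop[OF i] mn(1,2)[of i] by (intro loglog_mono) auto
      also have "\<dots> = \<Lambda> r" by (simp add: loglog_eq \<Lambda>_def)
      finally have lm: "loglog (m (Suc i)) \<le> \<Lambda> r" .
      have "N ^ n i * ?\<tau> \<le> (1 + x) * \<Lambda> r"
        by (rule rate) (use r mn[of i] lm in \<open>auto simp: n_def\<close>)
      then have "(1 - x) * (N ^ n i * ?\<tau>) \<le> (1 - x) * ((1 + x) * \<Lambda> r)"
        using x by (intro mult_left_mono) auto
      also have "\<dots> = (1 - x\<^sup>2) * \<Lambda> r" by (simp add: power2_eq_square algebra_simps)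
      finally have "p \<le> exp (- ((1 - q / 2) * N ^ n i * ?\<tau>))"
        by (simp add: p_def x_def mult.assoc)
      also have "\<dots> \<le> ex (E (m (Suc i)) O0) (\<lambda>X. of_bool (good (m i) (n i) (m (Suc i)) X))"
        by (rule good_prob) (use mn qsum q in auto)
      finally show ?thesis .
    qed
    define F where "F = C * (8 * real r * 2 ^ r + 2) / 8 ^ r"
    have F: "N ^ n i * (\<Sum>l\<in>{Suc (m (Suc i))..M}. level_rate l) \<le> F" if i: "i < 2 ^ r" for i M
    proof -
      have "N ^ n i * (\<Sum>l\<in>{Suc (m (Suc i))..M}. level_rate l) \<le> N ^ n i * (C * ((real (m (Suc i)) + 2) / N ^ m (Suc i)))"
        using sumC N0 by (intro mult_left_mono) auto
      also have "\<dots> = C * (real (m (Suc i)) + 2) / N ^ (3 * r)"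
      proof -
        have "b * (C * (y / (b * z))) = C * y / z" if "b \<noteq> 0" for b y z :: real
          using that by simp
        then show ?thesis unfolding mn(3) power_add by this (use zero_less_power[OF N0, of "n i"] in linarith)
      qed
      also have "\<dots> \<le> C * (8 * real r * 2 ^ r + 2) / 8 ^ r"
      proof (rule frac_le)
        have "real (m (Suc i)) \<le> real (8 * r * 2 ^ r)" using mtop[OF i] by (simp only: of_nat_le_iff)
        then show "C * (real (m (Suc i)) + 2) \<le> C * (8 * real r * 2 ^ r + 2)"
          using C0 by (intro mult_left_mono) auto
        have "(2::real) ^ (3 * r) \<le> N ^ (3 * r)" using N2 by (intro power_mono) auto
        then show "8 ^ r \<le> N ^ (3 * r)" by (simp add: power_mult)
      qed (use C0 in auto)
      finally show ?thesis by (simp add: F_def)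
    qed
    have F0: "0 \<le> F" using C0 by (simp add: F_def)
    have "measure (perc d L j) (perc_event d L j) \<le> (1 - p) ^ (2 ^ r) + real (2 ^ r) * F"
      by (rule perc_event_le[of "m (2 ^ r)"], rule leaves_prob[of m n "2 ^ r" p F, OF mn(1,2) pg p1 F F0]) auto
    also have "(1 - p) ^ (2 ^ r) \<le> exp (- p) ^ (2 ^ r)"
      using p1 exp_ge_add_one_self[of "- p"] by (intro power_mono) auto
    also have "exp (- p) ^ (2 ^ r) = exp (- (2 ^ r * p))"
      by (simp add: exp_of_nat_mult[symmetric])
    finally show ?thesis by (simp add: h_def p_def F_def)
  qed
  have lim: "h \<longlonglongrightarrow> 0"
    unfolding h_def \<Lambda>_def using blocks_asymp[OF lnL, of "x\<^sup>2" C] x by simp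
  have "eventually (\<lambda>r. 0 \<le> \<Lambda> r) sequentially"
    unfolding \<Lambda>_def using lnL by real_asymp
  then have "eventually (\<lambda>r. measure (perc d L j) (perc_event d L j) \<le> h r) sequentially"
    using eventually_ge_at_top[of 1] eventually_ge_at_top[of l1]
    by eventually_elim (rule bound)
  then have "measure (perc d L j) (perc_event d L j) \<le> 0"
    by (rule tendsto_lowerbound[OF lim]) simp
  then show ?thesis using measure_nonneg[of "perc d L j" "perc_event d L j"] by linarith
qed

end

section \<open>Merging sibling blocks\<close>

text \<open>The right-hand side is the exponent (up to the factor \<open>ln n / M\<close>) of the event that a cluster of relative
  density \<open>z0\<close> absorbs exactly the fractions \<open>\<zeta>\<close> of its sibling blocks and then remains isolated. It never falls
  below the cost \<open>M * z0\<close> of staying alone.\<close>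
lemma energy_core:
  fixes \<zeta> :: "'c \<Rightarrow> real"
  assumes "finite I" "real (card I) + 1 = M" "\<And>c. c \<in> I \<Longrightarrow> 0 \<le> \<zeta> c \<and> \<zeta> c \<le> 1"
  defines "Y \<equiv> \<Sum>c\<in>I. \<zeta> c"
  shows "M * z0 + (1 - z0) * Y \<le> (\<Sum>c\<in>I. (1 - \<zeta> c) * (z0 + Y - \<zeta> c)) + z0 + Y"
proof -
  let ?K = "real (card I)"
  \<comment> \<open>The two sides of the claim differ by exactly the sum of these terms. The bracket
    is the total unabsorbed fraction of the siblings other than \<open>c\<close>, hence
    nonnegative.\<close>
  have 1: "0 \<le> \<zeta> c * (?K - 1 - Y + \<zeta> c)" if c: "c \<in> I" for c
  proof -
    have "Y = \<zeta> c + (\<Sum>c'\<in>I - {c}. \<zeta> c')" unfolding Y_def using assms(1) c by (rule sum.remove)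
    moreover have "(\<Sum>c'\<in>I - {c}. \<zeta> c') \<le> (\<Sum>c'\<in>I - {c}. 1)" using assms(3) by (intro sum_mono) auto
    moreover have "(\<Sum>c'\<in>I - {c}. 1::real) = ?K - 1"
      using c assms(1) card_gt_0_iff[of I] by (auto simp: card_Diff_singleton of_nat_diff)
    ultimately have "0 \<le> ?K - 1 - Y + \<zeta> c" by linarith
    then show ?thesis using assms(3)[OF c] by simp
  qed
  have "0 \<le> (\<Sum>c\<in>I. \<zeta> c * (?K - 1 - Y + \<zeta> c))" by (intro sum_nonneg 1)
  also have "\<dots> = (\<Sum>c\<in>I. (?K - 1 - Y) * \<zeta> c + \<zeta> c * \<zeta> c)"
    by (intro sum.cong) (auto simp: algebra_simps)
  also have "\<dots> = (?K - 1 - Y) * Y + (\<Sum>c\<in>I. \<zeta> c * \<zeta> c)"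
    by (simp only: sum.distrib sum_distrib_left[symmetric] Y_def)
  finally have 2: "0 \<le> (?K - 1 - Y) * Y + (\<Sum>c\<in>I. \<zeta> c * \<zeta> c)" .
  have "(\<Sum>c\<in>I. (1 - \<zeta> c) * (z0 + Y - \<zeta> c)) = (\<Sum>c\<in>I. (z0 + Y) - (1 + z0 + Y) * \<zeta> c + \<zeta> c * \<zeta> c)"
    by (intro sum.cong) (auto simp: algebra_simps)
  also have "\<dots> = ?K * (z0 + Y) - (1 + z0 + Y) * Y + (\<Sum>c\<in>I. \<zeta> c * \<zeta> c)"
    by (simp add: sum.distrib sum_subtractf sum_distrib_left[symmetric] Y_def)
  finally show ?thesis using 2 unfolding assms(2)[symmetric] by (simp add: algebra_simps)
qed

text \<open>Density measured relative to \<theta> and capped: in a block that is not bad only the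
  fraction \<theta> is guaranteed to lie in large clusters, so \<theta> has to count as
  full.\<close>

definition zeta :: "real \<Rightarrow> real \<Rightarrow> real" where
  "zeta \<theta> x = min 1 (x / \<theta>)"

lemma zeta_bounds: "0 < \<theta> \<Longrightarrow> 0 \<le> x \<Longrightarrow> 0 \<le> zeta \<theta> x \<and> zeta \<theta> x \<le> 1"
  by (simp add: zeta_def)

lemma zeta_mono: "0 < \<theta> \<Longrightarrow> x \<le> y \<Longrightarrow> zeta \<theta> x \<le> zeta \<theta> y"
  unfolding zeta_def by (intro min.mono divide_right_mono) auto

lemma zeta_ge: "0 < \<theta> \<Longrightarrow> \<theta> \<le> 1 \<Longrightarrow> \<rho> \<le> 1 \<Longrightarrow> 0 \<le> \<rho> \<Longrightarrow> \<rho> \<le> x \<Longrightarrow> \<rho> \<le> zeta \<theta> x"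
proof -
  assume a: "0 < \<theta>" "\<theta> \<le> 1" "\<rho> \<le> 1" "0 \<le> \<rho>" "\<rho> \<le> x"
  have "\<rho> * \<theta> \<le> x * 1" using a by (intro mult_mono) auto
  then show "\<rho> \<le> zeta \<theta> x" using a by (simp add: zeta_def pos_le_divide_eq)
qed

lemma zeta_scale: "0 < \<theta> \<Longrightarrow> 1 \<le> M \<Longrightarrow> 0 \<le> x \<Longrightarrow> zeta \<theta> x / M \<le> zeta \<theta> (x / M)"
proof -
  assume a: "0 < \<theta>" "1 \<le> M" "0 \<le> x"
  have "min 1 (x / \<theta>) / M \<le> x / \<theta> / M" using a by (intro divide_right_mono) auto
  moreover have "min 1 (x / \<theta>) / M \<le> 1" using a by (simp add: min.coboundedI1)
  ultimately show ?thesis by (simp add: zeta_def mult.commute)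
qed

text \<open>\<open>energy_core\<close> for actual densities, with \<open>z c\<close> the absorbed
  and \<open>w c\<close> the rejected large-cluster mass of the sibling \<open>c\<close>. The bounds
  \<open>\<theta> * \<zeta> c \<le> z c\<close> and
  \<open>\<theta> * (1 - \<zeta> c) \<le> w c\<close> cost a factor \<theta> each, whence
  \<open>q \<le> a * \<theta>\<^sup>2\<close>. The first inequality gains nothing if nothing is
  absorbed; the second then exploits the gap between \<open>q\<close> and
  \<open>a * \<theta>\<^sup>2\<close>.\<close>

lemma energy_ge:
  fixes z w :: "'c \<Rightarrow> real"
  assumes I: "finite I" "real (card I) + 1 = M" "2 \<le> M"
    and zw: "\<And>c. c \<in> I \<Longrightarrow> 0 \<le> z c \<and> 0 \<le> w c \<and> \<theta> \<le> z c + w c" and z0: "0 \<le> z0"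
    and \<theta>: "0 < \<theta>" and a: "0 \<le> a" "q \<le> a * \<theta>\<^sup>2" "0 \<le> q"
  defines "Z \<equiv> z0 + (\<Sum>c\<in>I. z c)" and "\<zeta>0 \<equiv> zeta \<theta> z0"
  shows "q * \<zeta>0 + q / M * (1 - \<zeta>0) * (\<Sum>c\<in>I. zeta \<theta> (z c))
      \<le> a / M * (\<Sum>c\<in>I. w c * (Z - z c)) + q * zeta \<theta> (Z / M)" (is ?A)
    and "(\<And>c. c \<in> I \<Longrightarrow> z c = 0) \<Longrightarrow> q * \<zeta>0 + (a * \<theta>\<^sup>2 - q) / 2 * \<zeta>0
      \<le> a / M * (\<Sum>c\<in>I. w c * (Z - z c)) + q * zeta \<theta> (Z / M)"
proof -
  define \<zeta> where "\<zeta> c = zeta \<theta> (z c)" for c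
  define Y where "Y = (\<Sum>c\<in>I. \<zeta> c)"
  have zb: "0 \<le> \<zeta> c \<and> \<zeta> c \<le> 1" if "c \<in> I" for c using zeta_bounds zw[OF that] \<theta> by (simp add: \<zeta>_def)
  have z0b: "0 \<le> \<zeta>0" "\<zeta>0 \<le> 1" using zeta_bounds z0 \<theta> by (auto simp: \<zeta>0_def)
  have tz: "\<theta> * zeta \<theta> x \<le> x" for x using \<theta> by (auto simp: zeta_def min_def field_simps)
  have wz: "\<theta> * (1 - \<zeta> c) \<le> w c" if c: "c \<in> I" for c
    using zw[OF c] \<theta> by (auto simp: \<zeta>_def zeta_def min_def right_diff_distrib)
  have Zz: "\<theta> * (\<zeta>0 + Y - \<zeta> c) \<le> Z - z c" if c: "c \<in> I" for c
  proof -
    have "Y = \<zeta> c + (\<Sum>c'\<in>I - {c}. \<zeta> c')" "(\<Sum>c\<in>I. z c) = z c + (\<Sum>c'\<in>I - {c}. z c')"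
      unfolding Y_def using I(1) c by (auto intro: sum.remove)
    moreover have "\<theta> * (\<Sum>c'\<in>I - {c}. \<zeta> c') \<le> (\<Sum>c'\<in>I - {c}. z c')"
      unfolding sum_distrib_left \<zeta>_def by (intro sum_mono tz)
    moreover have "\<theta> * \<zeta>0 \<le> z0" unfolding \<zeta>0_def by (rule tz)
    ultimately show ?thesis unfolding Z_def by (simp add: algebra_simps)
  qed
  have Y0: "0 \<le> Y" unfolding Y_def using zb by (intro sum_nonneg) auto
  have YZ: "\<theta> * (\<zeta>0 + Y) \<le> Z"
    unfolding Z_def Y_def distrib_left sum_distrib_left \<zeta>_def \<zeta>0_def by (intro add_mono sum_mono tz)
  \<comment> \<open>Ensures that the average of the capped densities is at most 1, so the cap in
    \<open>zeta\<close> does no harm when the merged cluster is divided by \<open>M\<close>.\<close>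
  have Yle: "\<zeta>0 + Y \<le> M"
  proof -
    have "Y \<le> (\<Sum>c\<in>I. 1)" unfolding Y_def using zb by (intro sum_mono) auto
    then show ?thesis using I z0b by simp
  qed
  have zZ: "(\<zeta>0 + Y) / M \<le> zeta \<theta> (Z / M)"
    using YZ Yle I(3) \<theta> by (simp add: zeta_def pos_le_divide_eq pos_divide_le_eq mult_ac)
  have prod: "\<theta>\<^sup>2 * (\<Sum>c\<in>I. (1 - \<zeta> c) * (\<zeta>0 + Y - \<zeta> c)) \<le> (\<Sum>c\<in>I. w c * (Z - z c))"
    unfolding sum_distrib_left
  proof (rule sum_mono)
    fix c assume c: "c \<in> I"
    have "\<zeta> c \<le> Y" unfolding Y_def using I(1) c zb by (intro member_le_sum) auto
    then have "\<theta> * (1 - \<zeta> c) * (\<theta> * (\<zeta>0 + Y - \<zeta> c)) \<le> w c * (Z - z c)"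
      using wz[OF c] Zz[OF c] zb[OF c] z0b zw[OF c] \<theta> by (intro mult_mono) auto
    then show "\<theta>\<^sup>2 * ((1 - \<zeta> c) * (\<zeta>0 + Y - \<zeta> c)) \<le> w c * (Z - z c)"
      by (simp add: power2_eq_square mult_ac)
  qed
  define S where "S = (\<Sum>c\<in>I. (1 - \<zeta> c) * (\<zeta>0 + Y - \<zeta> c))"
  have S0: "0 \<le> S" unfolding S_def
  proof (intro sum_nonneg mult_nonneg_nonneg)
    fix c assume c: "c \<in> I"
    have "\<zeta> c \<le> Y" unfolding Y_def using I(1) c zb by (intro member_le_sum) auto
    then show "0 \<le> \<zeta>0 + Y - \<zeta> c" using z0b by simp
  qed (use zb in auto)
  have lower: "(a * \<theta>\<^sup>2) / M * S + q * ((\<zeta>0 + Y) / M) \<le> a / M * (\<Sum>c\<in>I. w c * (Z - z c)) + q * zeta \<theta> (Z / M)"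
  proof (rule add_mono)
    have "a / M * (\<theta>\<^sup>2 * S) \<le> a / M * (\<Sum>c\<in>I. w c * (Z - z c))"
      using prod a I(3) unfolding S_def by (intro mult_left_mono) auto
    then show "(a * \<theta>\<^sup>2) / M * S \<le> a / M * (\<Sum>c\<in>I. w c * (Z - z c))" by (simp add: mult_ac)
  qed (use zZ a in \<open>intro mult_left_mono, auto\<close>)
  have core: "M * \<zeta>0 + (1 - \<zeta>0) * Y \<le> S + \<zeta>0 + Y"
    unfolding S_def Y_def by (rule energy_core[OF I(1,2) zb])
  have "q * \<zeta>0 + q / M * (1 - \<zeta>0) * Y = q / M * (M * \<zeta>0 + (1 - \<zeta>0) * Y)" using I(3) by (simp add: field_simps)
  also have "\<dots> \<le> q / M * (S + \<zeta>0 + Y)" using core a I(3) by (intro mult_left_mono) auto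
  also have "\<dots> = q / M * S + q * ((\<zeta>0 + Y) / M)" by (simp add: add_divide_distrib distrib_left)
  also have "\<dots> \<le> (a * \<theta>\<^sup>2) / M * S + q * ((\<zeta>0 + Y) / M)"
    using a S0 I(3) by (intro add_mono order_refl mult_right_mono divide_right_mono) auto
  also note lower
  finally show ?A by (simp add: Y_def \<zeta>_def)
  assume z: "\<And>c. c \<in> I \<Longrightarrow> z c = 0"
  have \<zeta>: "\<zeta> c = 0" if "c \<in> I" for c using z[OF that] \<theta> by (simp add: \<zeta>_def zeta_def)
  then have Y: "Y = 0" by (simp add: Y_def)
  have "S = (\<Sum>c\<in>I. \<zeta>0)" unfolding S_def using \<zeta> Y by (intro sum.cong) auto
  moreover have "M - 1 = real (card I)" using I(2) by simp
  ultimately have S: "S = (M - 1) * \<zeta>0" by simp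
  have "(a * \<theta>\<^sup>2 - q) / 2 * \<zeta>0 \<le> (a * \<theta>\<^sup>2 - q) * ((M - 1) / M) * \<zeta>0"
  proof (rule mult_right_mono[OF _ z0b(1)])
    have "1 / 2 \<le> (M - 1) / M" using I(3) by (simp add: field_simps)
    then have "(a * \<theta>\<^sup>2 - q) * (1 / 2) \<le> (a * \<theta>\<^sup>2 - q) * ((M - 1) / M)" using a by (intro mult_left_mono) auto
    then show "(a * \<theta>\<^sup>2 - q) / 2 \<le> (a * \<theta>\<^sup>2 - q) * ((M - 1) / M)" by simp
  qed
  moreover have "(a * \<theta>\<^sup>2) / M * S + q * ((\<zeta>0 + Y) / M) = q * \<zeta>0 + (a * \<theta>\<^sup>2 - q) * ((M - 1) / M) * \<zeta>0"
    unfolding S Y using I(3) by (simp add: field_simps)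
  ultimately show "q * \<zeta>0 + (a * \<theta>\<^sup>2 - q) / 2 * \<zeta>0
      \<le> a / M * (\<Sum>c\<in>I. w c * (Z - z c)) + q * zeta \<theta> (Z / M)" using lower by linarith
qed

lemma (in hier_lattice) L_pos [simp]: "0 < L" "L \<noteq> 0"
  using L2 by auto

section \<open>Edge counts in the merger of sibling blocks\<close>

context hier_percolation
begin

definition block_cluster :: "nat \<Rightarrow> hvertex \<Rightarrow> hvertex set set \<Rightarrow> hvertex set" where
  "block_cluster n v X = cluster_in (X \<inter> hedges d L) (B n v) v"

definition cluster_density :: "nat \<Rightarrow> hvertex \<Rightarrow> hvertex set set \<Rightarrow> real" where
  "cluster_density n v X = real (card (block_cluster n v X)) / N ^ n"

definition inner_edges :: "nat \<Rightarrow> hvertex \<Rightarrow> hvertex set set" where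
  "inner_edges n v = \<Union>(edges_in d L ` subblocks d L n v)"

text \<open>Precisely the edges of level \<open>Suc n\<close> in the larger block. Conditioning on
  the inner edges fixes all clusters of the subblocks and leaves these edges independent.\<close>

definition outer_edges :: "nat \<Rightarrow> hvertex \<Rightarrow> hvertex set set" where
  "outer_edges n v = E (Suc n) v - inner_edges n v"

definition siblings :: "nat \<Rightarrow> hvertex \<Rightarrow> hvertex set set" where
  "siblings n v = subblocks d L n v - {B n v}"

lemma depends_on_block_cluster: "depends_on (E n v) (block_cluster n v)"
  unfolding block_cluster_def by (rule depends_on_cluster_in_E)

lemma depends_on_cluster_density: "depends_on (E n v) (cluster_density n v)"
  using depends_on_block_cluster unfolding depends_on_def cluster_density_def by metis

lemma block_cluster_self: "v \<in> block_cluster n v X"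
  by (simp add: block_cluster_def)

lemma block_cluster_subset: "v \<in> V \<Longrightarrow> block_cluster n v X \<subseteq> B n v"
  unfolding block_cluster_def by (rule cluster_in_subset) simp

lemma finite_block_cluster: "v \<in> V \<Longrightarrow> finite (block_cluster n v X)"
  using finite_subset[OF block_cluster_subset] by simp

lemma block_cluster_eq: "w \<in> block_cluster n v X \<Longrightarrow> v \<in> V \<Longrightarrow> block_cluster n w X = block_cluster n v X"
  using block_eq[of w d L n v] block_cluster_subset[of v n X] cluster_in_eq[of w "X \<inter> hedges d L" "B n v" v]
  unfolding block_cluster_def by auto

lemma block_cluster_Suc: "X \<subseteq> Y \<Longrightarrow> block_cluster n v X \<subseteq> block_cluster (Suc n) v Y"
  unfolding block_cluster_def by (intro cluster_in_mono block_mono) auto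

lemma siblings_props:
  assumes "v \<in> V"
  shows "finite (siblings n v)" "real (card (siblings n v)) + 1 = N"
    "\<Union>(siblings n v) = B (Suc n) v - B n v"
proof -
  note p = subblocks_props[OF assms, where n = n]
  show "finite (siblings n v)" using p(1) by (simp add: siblings_def)
  have "Suc (card (siblings n v)) = card (subblocks d L n v)" unfolding siblings_def by (rule card_Suc_Diff1[OF p(1,6)])
  then have "real (Suc (card (siblings n v))) = N" using p(5) by simp
  then show "real (card (siblings n v)) + 1 = N" by linarith
  show "\<Union>(siblings n v) = B (Suc n) v - B n v"
    unfolding siblings_def p(2)[symmetric] using p(3)[OF p(6)] by auto
qed

lemma subblocks_eq: "c \<in> subblocks d L n v \<Longrightarrow> w \<in> c \<Longrightarrow> B n w = c"
  unfolding subblocks_def using block_eq by blast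

lemma card_split:
  assumes "v \<in> V" "A \<subseteq> B (Suc n) v"
  shows "real (card A) = real (card (A \<inter> B n v)) + (\<Sum>c\<in>siblings n v. real (card (A \<inter> c)))"
proof -
  note p = subblocks_props[OF assms(1), where n = n]
  have fA: "finite A" using assms finite_subset finite_B by blast
  have "A = (\<Union>c\<in>subblocks d L n v. A \<inter> c)" using assms(2) p(2) by blast
  then have "real (card A) = real (card (\<Union>c\<in>subblocks d L n v. A \<inter> c))" by simp
  also have "\<dots> = (\<Sum>c\<in>subblocks d L n v. real (card (A \<inter> c)))"
  proof (subst card_UN_disjoint)
    show "\<forall>x\<in>subblocks d L n v. \<forall>y\<in>subblocks d L n v. x \<noteq> y \<longrightarrow> A \<inter> x \<inter> (A \<inter> y) = {}" using p(3) by blast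
  qed (use p(1) fA in auto)
  also have "\<dots> = real (card (A \<inter> B n v)) + (\<Sum>c\<in>siblings n v. real (card (A \<inter> c)))"
    unfolding siblings_def by (rule sum.remove[OF p(1,6)])
  finally show ?thesis .
qed

lemma outer_edges_iff:
  assumes "u \<in> B (Suc n) v" "w \<in> B (Suc n) v" "w \<notin> B n u"
  shows "{u, w} \<in> outer_edges n v"
proof -
  have "u \<noteq> w" using assms block_self[of u d L n] block_hvert by blast
  then have "{u, w} \<in> E (Suc n) v" using assms by (auto simp: edges_in_def edge_iff block_hvert)
  moreover have "{u, w} \<notin> inner_edges n v"
  proof
    assume "{u, w} \<in> inner_edges n v"
    then obtain c where "c \<in> subblocks d L n v" "u \<in> c" "w \<in> c" by (auto simp: inner_edges_def edges_in_def)
    then show False using assms(3) subblocks_eq by blast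
  qed
  ultimately show ?thesis by (simp add: outer_edges_def)
qed

lemma inner_edges_subset: "v \<in> V \<Longrightarrow> inner_edges n v \<subseteq> E (Suc n) v"
  using subblocks_props(2)[of v n] by (auto simp: inner_edges_def edges_in_def)

lemma E_inner_edges: "v \<in> V \<Longrightarrow> w \<in> B (Suc n) v \<Longrightarrow> E n w \<subseteq> inner_edges n v"
  by (auto simp: inner_edges_def subblocks_def)

lemma inner_edges_outer_edges: "v \<in> V \<Longrightarrow> E (Suc n) v = inner_edges n v \<union> outer_edges n v" "inner_edges n v \<inter> outer_edges n v = {}"
  using inner_edges_subset by (auto simp: outer_edges_def)

lemma block_cluster_inner_edges:
  assumes "v \<in> V" "w \<in> B (Suc n) v" "Y \<subseteq> outer_edges n v" "m \<le> n"
  shows "block_cluster m w (X \<union> Y) = block_cluster m w X"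
proof -
  have "E m w \<subseteq> inner_edges n v"
    using E_inner_edges[OF assms(1,2)] edges_in_mono[OF block_mono[OF assms(4), of d L w], of d L] by blast
  then have "(X \<union> Y) \<inter> E m w = X \<inter> E m w" using assms(3) by (auto simp: outer_edges_def)
  then show ?thesis using depD[OF depends_on_block_cluster[of m w], of "X \<union> Y"] depD[OF depends_on_block_cluster[of m w], of X] by simp
qed

text \<open>Pairs inside a common subblock have shorter edges, already revealed, and are excluded. A
  vertex of \<open>W\<close> in the sibling \<open>c\<close> therefore sees only
  \<open>card U - card (U \<inter> c)\<close> vertices of \<open>U\<close>, the origin of the terms
  \<open>Z - z c\<close> in the energy.\<close>

lemma outer_edges_rate:
  assumes v: "v \<in> V" and U: "U \<subseteq> B (Suc n) v" and W: "W \<subseteq> B (Suc n) v - B n v" and UW: "U \<inter> W = {}"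
  defines "S \<equiv> (\<lambda>(u, w). {u, w}) ` {(u, w) \<in> U \<times> W. w \<notin> B n u}"
  shows "S \<subseteq> outer_edges n v"
    and "(\<Sum>e\<in>S. J e) = j (Suc n) * (\<Sum>c\<in>siblings n v. real (card (W \<inter> c)) * (real (card U) - real (card (U \<inter> c))))"
proof -
  note p = subblocks_props[OF v, where n = n]
  show sub: "S \<subseteq> outer_edges n v"
  proof
    fix e assume "e \<in> S"
    then obtain u w where "e = {u, w}" "u \<in> U" "w \<in> W" "w \<notin> B n u" unfolding S_def by auto
    then show "e \<in> outer_edges n v" using outer_edges_iff[of u n v w] U W by blast
  qed
  have f: "finite U" "finite W" using finite_subset[OF U] finite_subset[OF W] v by auto
  have inj: "inj_on (\<lambda>(u, w). {u, w}) {(u, w) \<in> U \<times> W. w \<notin> B n u}"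
    using inj_on_edges_between[OF UW] by (rule inj_on_subset) auto
  have lev: "J {u, w} = j (Suc n)" if "u \<in> U" "w \<in> W" "w \<notin> B n u" for u w
  proof -
    have u: "u \<in> B (Suc n) v" and w: "w \<in> B (Suc n) v" using that U W by auto
    have "w \<in> B (Suc n) u" using block_eq[OF u] w by simp
    then show ?thesis using elevel_Suc[of w d L n u] that block_hvert[OF u] by simp
  qed
  have "(\<Sum>e\<in>S. J e) = (\<Sum>x\<in>{(u, w) \<in> U \<times> W. w \<notin> B n u}. j (Suc n))"
    unfolding S_def by (subst sum.reindex[OF inj]) (intro sum.cong, auto simp: lev)
  also have "\<dots> = j (Suc n) * real (card {(u, w) \<in> U \<times> W. w \<notin> B n u})" by simp
  also have "real (card {(u, w) \<in> U \<times> W. w \<notin> B n u}) = (\<Sum>x\<in>U \<times> W. of_bool (snd x \<notin> B n (fst x)))"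
  proof -
    have "{(u, w) \<in> U \<times> W. w \<notin> B n u} = {x \<in> U \<times> W. snd x \<notin> B n (fst x)}" by auto
    then show ?thesis using f by (simp add: Int_def)
  qed
  also have "\<dots> = (\<Sum>u\<in>U. \<Sum>w\<in>W. of_bool (w \<notin> B n u))" by (simp add: sum.cartesian_product case_prod_unfold)
  also have "\<dots> = (\<Sum>w\<in>W. \<Sum>u\<in>U. of_bool (w \<notin> B n u))" by (rule sum.swap)
  also have "\<dots> = (\<Sum>w\<in>W. real (card U) - real (card (U \<inter> B n w)))"
  proof (rule sum.cong[OF refl])
    fix w assume w: "w \<in> W"
    have iff: "w \<notin> B n u \<longleftrightarrow> u \<notin> B n w" if "u \<in> U" for u
    proof -
      have "u \<in> V" "w \<in> V" using that w U W block_hvert by blast+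
      then show ?thesis using block_sym by blast
    qed
    have "(\<Sum>u\<in>U. of_bool (w \<notin> B n u)) = (\<Sum>u\<in>U. 1 - of_bool (u \<in> B n w) :: real)"
      by (intro sum.cong) (auto simp: iff)
    then show "(\<Sum>u\<in>U. of_bool (w \<notin> B n u)) = real (card U) - real (card (U \<inter> B n w))"
      using f by (simp add: sum_subtractf Int_def)
  qed
  also have "\<dots> = (\<Sum>c\<in>siblings n v. \<Sum>w\<in>W \<inter> c. real (card U) - real (card (U \<inter> B n w)))"
  proof -
    have "W = (\<Union>c\<in>siblings n v. W \<inter> c)" using W siblings_props(3)[OF v, of n] by blast
    then have "(\<Sum>w\<in>W. real (card U) - real (card (U \<inter> B n w)))
        = (\<Sum>w\<in>(\<Union>c\<in>siblings n v. W \<inter> c). real (card U) - real (card (U \<inter> B n w)))" by simp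
    also have "\<dots> = (\<Sum>c\<in>siblings n v. \<Sum>w\<in>W \<inter> c. real (card U) - real (card (U \<inter> B n w)))"
    proof (rule sum.UNION_disjoint)
      show "\<forall>x\<in>siblings n v. \<forall>y\<in>siblings n v. x \<noteq> y \<longrightarrow> W \<inter> x \<inter> (W \<inter> y) = {}"
        using p(3) unfolding siblings_def by blast
    qed (use siblings_props(1)[OF v] f in auto)
    finally show ?thesis .
  qed
  also have "\<dots> = (\<Sum>c\<in>siblings n v. \<Sum>w\<in>W \<inter> c. real (card U) - real (card (U \<inter> c)))"
    using subblocks_eq by (intro sum.cong refl) (auto simp: siblings_def)
  finally show "(\<Sum>e\<in>S. J e) = j (Suc n) * (\<Sum>c\<in>siblings n v. real (card (W \<inter> c)) * (real (card U) - real (card (U \<inter> c))))"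
    by simp
qed

definition big :: "real \<Rightarrow> nat \<Rightarrow> hvertex \<Rightarrow> hvertex set set \<Rightarrow> hvertex set set" where
  "big \<rho> n v X = {C. \<exists>w\<in>B (Suc n) v - B n v. C = block_cluster n w X \<and> \<rho> * N ^ n \<le> real (card C)}"

lemma big_props:
  assumes v: "v \<in> V"
  shows "finite (big \<rho> n v X)" "\<Union>(big \<rho> n v X) \<subseteq> B (Suc n) v - B n v"
    "\<And>C C'. C \<in> big \<rho> n v X \<Longrightarrow> C' \<in> big \<rho> n v X \<Longrightarrow> C \<noteq> C' \<Longrightarrow> C \<inter> C' = {}"
    "\<And>C. C \<in> big \<rho> n v X \<Longrightarrow> finite C \<and> \<rho> * N ^ n \<le> real (card C) \<and> (\<exists>c\<in>siblings n v. C \<subseteq> c)"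
proof -
  have c: "\<exists>c\<in>siblings n v. block_cluster n w X \<subseteq> c" if w: "w \<in> B (Suc n) v - B n v" for w
  proof -
    have wV: "w \<in> V" using w block_hvert by blast
    have "B n w \<noteq> B n v" using w block_self[OF wV, of n] by blast
    then have "B n w \<in> siblings n v" using w by (auto simp: siblings_def subblocks_def)
    then show ?thesis using block_cluster_subset[OF wV] by blast
  qed
  show "finite (big \<rho> n v X)"
    by (rule finite_subset[of _ "(\<lambda>w. block_cluster n w X) ` (B (Suc n) v - B n v)"]) (use v in \<open>auto simp: big_def\<close>)
  show 4: "finite C \<and> \<rho> * N ^ n \<le> real (card C) \<and> (\<exists>c\<in>siblings n v. C \<subseteq> c)" if "C \<in> big \<rho> n v X" for C
    using that c finite_block_cluster block_hvert by (auto simp: big_def)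
  show "\<Union>(big \<rho> n v X) \<subseteq> B (Suc n) v - B n v" using 4 siblings_props(3)[OF v, of n] by blast
  show "C \<inter> C' = {}" if C: "C \<in> big \<rho> n v X" "C' \<in> big \<rho> n v X" "C \<noteq> C'" for C C'
  proof (rule ccontr)
    assume "C \<inter> C' \<noteq> {}"
    then obtain x where x: "x \<in> C" "x \<in> C'" by blast
    obtain w where w: "C = block_cluster n w X" "w \<in> B (Suc n) v" using C(1) unfolding big_def by blast
    obtain w' where w': "C' = block_cluster n w' X" "w' \<in> B (Suc n) v" using C(2) unfolding big_def by blast
    have "block_cluster n x X = C" using x(1) w block_cluster_eq[of x n w X] block_hvert[OF w(2)] by simp
    moreover have "block_cluster n x X = C'" using x(2) w' block_cluster_eq[of x n w' X] block_hvert[OF w'(2)] by simp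
    ultimately show False using C(3) by simp
  qed
qed

text \<open>Disjoint clusters of at least \<open>\<rho> * N ^ n\<close> vertices must fit into
  \<open>N * N ^ n\<close> vertices. The bound does not depend on \<open>n\<close>, so a union bound
  over sets of large clusters costs only a constant.\<close>

lemma card_big:
  assumes v: "v \<in> V" and \<rho>: "0 < \<rho>"
  shows "card (big \<rho> n v X) \<le> nat \<lfloor>N / \<rho>\<rfloor>"
proof -
  note b = big_props[OF v, where \<rho> = \<rho> and n = n and X = X]
  have "real (card (big \<rho> n v X)) * (\<rho> * N ^ n) = (\<Sum>C\<in>big \<rho> n v X. \<rho> * N ^ n)" by simp
  also have "\<dots> \<le> (\<Sum>C\<in>big \<rho> n v X. real (card C))" using b(4) by (intro sum_mono) auto
  also have "\<dots> = real (card (\<Union>(big \<rho> n v X)))"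
    using b by (subst card_Union_disjoint) (auto simp: pairwise_def disjnt_def)
  also have "\<dots> \<le> real (card (B (Suc n) v))"
    using b(2) v by (intro of_nat_mono card_mono) auto
  also have "\<dots> = N * N ^ n" by (simp add: card_B v)
  finally have "(real (card (big \<rho> n v X)) * \<rho>) * N ^ n \<le> N * N ^ n" by (simp only: mult.assoc)
  then have "real (card (big \<rho> n v X)) * \<rho> \<le> N" using N0 by (simp only: mult_le_cancel_right_pos zero_less_power)
  then have "real (card (big \<rho> n v X)) \<le> N / \<rho>" using \<rho> by (simp add: pos_le_divide_eq)
  then show ?thesis by (simp add: le_nat_floor)
qed

end

text \<open>The kernel is prescribed above level \<open>n0\<close> only; smaller levels are left
  free for the start of the induction. \<theta> is the fraction required of a sibling block, \<rho>
  the density below which a cluster dies, \<open>q\<close> the exponent per unit of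
  \<open>zeta\<close>, and \<open>r1\<close> a smaller exponent at which mergers of nearly full
  clusters are charged.\<close>

locale hier_supercritical = hier_percolation d L j for d L j +
  fixes a \<theta> \<rho> q r1 :: real and n0 :: nat
  assumes theta: "0 < \<theta>" "\<theta> \<le> 1" and rho: "0 < \<rho>" "\<rho> \<le> 1"
    and q: "0 < r1" "r1 < q" "q \<le> a * \<theta>\<^sup>2"
    and n01: "1 \<le> n0"
    and jn: "n0 \<le> n \<Longrightarrow> j (Suc n) = a * N * loglog (Suc n) / N ^ (2 * Suc n)"
    and lamnn: "n0 \<le> n \<Longrightarrow> 0 \<le> loglog n"
begin

definition psi :: "nat \<Rightarrow> hvertex \<Rightarrow> hvertex set set \<Rightarrow> real" where
  "psi n v X = exp (- (q * loglog n * zeta \<theta> (cluster_density n v X)))"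

definition absorb_factor :: real where
  "absorb_factor = 2 ^ nat \<lfloor>N / \<rho>\<rfloor>"

text \<open>The two summands are the gains over the exponent \<open>q * \<zeta>0\<close>, when
  nothing is absorbed and when something is absorbed by a cluster that is not nearly full. Both tend
  to 0, which leaves room for every other error in the induction.\<close>

definition contraction :: "nat \<Rightarrow> real" where
  "contraction n = exp (- (loglog n * ((a * \<theta>\<^sup>2 - q) / 2 * \<rho>))) + absorb_factor * exp (- (loglog n * (\<rho> * (q - r1) / N)))"

lemma q0: "0 < q" using q by linarith

lemma a0: "0 < a"
  using q q0 theta by (metis zero_less_mult_pos2 zero_less_power dual_order.strict_trans1)

lemma cluster_density_nonneg: "0 \<le> cluster_density n v X"
  unfolding cluster_density_def using N0 by simp

lemma cluster_density_Suc_ge: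
  assumes "v \<in> V" "U \<subseteq> block_cluster (Suc n) v X"
  shows "real (card U) / N ^ n / N \<le> cluster_density (Suc n) v X"
proof -
  have "real (card U) \<le> real (card (block_cluster (Suc n) v X))"
    using assms finite_block_cluster by (intro of_nat_mono card_mono) auto
  then have "real (card U) / N ^ Suc n \<le> cluster_density (Suc n) v X"
    unfolding cluster_density_def using N0 by (intro divide_right_mono) auto
  then show ?thesis by (simp add: mult.commute)
qed

text \<open>Without information on the siblings only this remains: the cluster keeps its vertices,
  so its density drops by at most the factor \<open>N\<close>.\<close>

lemma inner_bad:
  assumes v: "v \<in> V" and n: "n0 \<le> n" and XY: "X \<subseteq> Y"
  shows "psi (Suc n) v Y \<le> exp (- (q * loglog (Suc n) * (zeta \<theta> (cluster_density n v X) / N)))"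
proof -
  have "cluster_density n v X / N \<le> cluster_density (Suc n) v Y"
    using cluster_density_Suc_ge[OF v block_cluster_Suc[OF XY]] by (simp add: cluster_density_def)
  then have "zeta \<theta> (cluster_density n v X) / N \<le> zeta \<theta> (cluster_density (Suc n) v Y)"
    using zeta_scale[OF theta(1), of N "cluster_density n v X"] zeta_mono[OF theta(1)] N2 cluster_density_nonneg[of n v X]
    by (smt (verit))
  then have "q * loglog (Suc n) * (zeta \<theta> (cluster_density n v X) / N) \<le> q * loglog (Suc n) * zeta \<theta> (cluster_density (Suc n) v Y)"
    using q0 lamnn[of "Suc n"] n by (intro mult_left_mono) auto
  then show ?thesis unfolding psi_def by (simp only: exp_le_cancel_iff neg_le_iff_le)
qed

text \<open>Union bound over the set \<open>\<J>\<close> of large sibling clusters that are absorbed by the cluster of \<open>v\<close>.\<close>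
lemma inner_good:
  assumes v: "v \<in> V" and n: "n0 \<le> n" and X: "X \<subseteq> inner_edges n v"
    and alive: "\<rho> \<le> cluster_density n v X"
    and nb: "\<And>c. c \<in> siblings n v \<Longrightarrow> \<theta> * N ^ n \<le> real (card (\<Union>(big \<rho> n v X) \<inter> c))"
  defines "lm \<equiv> loglog (Suc n)" and "\<zeta>0 \<equiv> zeta \<theta> (cluster_density n v X)"
  shows "ex (outer_edges n v) (\<lambda>Y. psi (Suc n) v (X \<union> Y))
    \<le> contraction (Suc n) * exp (- (q * lm * \<zeta>0)) + absorb_factor * exp (- (lm * r1))"
proof -
  define \<C> where "\<C> = big \<rho> n v X"
  define K0 where "K0 = block_cluster n v X"
  define U where "U \<J> = K0 \<union> \<Union>\<J>" for \<J>
  define W where "W \<J> = \<Union>(\<C> - \<J>)" for \<J>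
  define S where "S \<J> = (\<lambda>(u, w). {u, w}) ` {(u, w) \<in> U \<J> \<times> W \<J>. w \<notin> B n u}" for \<J>
  define g where "g \<J> = exp (- (q * lm * zeta \<theta> (real (card (U \<J>)) / N ^ n / N)))" for \<J>
  define joined where "joined Y = {C \<in> \<C>. C \<subseteq> block_cluster (Suc n) v (X \<union> Y)}" for Y
  note bp = big_props[OF v, where \<rho> = \<rho> and n = n and X = X, folded \<C>_def]
  have lm0: "0 \<le> lm" unfolding lm_def using lamnn n by simp
  have K0: "K0 \<subseteq> B n v" "K0 \<subseteq> B (Suc n) v" unfolding K0_def using block_cluster_subset[OF v, of n X] block_mono[of n "Suc n" d L v] by auto
  have fcross: "finite (outer_edges n v)" using v by (simp add: outer_edges_def)
  have UB: "U \<J> \<subseteq> B (Suc n) v" and WB: "W \<J> \<subseteq> B (Suc n) v - B n v" and UW: "U \<J> \<inter> W \<J> = {}"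
    if "\<J> \<subseteq> \<C>" for \<J>
  proof -
    show "U \<J> \<subseteq> B (Suc n) v" using that bp(2) K0 unfolding U_def by blast
    show W: "W \<J> \<subseteq> B (Suc n) v - B n v" using that bp(2) unfolding W_def by blast
    have "\<Union>\<J> \<inter> W \<J> = {}" using that bp(3) unfolding W_def by blast
    then show "U \<J> \<inter> W \<J> = {}" using W K0 unfolding U_def by blast
  qed
  \<comment> \<open>The summand that works is the set of all large clusters contained in the new
    cluster of \<open>v\<close>: an open edge from \<open>U\<close> to a further large cluster would
    absorb that one too. Absorbed small clusters only increase the density, so \<open>g\<close>
    stays an upper bound.\<close>
  have pt: "psi (Suc n) v (X \<union> Y) \<le> (\<Sum>\<J>\<in>Pow \<C>. of_bool (Y \<inter> S \<J> = {}) * g \<J>)"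
    if Y: "Y \<subseteq> outer_edges n v" for Y
  proof -
    let ?K = "block_cluster (Suc n) v (X \<union> Y)" and ?J = "joined Y"
    have J: "?J \<in> Pow \<C>" by (auto simp: joined_def)
    have UK: "U ?J \<subseteq> ?K" unfolding U_def K0_def joined_def using block_cluster_Suc[of X "X \<union> Y" n v] by auto
    have "Y \<inter> S ?J = {}"
    proof (rule ccontr)
      assume "Y \<inter> S ?J \<noteq> {}"
      then obtain u w where uw: "{u, w} \<in> Y" "u \<in> U ?J" "w \<in> W ?J" by (auto simp: S_def)
      then have "{u, w} \<in> (X \<union> Y) \<inter> hedges d L" using Y by (auto simp: outer_edges_def edges_in_def)
      moreover have "u \<in> ?K" using uw UK by blast
      moreover have "u \<in> B (Suc n) v" "w \<in> B (Suc n) v" using uw UB[of ?J] WB[of ?J] J by blast+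
      ultimately have w: "w \<in> ?K" unfolding block_cluster_def by (intro cluster_in_step[of u _ _ v w])
      obtain C where C: "C \<in> \<C>" "C \<notin> ?J" "w \<in> C" using uw(3) by (auto simp: W_def)
      obtain w0 where w0: "C = block_cluster n w0 X" "w0 \<in> B (Suc n) v" using C(1) unfolding \<C>_def big_def by blast
      have "block_cluster n w X = C" using block_cluster_eq[of w n w0 X] w0 C(3) block_hvert by blast
      then have "C \<subseteq> block_cluster (Suc n) w (X \<union> Y)" using block_cluster_Suc[of X "X \<union> Y" n w] by blast
      also have "\<dots> = ?K" by (rule block_cluster_eq[OF w v])
      finally show False using C by (simp add: joined_def)
    qed
    moreover have "psi (Suc n) v (X \<union> Y) \<le> g ?J"
      unfolding psi_def g_def lm_def[symmetric] using cluster_density_Suc_ge[OF v UK] zeta_mono[OF theta(1)] q0 lm0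
      by (auto intro!: mult_left_mono)
    ultimately have "psi (Suc n) v (X \<union> Y) \<le> of_bool (Y \<inter> S ?J = {}) * g ?J" by simp
    also have "\<dots> \<le> (\<Sum>\<J>\<in>Pow \<C>. of_bool (Y \<inter> S \<J> = {}) * g \<J>)"
      using bp(1) by (intro member_le_sum[OF J]) (auto simp: g_def)
    finally show ?thesis .
  qed
  define A where "A = exp (- (q * lm * \<zeta>0)) * exp (- (lm * ((a * \<theta>\<^sup>2 - q) / 2 * \<rho>)))"
  define D where "D = exp (- (q * lm * \<zeta>0)) * exp (- (lm * (\<rho> * (q - r1) / N))) + exp (- (lm * r1))"
  have D0: "0 \<le> D" by (simp add: D_def)
  have \<zeta>0: "\<rho> \<le> \<zeta>0" "\<zeta>0 \<le> 1" "0 \<le> \<zeta>0"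
    using zeta_ge[OF theta rho(2) _ alive] zeta_bounds[OF theta(1) cluster_density_nonneg] rho by (auto simp: \<zeta>0_def)
  \<comment> \<open>\<open>A\<close> pays for the empty set and \<open>D\<close> for all others;
    \<open>D\<close> is granted to the empty set as well, to make the sum over all sets
    uniform.\<close>
  have tm: "exp (- (\<Sum>e\<in>S \<J>. J e)) * g \<J> \<le> of_bool (\<J> = {}) * A + D" if J: "\<J> \<in> Pow \<C>" for \<J>
  proof -
    have J': "\<J> \<subseteq> \<C>" using J by simp
    define z where "z c = real (card (U \<J> \<inter> c)) / N ^ n" for c
    define w where "w c = real (card (W \<J> \<inter> c)) / N ^ n" for c
    define Z where "Z = cluster_density n v X + (\<Sum>c\<in>siblings n v. z c)"
    have Np: "N ^ n > 0" using N0 by simp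
    have fUW: "finite (U \<J>)" "finite (W \<J>)"
      using finite_subset[OF UB[OF J']] finite_subset[OF WB[OF J']] v by auto
    have "U \<J> \<inter> B n v = K0" using J' bp(2) K0 unfolding U_def by blast
    then have cU: "real (card (U \<J>)) = N ^ n * Z"
      unfolding card_split[OF v UB[OF J']] Z_def cluster_density_def z_def K0_def[symmetric]
      using Np by (simp add: distrib_left sum_distrib_left)
    have zc: "real (card (U \<J> \<inter> c)) = N ^ n * z c" "real (card (W \<J> \<inter> c)) = N ^ n * w c" for c
      using Np by (simp_all add: z_def w_def)
    have rate: "(\<Sum>e\<in>S \<J>. J e) = lm * (a / N * (\<Sum>c\<in>siblings n v. w c * (Z - z c)))"
    proof -
      have "(\<Sum>e\<in>S \<J>. J e) = j (Suc n) * (\<Sum>c\<in>siblings n v. (N ^ n * w c) * (N ^ n * Z - N ^ n * z c))"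
        unfolding S_def outer_edges_rate(2)[OF v UB[OF J'] WB[OF J'] UW[OF J']] cU zc ..
      also have "(\<Sum>c\<in>siblings n v. (N ^ n * w c) * (N ^ n * Z - N ^ n * z c)) = N ^ n * N ^ n * (\<Sum>c\<in>siblings n v. w c * (Z - z c))"
        unfolding sum_distrib_left by (intro sum.cong) (auto simp: algebra_simps)
      also have "j (Suc n) * (N ^ n * N ^ n * (\<Sum>c\<in>siblings n v. w c * (Z - z c))) = lm * (a / N * (\<Sum>c\<in>siblings n v. w c * (Z - z c)))"
      proof -
        have "a * b * lm / (b * x * (b * x)) * (x * x * y) = lm * (a / b * y)" if "b \<noteq> 0" "x \<noteq> 0" for b x y :: real
          using that by (simp add: field_simps)
        note al = this
        show ?thesis unfolding jn[OF n] lm_def[symmetric] mult_2 power_add power_Suc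
          by (rule al) (use N0 Np in linarith)+
      qed
      finally show ?thesis .
    qed
    \<comment> \<open>The mass of the large clusters in \<open>c\<close> is split between absorbed
      and rejected ones; nothing else is required of the sibling.\<close>
    have zw: "0 \<le> z c \<and> 0 \<le> w c \<and> \<theta> \<le> z c + w c" if c: "c \<in> siblings n v" for c
    proof -
      have "\<Union>\<C> \<inter> c \<subseteq> (U \<J> \<inter> c) \<union> (W \<J> \<inter> c)" unfolding U_def W_def by blast
      then have "card (\<Union>\<C> \<inter> c) \<le> card ((U \<J> \<inter> c) \<union> (W \<J> \<inter> c))" using fUW by (intro card_mono) auto
      also have "\<dots> \<le> card (U \<J> \<inter> c) + card (W \<J> \<inter> c)" by (rule card_Un_le)
      finally have "real (card (\<Union>\<C> \<inter> c)) \<le> N ^ n * (z c + w c)"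
        unfolding distrib_left zc[symmetric] of_nat_add[symmetric] by (rule of_nat_mono)
      then have "\<theta> * N ^ n \<le> (z c + w c) * N ^ n" 
        using nb[OF c] unfolding \<C>_def mult.commute[of "z c + w c"] by linarith
      then have "\<theta> \<le> z c + w c" using Np mult_right_le_imp_le by blast
      moreover have "0 \<le> z c" "0 \<le> w c" using Np by (simp_all add: z_def w_def)
      ultimately show ?thesis by blast
    qed
    have sp: "finite (siblings n v)" "real (card (siblings n v)) + 1 = N" using siblings_props[OF v] by auto
    have en1: "q * \<zeta>0 + q / N * (1 - \<zeta>0) * (\<Sum>c\<in>siblings n v. zeta \<theta> (z c))
        \<le> a / N * (\<Sum>c\<in>siblings n v. w c * (Z - z c)) + q * zeta \<theta> (Z / N)"
      unfolding Z_def \<zeta>0_def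
      by (rule energy_ge(1)[OF sp N2 zw cluster_density_nonneg theta(1) less_imp_le[OF a0] q(3) less_imp_le[OF q0]])
    have en2: "q * \<zeta>0 + (a * \<theta>\<^sup>2 - q) / 2 * \<zeta>0
        \<le> a / N * (\<Sum>c\<in>siblings n v. w c * (Z - z c)) + q * zeta \<theta> (Z / N)"
      if "\<And>c. c \<in> siblings n v \<Longrightarrow> z c = 0"
      unfolding Z_def \<zeta>0_def
      by (rule energy_ge(2)[OF sp N2 zw cluster_density_nonneg theta(1) less_imp_le[OF a0] q(3) less_imp_le[OF q0] that])
    have eq: "exp (- (\<Sum>e\<in>S \<J>. J e)) * g \<J>
        = exp (- (lm * (a / N * (\<Sum>c\<in>siblings n v. w c * (Z - z c)) + q * zeta \<theta> (Z / N))))"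
    proof -
      have "real (card (U \<J>)) / N ^ n / N = Z / N" unfolding cU using Np by simp
      then show ?thesis unfolding g_def rate exp_add[symmetric] by (simp add: mult_exp_exp algebra_simps)
    qed
    show ?thesis
    proof (cases "\<J> = {}")
      case True
      have z0: "z c = 0" if "c \<in> siblings n v" for c
      proof -
        have "c \<inter> B n v = {}" using that siblings_props(3)[OF v, of n] by blast
        then have "U \<J> \<inter> c = {}" using True K0 unfolding U_def by blast
        then show ?thesis by (simp add: z_def)
      qed
      have "(a * \<theta>\<^sup>2 - q) / 2 * \<rho> \<le> (a * \<theta>\<^sup>2 - q) / 2 * \<zeta>0" using \<zeta>0 q by (intro mult_left_mono) auto
      then have "q * \<zeta>0 + (a * \<theta>\<^sup>2 - q) / 2 * \<rho> \<le> a / N * (\<Sum>c\<in>siblings n v. w c * (Z - z c)) + q * zeta \<theta> (Z / N)"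
        using en2[OF z0] by linarith
      then have "lm * (q * \<zeta>0 + (a * \<theta>\<^sup>2 - q) / 2 * \<rho>) \<le> lm * (a / N * (\<Sum>c\<in>siblings n v. w c * (Z - z c)) + q * zeta \<theta> (Z / N))"
        using lm0 by (rule mult_left_mono)
      then have "exp (- (\<Sum>e\<in>S \<J>. J e)) * g \<J> \<le> exp (- (lm * (q * \<zeta>0 + (a * \<theta>\<^sup>2 - q) / 2 * \<rho>)))"
        unfolding eq by simp
      also have "\<dots> = A" unfolding A_def by (simp add: mult_exp_exp algebra_simps)
      finally show ?thesis using True D0 by simp
    next
      case False
      then obtain C where C: "C \<in> \<J>" by blast
      then obtain c where c: "c \<in> siblings n v" "C \<subseteq> c" "\<rho> * N ^ n \<le> real (card C)" using bp(4) J' by blast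
      have "C \<subseteq> U \<J> \<inter> c" using C c unfolding U_def by blast
      then have "real (card C) \<le> real (card (U \<J> \<inter> c))" using fUW by (intro of_nat_mono card_mono) auto
      then have "\<rho> * N ^ n \<le> z c * N ^ n"
        using c(3) zc(1)[of c] unfolding mult.commute[of "z c"] by linarith
      then have "\<rho> \<le> z c" using Np mult_right_le_imp_le by blast
      then have "\<rho> \<le> zeta \<theta> (z c)" using rho by (intro zeta_ge theta) auto
      also have "\<dots> \<le> (\<Sum>c\<in>siblings n v. zeta \<theta> (z c))"
        using zeta_bounds[OF theta(1)] zw by (intro member_le_sum[OF c(1) _ sp(1)]) auto
      finally have Y: "\<rho> \<le> (\<Sum>c\<in>siblings n v. zeta \<theta> (z c))" .
      have "q / N * (1 - \<zeta>0) * \<rho> \<le> q / N * (1 - \<zeta>0) * (\<Sum>c\<in>siblings n v. zeta \<theta> (z c))"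
        using Y \<zeta>0 q0 N0 by (intro mult_left_mono) auto
      then have e: "q * \<zeta>0 + q / N * (1 - \<zeta>0) * \<rho> \<le> a / N * (\<Sum>c\<in>siblings n v. w c * (Z - z c)) + q * zeta \<theta> (Z / N)"
        using en1 by linarith
      \<comment> \<open>The gain from absorption carries the factor \<open>1 - \<zeta>0\<close> and
        fades for nearly full clusters. But then \<open>q * \<zeta>0\<close> already reaches
        \<open>r1\<close>; otherwise \<open>q - q * \<zeta>0\<close> exceeds \<open>q - r1\<close>
        and the gain is bounded below.\<close>
      have mx: "min (q * \<zeta>0 + \<rho> * (q - r1) / N) r1 \<le> q * \<zeta>0 + q / N * (1 - \<zeta>0) * \<rho>"
      proof (cases "r1 \<le> q * \<zeta>0")
        case True
        have "0 \<le> q / N * (1 - \<zeta>0) * \<rho>" using \<zeta>0 q0 N0 rho by auto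
        then show ?thesis using True by linarith
      next
        case False
        then have "\<rho> / N * (q - r1) \<le> \<rho> / N * (q - q * \<zeta>0)" using rho N0 by (intro mult_left_mono) auto
        also have "\<dots> = q / N * (1 - \<zeta>0) * \<rho>" by (simp add: algebra_simps)
        finally show ?thesis by (simp add: min.coboundedI1)
      qed
      have "lm * min (q * \<zeta>0 + \<rho> * (q - r1) / N) r1 \<le> lm * (a / N * (\<Sum>c\<in>siblings n v. w c * (Z - z c)) + q * zeta \<theta> (Z / N))"
        using e mx lm0 by (intro mult_left_mono) linarith+
      then have "exp (- (\<Sum>e\<in>S \<J>. J e)) * g \<J> \<le> exp (- (lm * min (q * \<zeta>0 + \<rho> * (q - r1) / N) r1))"
        unfolding eq by simp
      also have "\<dots> \<le> exp (- (lm * (q * \<zeta>0 + \<rho> * (q - r1) / N))) + exp (- (lm * r1))"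
        by (cases "q * \<zeta>0 + \<rho> * (q - r1) / N \<le> r1") (simp_all add: min_def)
      also have "\<dots> = D" unfolding D_def by (simp add: mult_exp_exp algebra_simps)
      finally show ?thesis using False by simp
    qed
  qed
  have "ex (outer_edges n v) (\<lambda>Y. psi (Suc n) v (X \<union> Y)) \<le> ex (outer_edges n v) (\<lambda>Y. \<Sum>\<J>\<in>Pow \<C>. of_bool (Y \<inter> S \<J> = {}) * g \<J>)"
    by (rule bernoulli_ex_mono[OF J0 pt])
  also have "\<dots> = (\<Sum>\<J>\<in>Pow \<C>. ex (outer_edges n v) (\<lambda>Y. g \<J> * of_bool (Y \<inter> S \<J> = {})))"
    unfolding bernoulli_ex_sum by (simp only: mult.commute)
  also have "\<dots> = (\<Sum>\<J>\<in>Pow \<C>. exp (- (\<Sum>e\<in>S \<J>. J e)) * g \<J>)"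
  proof (rule sum.cong[OF refl])
    fix \<J> assume "\<J> \<in> Pow \<C>"
    then have J': "\<J> \<subseteq> \<C>" by simp
    have "S \<J> \<subseteq> outer_edges n v" unfolding S_def by (rule outer_edges_rate(1)[OF v UB[OF J'] WB[OF J'] UW[OF J']])
    then show "ex (outer_edges n v) (\<lambda>Y. g \<J> * of_bool (Y \<inter> S \<J> = {})) = exp (- (\<Sum>e\<in>S \<J>. J e)) * g \<J>"
      unfolding bernoulli_ex_cmult by (subst bernoulli_ex_closed[OF fcross]) auto
  qed
  also have "\<dots> \<le> (\<Sum>\<J>\<in>Pow \<C>. of_bool (\<J> = {}) * A + D)" by (rule sum_mono[OF tm])
  also have "\<dots> = A + 2 ^ card \<C> * D"
  proof -
    have "(\<Sum>\<J>\<in>Pow \<C>. of_bool (\<J> = {}) * A) = (\<Sum>\<J>\<in>Pow \<C>. if \<J> = {} then A else 0)" by (intro sum.cong) auto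
    also have "\<dots> = A" using bp(1) by simp
    finally show ?thesis using bp(1) by (simp add: sum.distrib card_Pow)
  qed
  also have "\<dots> \<le> A + absorb_factor * D"
    unfolding absorb_factor_def \<C>_def using card_big[OF v rho(1), of n X] D0
    by (intro add_left_mono mult_right_mono power_increasing) auto
  also have "\<dots> = contraction (Suc n) * exp (- (q * lm * \<zeta>0)) + absorb_factor * exp (- (lm * r1))"
    unfolding A_def D_def contraction_def lm_def[symmetric] by (simp add: algebra_simps)
  finally show ?thesis .
qed

end

section \<open>Survival of large clusters\<close>

context hier_supercritical
begin

text \<open>\<open>Phi\<close> controls the law of the density of the cluster of an alive vertex: the integrand is of order
  \<open>n powr - (q * x)\<close>, so a bound \<open>Phi n v \<le> n powr - r\<close> makes the probability of dying summable.\<close>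
definition alive :: "nat \<Rightarrow> hvertex \<Rightarrow> hvertex set set \<Rightarrow> bool" where
  "alive n v X \<longleftrightarrow> (\<forall>m. n0 \<le> m \<and> m \<le> n \<longrightarrow> \<rho> \<le> cluster_density m v X)"

definition dead_fraction :: "nat \<Rightarrow> hvertex set \<Rightarrow> hvertex set set \<Rightarrow> real" where
  "dead_fraction n c X = (\<Sum>w\<in>c. of_bool (\<not> alive n w X)) / N ^ n"

definition bad :: "nat \<Rightarrow> hvertex set \<Rightarrow> hvertex set set \<Rightarrow> bool" where
  "bad n c X \<longleftrightarrow> 1 - \<theta> < dead_fraction n c X"

definition Phi :: "nat \<Rightarrow> hvertex \<Rightarrow> real" where
  "Phi n v = ex (E n v) (\<lambda>X. of_bool (alive n v X) * psi n v X)"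

text \<open>Alive is tested at \<open>n\<close> but \<open>psi\<close> is taken at
  \<open>Suc n\<close>. This hybrid dominates \<open>Phi (Suc n) v\<close> and, by Markov's
  inequality, also controls the deaths at level \<open>Suc n\<close>.\<close>

definition Phi' :: "nat \<Rightarrow> hvertex \<Rightarrow> real" where
  "Phi' n v = ex (E (Suc n) v) (\<lambda>X. of_bool (alive n v X) * psi (Suc n) v X)"

definition death_prob :: "nat \<Rightarrow> hvertex \<Rightarrow> real" where
  "death_prob n v = ex (E n v) (\<lambda>X. of_bool (\<not> alive n v X))"

definition dead_mean :: "nat \<Rightarrow> hvertex set \<Rightarrow> real" where
  "dead_mean n c = ex (edges_in d L c) (dead_fraction n c)"

definition dead_variance :: "nat \<Rightarrow> hvertex set \<Rightarrow> real" where
  "dead_variance n c = ex (edges_in d L c) (\<lambda>X. (dead_fraction n c X - dead_mean n c)\<^sup>2)"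

lemma depends_on_alive: "depends_on (E n v) (alive n v)"
  unfolding depends_on_def
proof
  fix X
  have "cluster_density m v X = cluster_density m v (X \<inter> E n v)" if "m \<le> n" for m
  proof -
    have "E m v \<subseteq> E n v" by (intro edges_in_mono block_mono that)
    from depends_on_mono[OF depends_on_cluster_density this] show ?thesis unfolding depends_on_def by blast
  qed
  then show "alive n v X = alive n v (X \<inter> E n v)" unfolding alive_def by auto
qed

lemma depends_on_psi: "depends_on (E n v) (psi n v)"
  using depends_on_cluster_density[of n v] unfolding depends_on_def psi_def by auto

lemma depends_on_dead_fraction: "depends_on (E n v) (dead_fraction n (B n v))"
  unfolding depends_on_def
proof
  fix X
  have "alive n w X = alive n w (X \<inter> E n v)" if "w \<in> B n v" for w
    using depD[OF depends_on_alive[of n w], of X] block_eq[OF that] by simp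
  then show "dead_fraction n (B n v) X = dead_fraction n (B n v) (X \<inter> E n v)" unfolding dead_fraction_def by simp
qed

lemma sub_block: "c \<in> subblocks d L n v \<Longrightarrow> \<exists>w\<in>V. w \<in> B (Suc n) v \<and> c = B n w"
  unfolding subblocks_def using block_hvert by blast

lemma depends_on_dead_fraction_sub: "c \<in> subblocks d L n v \<Longrightarrow> depends_on (edges_in d L c) (dead_fraction n c)"
  using sub_block depends_on_dead_fraction by blast

lemma edges_in_disjoint: "c \<inter> c' = {} \<Longrightarrow> edges_in d L c \<inter> edges_in d L c' = {}"
  by (auto simp: edges_in_def hedges_def)

lemma edges_in_sub_inner_edges: "c \<in> subblocks d L n v \<Longrightarrow> edges_in d L c \<subseteq> inner_edges n v"
  by (auto simp: inner_edges_def)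

text \<open>An alive vertex lies in a large cluster, namely its own, so a dead fraction of at most
  \<open>1 - \<theta>\<close> leaves mass \<theta> for the large clusters.\<close>

lemma not_bad:
  assumes v: "v \<in> V" and n: "n0 \<le> n" and c: "c \<in> siblings n v" and nb: "\<not> bad n c X"
  shows "\<theta> * N ^ n \<le> real (card (\<Union>(big \<rho> n v X) \<inter> c))"
proof -
  have cs: "c \<in> subblocks d L n v" using c by (simp add: siblings_def)
  have fc: "finite c" "real (card c) = N ^ n" using subblocks_props(4)[OF v cs] by auto
  have Np: "0 < N ^ n" using N0 by simp
  have "dead_fraction n c X \<le> 1 - \<theta>" using nb by (simp add: bad_def)
  then have 1: "(\<Sum>w\<in>c. of_bool (\<not> alive n w X)) \<le> (1 - \<theta>) * N ^ n"
    unfolding dead_fraction_def using Np by (simp add: pos_divide_le_eq)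
  have sub: "{w \<in> c. alive n w X} \<subseteq> \<Union>(big \<rho> n v X) \<inter> c"
  proof
    fix w assume w: "w \<in> {w \<in> c. alive n w X}"
    then have "\<rho> \<le> cluster_density n w X" using n by (simp add: alive_def)
    then have "\<rho> * N ^ n \<le> real (card (block_cluster n w X))" unfolding cluster_density_def using Np by (simp add: pos_le_divide_eq)
    moreover have "w \<in> B (Suc n) v - B n v" using w c siblings_props(3)[OF v, of n] by blast
    ultimately have "block_cluster n w X \<in> big \<rho> n v X" unfolding big_def by blast
    then show "w \<in> \<Union>(big \<rho> n v X) \<inter> c" using w block_cluster_self by blast
  qed
  have "N ^ n - (1 - \<theta>) * N ^ n \<le> (\<Sum>w\<in>c. 1 - of_bool (\<not> alive n w X))"
    using 1 fc by (simp add: sum_subtractf)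
  also have "\<dots> = (\<Sum>w\<in>c. of_bool (alive n w X))" by (intro sum.cong) auto
  also have "\<dots> = real (card {w \<in> c. alive n w X})" using fc by (simp add: Int_def)
  also have "\<dots> \<le> real (card (\<Union>(big \<rho> n v X) \<inter> c))" using fc sub by (intro of_nat_mono card_mono) auto
  finally show ?thesis by (simp add: algebra_simps)
qed

text \<open>Condition on the inner edges. If no sibling is bad, \<open>inner_good\<close> applies.
  If one is, the weak bound \<open>inner_bad\<close> is multiplied by the probability
  \<open>b\<close> of a bad sibling, which is independent of the cluster of \<open>v\<close> in its
  own block.\<close>

lemma Phi'_le:
  assumes v: "v \<in> V" and n: "n0 \<le> n" and loglog: "loglog n \<le> loglog (Suc n)"
    and \<phi>: "Phi n v \<le> \<phi>" and b: "\<And>c. c \<in> siblings n v \<Longrightarrow> ex (edges_in d L c) (\<lambda>X. of_bool (bad n c X)) \<le> b"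
  shows "Phi' n v \<le> contraction (Suc n) * \<phi> + absorb_factor * exp (- (loglog (Suc n) * r1))
    + N * b * (exp (q * loglog (Suc n) / 2) * \<phi> + exp (- (q * loglog (Suc n) / (2 * N))))"
proof -
  define lm where "lm = loglog (Suc n)"
  define h where "h X = of_bool (alive n v X) * psi n v X" for X
  define \<beta> where "\<beta> = (\<lambda>c X. of_bool (bad n c X) :: real)"
  have lm0: "0 \<le> lm" unfolding lm_def using lamnn n by simp
  have fl: "finite (inner_edges n v)" "finite (outer_edges n v)"
    using finite_subset[OF inner_edges_subset[OF v]] v by (auto simp: outer_edges_def)
  have kap0: "0 \<le> contraction (Suc n)" "0 \<le> absorb_factor" by (auto simp: contraction_def absorb_factor_def)
  have h0: "0 \<le> h X" for X by (simp add: h_def psi_def)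
  have pt: "ex (outer_edges n v) (\<lambda>Y. of_bool (alive n v (X \<union> Y)) * psi (Suc n) v (X \<union> Y))
      \<le> contraction (Suc n) * h X + absorb_factor * exp (- (lm * r1))
        + (\<Sum>c\<in>siblings n v. exp (q * lm / 2) * (h X * \<beta> c X) + exp (- (q * lm / (2 * N))) * \<beta> c X)"
    (is "?L \<le> ?R1 + ?R2") if X: "X \<subseteq> inner_edges n v" for X
  proof -
    let ?\<zeta> = "zeta \<theta> (cluster_density n v X)"
    have R2: "0 \<le> ?R2" by (intro sum_nonneg add_nonneg_nonneg mult_nonneg_nonneg h0) (auto simp: \<beta>_def)
    have R1: "0 \<le> ?R1" using kap0 h0 by auto
    have al: "alive n v (X \<union> Y) = alive n v X" if "Y \<subseteq> outer_edges n v" for Y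
      unfolding alive_def cluster_density_def using block_cluster_inner_edges[OF v block_self[OF v] that, of _ X] by auto
    have L: "?L = of_bool (alive n v X) * ex (outer_edges n v) (\<lambda>Y. psi (Suc n) v (X \<union> Y))"
      unfolding bernoulli_ex_cmult[symmetric] by (rule bernoulli_ex_cong) (simp add: al)
    show ?thesis
    proof (cases "alive n v X")
      case False
      then show ?thesis using L R1 R2 by simp
    next
      case True
      then have dn: "\<rho> \<le> cluster_density n v X" using n by (simp add: alive_def)
      have pl: "exp (- (q * lm * ?\<zeta>)) \<le> h X"
      proof -
        have "q * loglog n * ?\<zeta> \<le> q * lm * ?\<zeta>"
          using loglog q0 zeta_bounds[OF theta(1) cluster_density_nonneg] unfolding lm_def by (intro mult_right_mono mult_left_mono) auto
        then show ?thesis using True by (simp add: h_def psi_def)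
      qed
      show ?thesis
      proof (cases "\<exists>c\<in>siblings n v. bad n c X")
        case False
        have "ex (outer_edges n v) (\<lambda>Y. psi (Suc n) v (X \<union> Y)) \<le> contraction (Suc n) * exp (- (q * lm * ?\<zeta>)) + absorb_factor * exp (- (lm * r1))"
          unfolding lm_def by (rule inner_good[OF v n X dn]) (use not_bad[OF v n] False in auto)
        also have "\<dots> \<le> ?R1" using pl kap0 by (auto intro: mult_left_mono)
        finally show ?thesis using L True R2 by simp
      next
        case bd: True
        then obtain c where c: "c \<in> siblings n v" "bad n c X" by blast
        have "ex (outer_edges n v) (\<lambda>Y. psi (Suc n) v (X \<union> Y)) \<le> exp (- (q * lm * (?\<zeta> / N)))"
          unfolding lm_def by (rule bernoulli_ex_le_const[OF fl(2) J0]) (rule inner_bad[OF v n], auto)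
        \<comment> \<open>For \<open>zeta\<close> at least 1/2 the diluted exponent is good enough.
          Below 1/2, \<open>h X\<close> is at least \<open>exp (- (q * lm / 2))\<close>, and trading
          the constant 1 for \<open>h X\<close> brings back the small factor
          \<open>Phi\<close>.\<close>
        also have "\<dots> \<le> exp (q * lm / 2) * h X + exp (- (q * lm / (2 * N)))"
        proof (cases "1 / 2 \<le> ?\<zeta>")
          case True
          have "q * lm * (1 / 2 / N) \<le> q * lm * (?\<zeta> / N)"
            using True q0 lm0 N0 by (intro mult_left_mono divide_right_mono) auto
          then have "exp (- (q * lm * (?\<zeta> / N))) \<le> exp (- (q * lm / (2 * N)))" by simp
          then show ?thesis using h0[of X] by (smt (verit) mult_nonneg_nonneg exp_ge_zero)
        next
          case False
          have "q * lm * ?\<zeta> \<le> q * lm * (1 / 2)" using False q0 lm0 by (intro mult_left_mono) auto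
          then have "1 \<le> exp (q * lm / 2) * exp (- (q * lm * ?\<zeta>))" by (simp add: mult_exp_exp)
          also have "\<dots> \<le> exp (q * lm / 2) * h X" using pl by (intro mult_left_mono) auto
          finally have "1 \<le> exp (q * lm / 2) * h X" .
          moreover have "exp (- (q * lm * (?\<zeta> / N))) \<le> 1"
            using q0 lm0 zeta_bounds[OF theta(1) cluster_density_nonneg[of n v X]] N0 by simp
          ultimately show ?thesis by (smt (verit) exp_ge_zero)
        qed
        also have "\<dots> = exp (q * lm / 2) * (h X * \<beta> c X) + exp (- (q * lm / (2 * N))) * \<beta> c X"
          using c by (simp add: \<beta>_def)
        also have "\<dots> \<le> ?R2"
          using siblings_props(1)[OF v, of n] h0
          by (intro member_le_sum[OF c(1)] add_nonneg_nonneg mult_nonneg_nonneg) (auto simp: \<beta>_def)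
        finally show ?thesis using L True R1 \<open>alive n v X\<close> by simp
      qed
    qed
  qed
  have "Phi' n v = ex (inner_edges n v) (\<lambda>X. ex (outer_edges n v) (\<lambda>Y. of_bool (alive n v (X \<union> Y)) * psi (Suc n) v (X \<union> Y)))"
    unfolding Phi'_def inner_edges_outer_edges(1)[OF v] by (rule bernoulli_ex_Un[OF fl inner_edges_outer_edges(2)])
  also have "\<dots> \<le> ex (inner_edges n v) (\<lambda>X. (contraction (Suc n) * h X + absorb_factor * exp (- (lm * r1)))
        + (\<Sum>c\<in>siblings n v. exp (q * lm / 2) * (h X * \<beta> c X) + exp (- (q * lm / (2 * N))) * \<beta> c X))"
    by (rule bernoulli_ex_mono[OF J0 pt])
  also have "\<dots> = contraction (Suc n) * ex (inner_edges n v) h + absorb_factor * exp (- (lm * r1))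
        + (\<Sum>c\<in>siblings n v. exp (q * lm / 2) * ex (inner_edges n v) (\<lambda>X. h X * \<beta> c X) + exp (- (q * lm / (2 * N))) * ex (inner_edges n v) (\<beta> c))"
    by (simp only: bernoulli_ex_add bernoulli_ex_sum bernoulli_ex_cmult bernoulli_ex_const[OF fl(1)])
  also have "\<dots> \<le> contraction (Suc n) * \<phi> + absorb_factor * exp (- (lm * r1))
        + (\<Sum>c\<in>siblings n v. exp (q * lm / 2) * (\<phi> * b) + exp (- (q * lm / (2 * N))) * b)"
  proof (intro add_mono sum_mono mult_left_mono order_refl)
    have dh: "depends_on (E n v) h"
      unfolding depends_on_def h_def using depD[OF depends_on_alive[of n v]] depD[OF depends_on_psi[of n v]] by simp
    have sub: "E n v \<subseteq> inner_edges n v" by (rule E_inner_edges[OF v block_self[OF v]])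
    have hphi: "ex (inner_edges n v) h = Phi n v" unfolding Phi_def h_def[symmetric] by (rule bernoulli_ex_depends_on[OF fl(1) sub dh])
    then show "ex (inner_edges n v) h \<le> \<phi>" using \<phi> by simp
    fix c assume c: "c \<in> siblings n v"
    then have cs: "c \<in> subblocks d L n v" "c \<noteq> B n v" by (auto simp: siblings_def)
    have dj: "E n v \<inter> edges_in d L c = {}"
      using subblocks_props(3)[OF v subblocks_props(6)[OF v] cs(1)] cs(2) by (intro edges_in_disjoint) auto
    have db: "depends_on (edges_in d L c) (\<beta> c)" using depends_on_dead_fraction_sub[OF cs(1)] unfolding depends_on_def \<beta>_def bad_def by metis
    have be: "ex (inner_edges n v) (\<beta> c) = ex (edges_in d L c) (\<beta> c)" by (rule bernoulli_ex_depends_on[OF fl(1) edges_in_sub_inner_edges[OF cs(1)] db])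
    show bb: "ex (inner_edges n v) (\<beta> c) \<le> b" using b[OF c] unfolding be unfolding \<beta>_def .
    have "ex (inner_edges n v) (\<lambda>X. h X * \<beta> c X) = ex (inner_edges n v) h * ex (inner_edges n v) (\<beta> c)"
      by (rule bernoulli_ex_indep[OF fl(1) sub edges_in_sub_inner_edges[OF cs(1)] dj dh db])
    also have "\<dots> \<le> \<phi> * b"
    proof (rule mult_mono)
      show "0 \<le> \<phi>" using \<phi> hphi bernoulli_ex_nonneg[of J "inner_edges n v" h] h0 J0 by force
      show "0 \<le> ex (inner_edges n v) (\<beta> c)" using J0 by (intro bernoulli_ex_nonneg) (auto simp: \<beta>_def)
    qed (use hphi \<phi> bb in auto)
    finally show "ex (inner_edges n v) (\<lambda>X. h X * \<beta> c X) \<le> \<phi> * b" .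
  qed (use kap0 in auto)
  also have "\<dots> = contraction (Suc n) * \<phi> + absorb_factor * exp (- (lm * r1))
        + (N - 1) * (b * (exp (q * lm / 2) * \<phi> + exp (- (q * lm / (2 * N)))))"
  proof -
    have c: "real (card (siblings n v)) = N - 1" using siblings_props(2)[OF v, of n] by linarith
    have "exp (q * lm / 2) * (\<phi> * b) + exp (- (q * lm / (2 * N))) * b
        = b * (exp (q * lm / 2) * \<phi> + exp (- (q * lm / (2 * N))))" by (simp add: algebra_simps)
    then show ?thesis unfolding sum_constant c by (simp only:)
  qed
  also have "\<dots> \<le> contraction (Suc n) * \<phi> + absorb_factor * exp (- (lm * r1))
        + N * (b * (exp (q * lm / 2) * \<phi> + exp (- (q * lm / (2 * N)))))"
  proof (intro add_left_mono mult_right_mono)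
    have "siblings n v \<noteq> {}" using siblings_props(2)[OF v, of n] N2 by auto
    then obtain c where c: "c \<in> siblings n v" by blast
    have "0 \<le> b" using b[OF c] bernoulli_ex_nonneg[of J "edges_in d L c" "\<lambda>X. of_bool (bad n c X)"] J0 by force
    moreover have "0 \<le> \<phi>" using \<phi> bernoulli_ex_nonneg[of J "E n v" h] h0 J0 unfolding Phi_def h_def by force
    ultimately show "0 \<le> b * (exp (q * lm / 2) * \<phi> + exp (- (q * lm / (2 * N))))" by simp
  qed simp
  finally show ?thesis unfolding lm_def by (simp add: mult.assoc)
qed

text \<open>Markov's inequality: at death \<open>zeta\<close> is at most
  \<open>\<rho> / \<theta>\<close>, so \<open>psi\<close> is not small. The price is
  \<open>q * \<rho> / \<theta>\<close> in the exponent, which is why \<rho> must be small.\<close>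

lemma newly_dead_le:
  assumes v: "v \<in> V" and n: "n0 \<le> n"
  shows "ex (E (Suc n) v) (\<lambda>X. of_bool (alive n v X \<and> \<not> alive (Suc n) v X))
    \<le> exp (loglog (Suc n) * (q * \<rho> / \<theta>)) * Phi' n v"
  unfolding Phi'_def bernoulli_ex_cmult[symmetric]
proof (rule bernoulli_ex_mono[OF J0])
  fix X
  show "of_bool (alive n v X \<and> \<not> alive (Suc n) v X)
    \<le> exp (loglog (Suc n) * (q * \<rho> / \<theta>)) * (of_bool (alive n v X) * psi (Suc n) v X)"
  proof (cases "alive n v X \<and> \<not> alive (Suc n) v X")
    case True
    then have "\<not> \<rho> \<le> cluster_density (Suc n) v X" unfolding alive_def by (metis le_Suc_eq)
    then have "cluster_density (Suc n) v X / \<theta> \<le> \<rho> / \<theta>" using theta by (intro divide_right_mono) auto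
    then have "zeta \<theta> (cluster_density (Suc n) v X) \<le> \<rho> / \<theta>" unfolding zeta_def by (rule min.coboundedI2)
    then have "q * loglog (Suc n) * zeta \<theta> (cluster_density (Suc n) v X) \<le> q * loglog (Suc n) * (\<rho> / \<theta>)"
      using q0 lamnn n by (intro mult_left_mono) auto
    then have "1 \<le> exp (loglog (Suc n) * (q * \<rho> / \<theta>)) * psi (Suc n) v X"
      unfolding psi_def by (simp add: mult_exp_exp mult_ac)
    then show ?thesis using True by simp
  next
    case False
    then show ?thesis by (cases "alive n v X") (auto simp: psi_def)
  qed
qed

lemma Phi_Suc_le: "Phi (Suc n) v \<le> Phi' n v"
  unfolding Phi_def Phi'_def by (rule bernoulli_ex_mono[OF J0]) (auto simp: psi_def alive_def)

lemma death_prob_Suc_le: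
  assumes v: "v \<in> V"
  shows "death_prob (Suc n) v \<le> death_prob n v + ex (E (Suc n) v) (\<lambda>X. of_bool (alive n v X \<and> \<not> alive (Suc n) v X))"
proof -
  have sub: "E n v \<subseteq> E (Suc n) v" by (intro edges_in_mono block_mono) auto
  have "death_prob (Suc n) v \<le> ex (E (Suc n) v) (\<lambda>X. of_bool (\<not> alive n v X) + of_bool (alive n v X \<and> \<not> alive (Suc n) v X))"
    unfolding death_prob_def by (rule bernoulli_ex_mono[OF J0]) auto
  moreover have "ex (E (Suc n) v) (\<lambda>X. of_bool (\<not> alive n v X)) = death_prob n v"
    unfolding death_prob_def by (rule bernoulli_ex_depends_on[OF _ sub]) (use v depends_on_alive[of n v] in \<open>auto simp: depends_on_def\<close>)
  ultimately show ?thesis by (simp add: bernoulli_ex_add)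
qed

text \<open>Averaging over the independent subblocks contracts the variance; newly dead vertices are the only source.\<close>
lemma dead_variance_Suc_le:
  assumes v: "v \<in> V" and V: "\<And>c. c \<in> subblocks d L n v \<Longrightarrow> dead_variance n c \<le> vn"
    and \<delta>: "\<And>w. w \<in> B (Suc n) v \<Longrightarrow> ex (E (Suc n) w) (\<lambda>X. of_bool (alive n w X \<and> \<not> alive (Suc n) w X)) \<le> \<delta>"
  shows "dead_variance (Suc n) (B (Suc n) v) \<le> 3 / 4 * vn + 3 * \<delta>"
proof -
  let ?C = "E (Suc n) v" and ?S = "subblocks d L n v" and ?B = "B (Suc n) v"
  define \<Delta> where "\<Delta> X = (\<Sum>w\<in>?B. of_bool (alive n w X \<and> \<not> alive (Suc n) w X)) / N ^ Suc n" for X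
  define D where "D c X = dead_fraction n c X - dead_mean n c" for c X
  define A where "A X = (\<Sum>c\<in>?S. D c X) / N" for X
  define m where "m = ex ?C \<Delta>"
  note sp = subblocks_props[OF v, where n = n]
  have fC: "finite ?C" using v by simp
  have Np: "0 < N ^ Suc n" using zero_less_power[OF N0] .
  have sub: "edges_in d L c \<subseteq> ?C" if "c \<in> ?S" for c using sp(2) that by (intro edges_in_mono) blast
  have Zsplit: "dead_fraction (Suc n) ?B X = (\<Sum>c\<in>?S. dead_fraction n c X) / N + \<Delta> X" for X
  proof -
    have "(\<Sum>w\<in>?B. of_bool (\<not> alive (Suc n) w X))
       = (\<Sum>w\<in>?B. of_bool (\<not> alive n w X) + of_bool (alive n w X \<and> \<not> alive (Suc n) w X) :: real)"
      by (intro sum.cong) (auto simp: alive_def)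
    moreover have "(\<Sum>w\<in>?B. of_bool (\<not> alive n w X)) = (\<Sum>c\<in>?S. \<Sum>w\<in>c. of_bool (\<not> alive n w X) :: real)"
      unfolding sp(2)[symmetric] by (rule sum.Union_disjoint[unfolded comp_def]) (use sp(3,4) in auto)
    ultimately show ?thesis
      unfolding dead_fraction_def \<Delta>_def
      by (simp add: sum.distrib add_divide_distrib sum_divide_distrib[symmetric] mult.commute)
  qed
  have dead_mean_c: "ex ?C (dead_fraction n c) = dead_mean n c" if "c \<in> ?S" for c
    unfolding dead_mean_def by (rule bernoulli_ex_depends_on[OF fC sub[OF that] depends_on_dead_fraction_sub[OF that]])
  have muB: "dead_mean (Suc n) ?B = (\<Sum>c\<in>?S. dead_mean n c) / N + m"
  proof -
    have "dead_mean (Suc n) ?B = ex ?C (\<lambda>X. (\<Sum>c\<in>?S. dead_fraction n c X) / N + \<Delta> X)"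
      unfolding dead_mean_def by (rule bernoulli_ex_cong) (rule Zsplit)
    also have "\<dots> = (\<Sum>c\<in>?S. ex ?C (dead_fraction n c)) / N + m" unfolding bernoulli_ex_add bernoulli_ex_cdiv bernoulli_ex_sum m_def ..
    finally show ?thesis using dead_mean_c by simp
  qed
  have dD: "depends_on (edges_in d L c) (D c)" if "c \<in> ?S" for c
    using depends_on_dead_fraction_sub[OF that] unfolding depends_on_def D_def by metis
  have D0: "ex ?C (D c) = 0" if "c \<in> ?S" for c
    unfolding D_def bernoulli_ex_diff bernoulli_ex_const[OF fC] dead_mean_c[OF that] by simp
  \<comment> \<open>Different subblocks have disjoint edge sets, so centred dead fractions are
    uncorrelated and the variance of their average is divided by \<open>N\<close>.\<close>
  have DD: "ex ?C (\<lambda>X. D c X * D c' X) = of_bool (c = c') * dead_variance n c" if "c \<in> ?S" "c' \<in> ?S" for c c'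
  proof (cases "c = c'")
    case True
    have "depends_on (edges_in d L c) (\<lambda>X. (D c X)\<^sup>2)" using dD[OF that(1)] unfolding depends_on_def by metis
    then have "ex ?C (\<lambda>X. (D c X)\<^sup>2) = dead_variance n c" unfolding dead_variance_def D_def by (rule bernoulli_ex_depends_on[OF fC sub[OF that(1)]])
    then show ?thesis using True by (simp add: power2_eq_square)
  next
    case False
    have "ex ?C (\<lambda>X. D c X * D c' X) = ex ?C (D c) * ex ?C (D c')"
      by (rule bernoulli_ex_indep[OF fC sub[OF that(1)] sub[OF that(2)] edges_in_disjoint dD[OF that(1)] dD[OF that(2)]])
        (rule sp(3)[OF that False])
    then show ?thesis using False D0[OF that(1)] by simp
  qed
  have AA: "ex ?C (\<lambda>X. (A X)\<^sup>2) \<le> vn / 2"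
  proof -
    have "ex ?C (\<lambda>X. (A X)\<^sup>2) = ex ?C (\<lambda>X. (\<Sum>c\<in>?S. \<Sum>c'\<in>?S. D c X * D c' X) / (N * N))"
      by (rule bernoulli_ex_cong) (simp add: A_def power2_eq_square sum_product)
    also have "\<dots> = (\<Sum>c\<in>?S. \<Sum>c'\<in>?S. of_bool (c = c') * dead_variance n c) / (N * N)"
      unfolding bernoulli_ex_cdiv bernoulli_ex_sum using DD by simp
    also have "(\<Sum>c\<in>?S. \<Sum>c'\<in>?S. of_bool (c = c') * dead_variance n c) = (\<Sum>c\<in>?S. dead_variance n c)"
    proof (rule sum.cong[OF refl])
      fix c assume "c \<in> ?S"
      have "(\<Sum>c'\<in>?S. of_bool (c = c') * dead_variance n c) = (\<Sum>c'\<in>?S. if c = c' then dead_variance n c else 0)"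
        by (intro sum.cong) auto
      then show "(\<Sum>c'\<in>?S. of_bool (c = c') * dead_variance n c) = dead_variance n c" using \<open>c \<in> ?S\<close> sp(1) by simp
    qed
    also have "(\<Sum>c\<in>?S. dead_variance n c) / (N * N) \<le> (N * vn) / (N * N)"
    proof (intro divide_right_mono)
      have "(\<Sum>c\<in>?S. dead_variance n c) \<le> (\<Sum>c\<in>?S. vn)" by (rule sum_mono[OF V])
      then show "(\<Sum>c\<in>?S. dead_variance n c) \<le> N * vn" using sp(5) by simp
    qed (use N0 in auto)
    also have "\<dots> = vn / N" using N0 by simp
    also have "\<dots> \<le> vn / 2"
    proof -
      obtain c where c: "c \<in> ?S" using sp(6) by blast
      have "0 \<le> dead_variance n c" unfolding dead_variance_def using J0 by (intro bernoulli_ex_nonneg) auto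
      then have "0 \<le> vn" using V[OF c] by linarith
      then show ?thesis by (intro divide_left_mono N2) (use N0 in linarith)+
    qed
    finally show ?thesis .
  qed
  have \<Delta>01: "0 \<le> \<Delta> X \<and> \<Delta> X \<le> 1" for X
  proof -
    have "(\<Sum>w\<in>?B. of_bool (alive n w X \<and> \<not> alive (Suc n) w X)) \<le> (\<Sum>w\<in>?B. 1::real)" by (intro sum_mono) auto
    then have "(\<Sum>w\<in>?B. of_bool (alive n w X \<and> \<not> alive (Suc n) w X)) \<le> N ^ Suc n" using card_B[OF v, of "Suc n"] by simp
    moreover have "0 \<le> (\<Sum>w\<in>?B. of_bool (alive n w X \<and> \<not> alive (Suc n) w X) :: real)" by (intro sum_nonneg) auto
    ultimately show ?thesis unfolding \<Delta>_def using Np by (auto simp only: zero_le_divide_iff pos_divide_le_eq mult_1)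
  qed
  have m\<delta>: "m \<le> \<delta>"
  proof -
    have "m = (\<Sum>w\<in>?B. ex ?C (\<lambda>X. of_bool (alive n w X \<and> \<not> alive (Suc n) w X))) / N ^ Suc n"
      unfolding m_def \<Delta>_def bernoulli_ex_cdiv bernoulli_ex_sum ..
    also have "\<dots> \<le> (\<Sum>w\<in>?B. \<delta>) / N ^ Suc n"
    proof (intro divide_right_mono sum_mono)
      fix w assume w: "w \<in> ?B"
      show "ex ?C (\<lambda>X. of_bool (alive n w X \<and> \<not> alive (Suc n) w X)) \<le> \<delta>"
        using \<delta>[OF w] unfolding block_eq[OF w] .
    qed (use Np in linarith)
    also have "\<dots> = \<delta>" using card_B[OF v, of "Suc n"] Np by simp
    finally show ?thesis .
  qed
  \<comment> \<open>For a variable with values in [0, 1] the second moment is at most the mean, so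
    new deaths enter linearly.\<close>
  have DeltaV: "ex ?C (\<lambda>X. (\<Delta> X - m)\<^sup>2) \<le> \<delta>"
  proof -
    have "ex ?C (\<lambda>X. (\<Delta> X - m)\<^sup>2) = ex ?C (\<lambda>X. ((\<Delta> X)\<^sup>2 - 2 * m * \<Delta> X) + m\<^sup>2)"
      by (rule bernoulli_ex_cong) (simp add: power2_diff algebra_simps)
    also have "\<dots> = ex ?C (\<lambda>X. (\<Delta> X)\<^sup>2) - m\<^sup>2"
      unfolding bernoulli_ex_add bernoulli_ex_diff bernoulli_ex_cmult bernoulli_ex_const[OF fC] m_def[symmetric] by (simp add: power2_eq_square)
    also have "\<dots> \<le> ex ?C (\<lambda>X. (\<Delta> X)\<^sup>2)" by simp
    also have "\<dots> \<le> ex ?C \<Delta>"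
    proof (rule bernoulli_ex_mono[OF J0])
      fix X show "(\<Delta> X)\<^sup>2 \<le> \<Delta> X" using \<Delta>01[of X] mult_left_le_one_le[of "\<Delta> X" "\<Delta> X"] by (simp add: power2_eq_square)
    qed
    finally show ?thesis using m\<delta> by (simp add: m_def)
  qed
  have "dead_variance (Suc n) ?B = ex ?C (\<lambda>X. (A X + (\<Delta> X - m))\<^sup>2)"
    unfolding dead_variance_def
  proof (rule bernoulli_ex_cong)
    fix X
    have "A X = (\<Sum>c\<in>?S. dead_fraction n c X) / N - (\<Sum>c\<in>?S. dead_mean n c) / N"
      by (simp add: A_def D_def sum_subtractf diff_divide_distrib)
    then have "dead_fraction (Suc n) ?B X - dead_mean (Suc n) ?B = A X + (\<Delta> X - m)" unfolding Zsplit muB by simp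
    then show "(dead_fraction (Suc n) ?B X - dead_mean (Suc n) ?B)\<^sup>2 = (A X + (\<Delta> X - m))\<^sup>2" by simp
  qed
  \<comment> \<open>The unequal weights are chosen so that 3/2, multiplied by the factor 1/2 from
    averaging, is 3/4 and thus still a contraction.\<close>
  also have "\<dots> \<le> ex ?C (\<lambda>X. 3 / 2 * (A X)\<^sup>2 + 3 * (\<Delta> X - m)\<^sup>2)"
  proof (rule bernoulli_ex_mono[OF J0])
    fix X
    have "0 \<le> (A X - 2 * (\<Delta> X - m))\<^sup>2" by simp
    then show "(A X + (\<Delta> X - m))\<^sup>2 \<le> 3 / 2 * (A X)\<^sup>2 + 3 * (\<Delta> X - m)\<^sup>2"
      by (simp add: power2_eq_square algebra_simps)
  qed
  also have "\<dots> = 3 / 2 * ex ?C (\<lambda>X. (A X)\<^sup>2) + 3 * ex ?C (\<lambda>X. (\<Delta> X - m)\<^sup>2)"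
    unfolding bernoulli_ex_add bernoulli_ex_cmult ..
  also have "\<dots> \<le> 3 / 2 * (vn / 2) + 3 * \<delta>" using AA DeltaV by linarith
  finally show ?thesis by simp
qed

text \<open>Chebyshev's inequality: the mean dead fraction is at most half of the threshold
  \<open>1 - \<theta>\<close>, so a bad block deviates from its mean by at least the other
  half.\<close>

lemma bad_prob_le:
  assumes w: "w \<in> V" and \<theta>1: "\<theta> < 1"
    and death_prob: "\<And>x. x \<in> B n w \<Longrightarrow> death_prob n x \<le> (1 - \<theta>) / 2" and dead_variance: "dead_variance n (B n w) \<le> vn"
  shows "ex (E n w) (\<lambda>X. of_bool (bad n (B n w) X)) \<le> 4 / (1 - \<theta>)\<^sup>2 * vn"
proof -
  have Np: "0 < N ^ n" using zero_less_power[OF N0] .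
  have dead_mean: "dead_mean n (B n w) \<le> (1 - \<theta>) / 2"
  proof -
    have "dead_mean n (B n w) = (\<Sum>x\<in>B n w. ex (E n w) (\<lambda>X. of_bool (\<not> alive n x X))) / N ^ n"
      unfolding dead_mean_def dead_fraction_def bernoulli_ex_cdiv bernoulli_ex_sum ..
    also have "\<dots> \<le> (\<Sum>x\<in>B n w. (1 - \<theta>) / 2) / N ^ n"
    proof (intro divide_right_mono sum_mono)
      fix x assume x: "x \<in> B n w"
      show "ex (E n w) (\<lambda>X. of_bool (\<not> alive n x X)) \<le> (1 - \<theta>) / 2"
        using death_prob[OF x] unfolding death_prob_def block_eq[OF x] .
    qed (use Np in linarith)
    also have "\<dots> = (1 - \<theta>) / 2"
      unfolding sum_constant card_B[OF w] by (rule nonzero_mult_div_cancel_left) (use Np in linarith)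
    finally show ?thesis .
  qed
  have "ex (E n w) (\<lambda>X. of_bool (bad n (B n w) X)) \<le> ex (E n w) (\<lambda>X. 4 / (1 - \<theta>)\<^sup>2 * (dead_fraction n (B n w) X - dead_mean n (B n w))\<^sup>2)"
  proof (rule bernoulli_ex_mono[OF J0])
    fix X
    show "of_bool (bad n (B n w) X) \<le> 4 / (1 - \<theta>)\<^sup>2 * (dead_fraction n (B n w) X - dead_mean n (B n w))\<^sup>2"
    proof (cases "bad n (B n w) X")
      case True
      then have "(1 - \<theta>) / 2 \<le> dead_fraction n (B n w) X - dead_mean n (B n w)" using dead_mean by (simp add: bad_def field_simps)
      then have "((1 - \<theta>) / 2)\<^sup>2 \<le> (dead_fraction n (B n w) X - dead_mean n (B n w))\<^sup>2" using \<theta>1 by (intro power_mono) auto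
      then have "4 / (1 - \<theta>)\<^sup>2 * ((1 - \<theta>) / 2)\<^sup>2 \<le> 4 / (1 - \<theta>)\<^sup>2 * (dead_fraction n (B n w) X - dead_mean n (B n w))\<^sup>2"
        by (intro mult_left_mono) auto
      moreover have "4 / (1 - \<theta>)\<^sup>2 * ((1 - \<theta>) / 2)\<^sup>2 = 1" using \<theta>1 by (simp add: power_divide)
      ultimately show ?thesis using True by simp
    qed simp
  qed
  also have "\<dots> = 4 / (1 - \<theta>)\<^sup>2 * dead_variance n (B n w)" unfolding bernoulli_ex_cmult dead_variance_def ..
  also have "\<dots> \<le> 4 / (1 - \<theta>)\<^sup>2 * vn" using dead_variance by (intro mult_left_mono) auto
  finally show ?thesis .
qed

end

section \<open>Induction over the scales and its starting point\<close>

context hier_supercritical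
begin

text \<open>The circle closes as follows: few deaths and small variance make bad siblings rare, this
  bounds \<open>Phi'\<close>, and \<open>Phi'\<close> bounds both the next \<open>Phi\<close> and
  the new deaths, which feed death probability and variance. \<open>S1\<close>, \<open>S2\<close>
  and \<open>S3\<close> are purely numerical. In \<open>S2\<close>, 12 is 3/4 * 16 and 13 is 16 - 3,
  so the constant 16 of the variance bound is reproduced.\<close>

lemma survival:
  fixes r c \<eta> :: real
  assumes \<theta>1: "\<theta> < 1" and c: "c = r - q * \<rho> / \<theta>"
    and S1: "\<And>n. n0 \<le> n \<Longrightarrow> contraction (Suc n) * exp (- (r * loglog n)) + absorb_factor * exp (- (loglog (Suc n) * r1))
      + N * (4 / (1 - \<theta>)\<^sup>2 * (16 * exp (- (c * loglog n))))
        * (exp (q * loglog (Suc n) / 2) * exp (- (r * loglog n)) + exp (- (q * loglog (Suc n) / (2 * N))))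
      \<le> exp (- (r * loglog (Suc n)))"
    and S2: "\<And>n. n0 \<le> n \<Longrightarrow> 12 * exp (- (c * loglog n)) \<le> 13 * exp (- (c * loglog (Suc n)))"
    and S3: "\<And>n. \<eta> + (\<Sum>m\<in>{n0..<n}. exp (- (c * loglog (Suc m)))) \<le> (1 - \<theta>) / 2"
    and init: "\<And>v. v \<in> V \<Longrightarrow> Phi n0 v \<le> exp (- (r * loglog n0))" "\<And>v. v \<in> V \<Longrightarrow> death_prob n0 v \<le> \<eta>"
      "\<And>v. v \<in> V \<Longrightarrow> dead_variance n0 (B n0 v) \<le> 16 * exp (- (c * loglog n0))"
    and n: "n0 \<le> n"
  shows "\<forall>v\<in>V. Phi n v \<le> exp (- (r * loglog n)) \<and> death_prob n v \<le> \<eta> + (\<Sum>m\<in>{n0..<n}. exp (- (c * loglog (Suc m))))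
    \<and> dead_variance n (B n v) \<le> 16 * exp (- (c * loglog n))"
  using n
proof (induction n rule: dec_induct)
  case base
  then show ?case using init by auto
next
  case (step n)
  have IH: "Phi n v \<le> exp (- (r * loglog n))" "death_prob n v \<le> \<eta> + (\<Sum>m\<in>{n0..<n}. exp (- (c * loglog (Suc m))))"
    "dead_variance n (B n v) \<le> 16 * exp (- (c * loglog n))" if "v \<in> V" for v
    using step.IH that by auto
  note n = step.hyps(1)
  have lm: "loglog n \<le> loglog (Suc n)" using n n01 by (intro loglog_mono) auto
  have bad: "ex (E n w) (\<lambda>X. of_bool (bad n (B n w) X)) \<le> 4 / (1 - \<theta>)\<^sup>2 * (16 * exp (- (c * loglog n)))" if w: "w \<in> V" for w
  proof (rule bad_prob_le[OF w \<theta>1 _ IH(3)[OF w]])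
    fix x assume "x \<in> B n w"
    then show "death_prob n x \<le> (1 - \<theta>) / 2" using IH(2)[OF block_hvert] S3[of n] by force
  qed
  have Phi': "Phi' n v \<le> exp (- (r * loglog (Suc n)))" if v: "v \<in> V" for v
  proof -
    have "Phi' n v \<le> contraction (Suc n) * exp (- (r * loglog n)) + absorb_factor * exp (- (loglog (Suc n) * r1))
      + N * (4 / (1 - \<theta>)\<^sup>2 * (16 * exp (- (c * loglog n))))
        * (exp (q * loglog (Suc n) / 2) * exp (- (r * loglog n)) + exp (- (q * loglog (Suc n) / (2 * N))))"
    proof (rule Phi'_le[OF v n lm IH(1)[OF v]])
      fix c' assume "c' \<in> siblings n v"
      then obtain w where "w \<in> V" "c' = B n w" using sub_block[of c' n v] by (auto simp: siblings_def)
      then show "ex (edges_in d L c') (\<lambda>X. of_bool (bad n c' X)) \<le> 4 / (1 - \<theta>)\<^sup>2 * (16 * exp (- (c * loglog n)))"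
        using bad by simp
    qed
    then show ?thesis using S1[OF n] by linarith
  qed
  have nd: "ex (E (Suc n) v) (\<lambda>X. of_bool (alive n v X \<and> \<not> alive (Suc n) v X)) \<le> exp (- (c * loglog (Suc n)))"
    if v: "v \<in> V" for v
  proof -
    have "ex (E (Suc n) v) (\<lambda>X. of_bool (alive n v X \<and> \<not> alive (Suc n) v X))
      \<le> exp (loglog (Suc n) * (q * \<rho> / \<theta>)) * Phi' n v" by (rule newly_dead_le[OF v n])
    also have "\<dots> \<le> exp (loglog (Suc n) * (q * \<rho> / \<theta>)) * exp (- (r * loglog (Suc n)))"
      by (intro mult_left_mono Phi'[OF v]) auto
    also have "\<dots> = exp (- (c * loglog (Suc n)))" unfolding mult_exp_exp c by (simp add: algebra_simps)
    finally show ?thesis .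
  qed
  show ?case
  proof (intro ballI conjI)
    fix v assume v: "v \<in> V"
    show "Phi (Suc n) v \<le> exp (- (r * loglog (Suc n)))" using Phi_Suc_le[of n v] Phi'[OF v] by linarith
    show "death_prob (Suc n) v \<le> \<eta> + (\<Sum>m\<in>{n0..<Suc n}. exp (- (c * loglog (Suc m))))"
      using death_prob_Suc_le[OF v, of n] IH(2)[OF v] nd[OF v] n by simp
    have "dead_variance (Suc n) (B (Suc n) v) \<le> 3 / 4 * (16 * exp (- (c * loglog n))) + 3 * exp (- (c * loglog (Suc n)))"
    proof (rule dead_variance_Suc_le[OF v])
      fix c' assume "c' \<in> subblocks d L n v"
      then obtain w where "w \<in> V" "c' = B n w" using sub_block[of c' n v] by auto
      then show "dead_variance n c' \<le> 16 * exp (- (c * loglog n))" using IH(3) by simp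
    next
      fix w assume "w \<in> B (Suc n) v"
      then show "ex (E (Suc n) w) (\<lambda>X. of_bool (alive n w X \<and> \<not> alive (Suc n) w X)) \<le> exp (- (c * loglog (Suc n)))"
        by (intro nd block_hvert)
    qed
    then show "dead_variance (Suc n) (B (Suc n) v) \<le> 16 * exp (- (c * loglog (Suc n)))" using S2[OF n] by linarith
  qed
qed

text \<open>Alive at level \<open>n\<close> means at least \<open>\<rho> * N ^ n\<close> vertices in
  the cluster, eventually more than any fixed block contains.\<close>

lemma alive_percolates:
  assumes "\<And>n. n0 \<le> n \<Longrightarrow> death_prob n O0 \<le> 1 / 2"
  shows "1 / 2 \<le> measure (perc d L j) (perc_event d L j)"
proof (rule perc_event_ge[of "\<lambda>n. alive n O0"])
  show "depends_on (E n O0) (alive n O0)" for n by (rule depends_on_alive)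
  show "alive (Suc n) O0 X \<Longrightarrow> alive n O0 X" for n X by (auto simp: alive_def)
  show "1 / 2 \<le> ex (E n O0) (\<lambda>X. of_bool (alive n O0 X))" for n
  proof (cases "n0 \<le> n")
    case True
    have "ex (E n O0) (\<lambda>X. of_bool (alive n O0 X)) = ex (E n O0) (\<lambda>X. 1 - of_bool (\<not> alive n O0 X))"
      by (rule bernoulli_ex_cong) auto
    also have "\<dots> = 1 - death_prob n O0" unfolding bernoulli_ex_diff death_prob_def by (simp add: bernoulli_ex_const)
    finally show ?thesis using assms[OF True] by simp
  next
    case False
    then have "alive n O0 X" for X by (auto simp: alive_def)
    then show ?thesis by (simp add: bernoulli_ex_const)
  qed
  fix X T assume al: "\<And>n. alive n O0 X"
  obtain k where k: "N ^ T / \<rho> < N ^ k" using real_arch_pow[of N "N ^ T / \<rho>"] N2 by auto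
  define n where "n = max k n0"
  have "N ^ k \<le> N ^ n" using N2 by (intro power_increasing) (auto simp: n_def)
  then have "N ^ T / \<rho> < N ^ n" using k by linarith
  then have 1: "N ^ T < \<rho> * N ^ n" using rho by (simp add: pos_divide_less_eq mult.commute)
  have "\<rho> \<le> cluster_density n O0 X" using al[of n] by (simp add: alive_def n_def)
  then have 2: "\<rho> * N ^ n \<le> real (card (block_cluster n O0 X))"
    unfolding cluster_density_def using zero_less_power[OF N0, of n] by (simp only: pos_le_divide_eq)
  have "leaves T n X"
  proof (rule ccontr)
    assume "\<not> leaves T n X"
    then have "block_cluster n O0 X \<subseteq> B T O0" by (simp add: leaves_def block_cluster_def)
    then have "real (card (block_cluster n O0 X)) \<le> real (card (B T O0))" by (intro of_nat_mono card_mono) auto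
    then show False using 1 2 card_B[of O0 T] by simp
  qed
  then show "\<exists>n. leaves T n X" ..
qed

text \<open>Unless some edge of the block is closed, the block is a complete graph, every density is
  1 and nobody is dead. The failure probability is bounded by the number of edges times
  \<open>exp (- H)\<close>; the edges are counted crudely as subsets of the block.\<close>

lemma base_case:
  fixes H :: real
  assumes H: "\<And>l. l \<le> n0 \<Longrightarrow> j l = H" and v: "v \<in> V"
  defines "\<eta> \<equiv> 2 ^ (L ^ d) ^ n0 * exp (- H)"
  shows "Phi n0 v \<le> exp (- (q * loglog n0)) + \<eta>" "death_prob n0 v \<le> \<eta>" "dead_variance n0 (B n0 v) \<le> \<eta>"
proof -
  let ?E = "E n0 v"
  define o' where "o' X = (of_bool (\<not> ?E \<subseteq> X) :: real)" for X
  have fE: "finite ?E" using v by simp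
  have Np: "0 < N ^ n0" using zero_less_power[OF N0] .
  have o': "ex ?E o' \<le> \<eta>"
  proof -
    have "ex ?E o' \<le> ex ?E (\<lambda>X. \<Sum>e\<in>?E. of_bool (X \<inter> {e} = {}))"
    proof (rule bernoulli_ex_mono[OF J0])
      fix X show "o' X \<le> (\<Sum>e\<in>?E. of_bool (X \<inter> {e} = {}))"
      proof (cases "?E \<subseteq> X")
        case False
        then obtain e where e: "e \<in> ?E" "e \<notin> X" by blast
        have "1 \<le> (\<Sum>e\<in>?E. of_bool (X \<inter> {e} = {}) :: real)"
          using member_le_sum[of e ?E "\<lambda>e. of_bool (X \<inter> {e} = {}) :: real"] e fE by simp
        then show ?thesis by (simp add: o'_def)
      qed (simp add: o'_def sum_nonneg)
    qed
    also have "\<dots> = (\<Sum>e\<in>?E. exp (- H))"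
      unfolding bernoulli_ex_sum
    proof (rule sum.cong[OF refl])
      fix e assume e: "e \<in> ?E"
      show "ex ?E (\<lambda>X. of_bool (X \<inter> {e} = {})) = exp (- H)"
        using bernoulli_ex_closed[OF fE, of "{e}" J] e H[OF elevel_edges_in[OF e]] by simp
    qed
    also have "\<dots> = real (card ?E) * exp (- H)" by simp
    also have "\<dots> \<le> \<eta>"
      unfolding \<eta>_def
    proof (rule mult_right_mono)
      have "card ?E \<le> card (Pow (B n0 v))" using v by (intro card_mono) (auto simp: edges_in_def)
      also have "\<dots> = 2 ^ (L ^ d) ^ n0" using card_block[OF L2 v, of n0] by (simp add: card_Pow)
      finally show "real (card ?E) \<le> 2 ^ (L ^ d) ^ n0" by (metis of_nat_le_iff of_nat_numeral of_nat_power)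
    qed simp
    finally show ?thesis .
  qed
  have full: "cluster_density n0 w X = 1" if X: "?E \<subseteq> X" and w: "w \<in> B n0 v" for w X
  proof -
    have wV: "w \<in> V" using w by (rule block_hvert)
    have Bw: "B n0 w = B n0 v" using w by (rule block_eq)
    have "B n0 w \<subseteq> block_cluster n0 w X"
    proof
      fix y assume y: "y \<in> B n0 w"
      show "y \<in> block_cluster n0 w X"
      proof (cases "y = w")
        case False
        have "{w, y} \<in> ?E" using y w False Bw wV block_hvert[OF y] by (auto simp: edges_in_def edge_iff)
        then have "{w, y} \<in> X \<inter> hedges d L" using X by (auto simp: edges_in_def)
        then show ?thesis unfolding block_cluster_def using y wV by (intro cluster_in_step[of w _ _ w y]) auto
      qed (simp add: block_cluster_self)
    qed
    then have "block_cluster n0 w X = B n0 w" using block_cluster_subset[OF wV] by blast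
    then show ?thesis using card_B[OF wV, of n0] Np by (simp add: cluster_density_def)
  qed
  have al: "alive n0 w X" if "?E \<subseteq> X" "w \<in> B n0 v" for w X
    unfolding alive_def using full[OF that] rho by (metis le_antisym)
  have "Phi n0 v \<le> ex ?E (\<lambda>X. exp (- (q * loglog n0)) + o' X)"
    unfolding Phi_def
  proof (rule bernoulli_ex_mono[OF J0])
    fix X
    have p1: "psi n0 v X \<le> 1"
      unfolding psi_def using q0 lamnn[of n0] zeta_bounds[OF theta(1) cluster_density_nonneg] by simp
    show "of_bool (alive n0 v X) * psi n0 v X \<le> exp (- (q * loglog n0)) + o' X"
    proof (cases "?E \<subseteq> X")
      case True
      have "zeta \<theta> (cluster_density n0 v X) = 1" using full[OF True block_self[OF v]] theta by (simp add: zeta_def)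
      then show ?thesis by (simp add: psi_def o'_def)
    next
      case False
      then have "o' X = 1" by (simp add: o'_def)
      moreover have "of_bool (alive n0 v X) * psi n0 v X \<le> 1" using p1 by simp
      ultimately show ?thesis using exp_ge_zero[of "- (q * loglog n0)"] by linarith
    qed
  qed
  then show "Phi n0 v \<le> exp (- (q * loglog n0)) + \<eta>" using o' by (simp add: bernoulli_ex_add bernoulli_ex_const[OF fE])
  have "death_prob n0 v \<le> ex ?E o'"
    unfolding death_prob_def by (rule bernoulli_ex_mono[OF J0]) (use al[OF _ block_self[OF v]] in \<open>auto simp: o'_def\<close>)
  then show "death_prob n0 v \<le> \<eta>" using o' by linarith
  have Z01: "(dead_fraction n0 (B n0 v) X)\<^sup>2 \<le> o' X" for X
  proof (cases "?E \<subseteq> X")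
    case True
    then have "(\<Sum>w\<in>B n0 v. of_bool (\<not> alive n0 w X)) = (0::real)" using al[OF True] by (intro sum.neutral) auto
    then show ?thesis unfolding dead_fraction_def by (simp add: o'_def)
  next
    case False
    have "(\<Sum>w\<in>B n0 v. of_bool (\<not> alive n0 w X)) \<le> (\<Sum>w\<in>B n0 v. 1::real)" by (intro sum_mono) auto
    then have "(\<Sum>w\<in>B n0 v. of_bool (\<not> alive n0 w X)) \<le> N ^ n0" using card_B[OF v, of n0] by simp
    then have "dead_fraction n0 (B n0 v) X \<le> 1" unfolding dead_fraction_def using Np by (simp only: pos_divide_le_eq mult_1)
    moreover have "0 \<le> dead_fraction n0 (B n0 v) X" unfolding dead_fraction_def using Np by (intro divide_nonneg_nonneg sum_nonneg) auto
    ultimately show ?thesis using False by (simp add: o'_def power_le_one)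
  qed
  have "dead_variance n0 (B n0 v) = ex ?E (\<lambda>X. ((dead_fraction n0 (B n0 v) X)\<^sup>2 - 2 * dead_mean n0 (B n0 v) * dead_fraction n0 (B n0 v) X) + (dead_mean n0 (B n0 v))\<^sup>2)"
    unfolding dead_variance_def by (rule bernoulli_ex_cong) (simp add: power2_diff algebra_simps)
  also have "\<dots> = ex ?E (\<lambda>X. (dead_fraction n0 (B n0 v) X)\<^sup>2) - (dead_mean n0 (B n0 v))\<^sup>2"
    unfolding bernoulli_ex_add bernoulli_ex_diff bernoulli_ex_cmult bernoulli_ex_const[OF fE] dead_mean_def[symmetric] by (simp add: power2_eq_square)
  also have "\<dots> \<le> ex ?E (\<lambda>X. (dead_fraction n0 (B n0 v) X)\<^sup>2)" by simp
  also have "\<dots> \<le> ex ?E o'" by (rule bernoulli_ex_mono[OF J0 Z01])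
  finally show "dead_variance n0 (B n0 v) \<le> \<eta>" using o' by linarith
qed

end

section \<open>Numerical conditions at large scales\<close>

context hier_lattice
begin

lemma loglog_at_top: "filterlim loglog at_top sequentially"
  unfolding loglog_eq[abs_def] using lnL by real_asymp

lemma loglog_Suc_at_top: "filterlim (\<lambda>n. loglog (Suc n)) at_top sequentially"
  using loglog_at_top by (rule filterlim_compose[OF _ filterlim_Suc])

lemma loglog_diff: "(\<lambda>n. loglog (Suc n) - loglog n) \<longlonglongrightarrow> 0"
  unfolding loglog_eq[abs_def] using lnL by real_asymp

lemma exp_loglog_0: "0 < k \<Longrightarrow> (\<lambda>n. exp (- (k * loglog (Suc n)))) \<longlonglongrightarrow> 0"
proof -
  assume "0 < k"
  then have "filterlim (\<lambda>n. k * loglog (Suc n)) at_top sequentially"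
    by (intro filterlim_tendsto_pos_mult_at_top[OF tendsto_const _ loglog_Suc_at_top])
  then have "filterlim (\<lambda>n. - (k * loglog (Suc n))) at_bot sequentially" by (simp add: filterlim_uminus_at_bot)
  then show ?thesis by (rule filterlim_compose[OF exp_at_bot])
qed

lemma exp_loglog_diff: "(\<lambda>n. exp (k * (loglog (Suc n) - loglog n))) \<longlonglongrightarrow> 1"
  using tendsto_exp[OF tendsto_mult_left[OF loglog_diff, of k]] by simp

text \<open>Divide by the right-hand side. Consecutive values of \<open>loglog\<close> differ by
  o(1), so each term becomes a bounded factor times an exponential with exponent \<open>A\<close>,
  \<open>A'\<close>, \<open>r1 - r\<close>, \<open>c - q / 2\<close> or
  \<open>c + q / (2 * N) - r\<close> times \<open>- loglog (Suc n)\<close>; the assumptions say that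
  these five are positive.\<close>

lemma eventually_S1:
  fixes r r1 c q A A' K M :: real
  assumes "0 < A" "0 < A'" "r < r1" "q / 2 < c" "r < c + q / (2 * N)"
  shows "eventually (\<lambda>n. (exp (- (loglog (Suc n) * A)) + K * exp (- (loglog (Suc n) * A'))) * exp (- (r * loglog n))
      + K * exp (- (loglog (Suc n) * r1))
      + N * (M * (16 * exp (- (c * loglog n))))
        * (exp (q * loglog (Suc n) / 2) * exp (- (r * loglog n)) + exp (- (q * loglog (Suc n) / (2 * N))))
      \<le> exp (- (r * loglog (Suc n)))) sequentially"
proof -
  define F where "F n = (exp (- (A * loglog (Suc n))) + K * exp (- (A' * loglog (Suc n)))) * exp (r * (loglog (Suc n) - loglog n))
      + K * exp (- ((r1 - r) * loglog (Suc n)))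
      + N * M * 16 * (exp ((c + r) * (loglog (Suc n) - loglog n)) * exp (- ((c - q / 2) * loglog (Suc n)))
          + exp (c * (loglog (Suc n) - loglog n)) * exp (- ((c + q / (2 * N) - r) * loglog (Suc n))))" for n
  have "F \<longlonglongrightarrow> (0 + K * 0) * 1 + K * 0 + N * M * 16 * (1 * 0 + 1 * 0)"
    unfolding F_def by (intro tendsto_intros exp_loglog_0 exp_loglog_diff) (use assms in auto)
  then have "eventually (\<lambda>n. F n < 1) sequentially" by (intro order_tendstoD) auto
  then show ?thesis
  proof eventually_elim
    case (elim n)
    have "F n * exp (- (r * loglog (Suc n))) \<le> 1 * exp (- (r * loglog (Suc n)))"
      using elim by (intro mult_right_mono) auto
    moreover have "F n * exp (- (r * loglog (Suc n))) = (exp (- (loglog (Suc n) * A)) + K * exp (- (loglog (Suc n) * A'))) * exp (- (r * loglog n))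
      + K * exp (- (loglog (Suc n) * r1))
      + N * (M * (16 * exp (- (c * loglog n))))
        * (exp (q * loglog (Suc n) / 2) * exp (- (r * loglog n)) + exp (- (q * loglog (Suc n) / (2 * N))))"
    proof -
      have e1: "exp (r * (loglog (Suc n) - loglog n)) * exp (- (r * loglog (Suc n))) = exp (- (r * loglog n))"
        unfolding mult_exp_exp by (simp add: algebra_simps)
      have e2: "exp (- ((r1 - r) * loglog (Suc n))) * exp (- (r * loglog (Suc n))) = exp (- (loglog (Suc n) * r1))"
        unfolding mult_exp_exp by (simp add: algebra_simps)
      have e3: "exp ((c + r) * (loglog (Suc n) - loglog n)) * exp (- ((c - q / 2) * loglog (Suc n))) * exp (- (r * loglog (Suc n)))
          = exp (- (c * loglog n)) * (exp (q * loglog (Suc n) / 2) * exp (- (r * loglog n)))"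
        unfolding mult_exp_exp by (simp add: algebra_simps)
      have e4: "exp (c * (loglog (Suc n) - loglog n)) * exp (- ((c + q / (2 * N) - r) * loglog (Suc n))) * exp (- (r * loglog (Suc n)))
          = exp (- (c * loglog n)) * exp (- (q * loglog (Suc n) / (2 * N)))"
        unfolding mult_exp_exp by (simp add: algebra_simps)
      have "F n * exp (- (r * loglog (Suc n)))
        = (exp (- (A * loglog (Suc n))) + K * exp (- (A' * loglog (Suc n)))) * (exp (r * (loglog (Suc n) - loglog n)) * exp (- (r * loglog (Suc n))))
        + K * (exp (- ((r1 - r) * loglog (Suc n))) * exp (- (r * loglog (Suc n))))
        + N * M * 16 * (exp ((c + r) * (loglog (Suc n) - loglog n)) * exp (- ((c - q / 2) * loglog (Suc n))) * exp (- (r * loglog (Suc n)))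
          + exp (c * (loglog (Suc n) - loglog n)) * exp (- ((c + q / (2 * N) - r) * loglog (Suc n))) * exp (- (r * loglog (Suc n))))"
        unfolding F_def by (simp only: distrib_right distrib_left mult.assoc)
      then show ?thesis unfolding e1 e2 e3 e4 by (simp only: distrib_left mult_ac)
    qed
    ultimately show ?case by simp
  qed
qed

lemma eventually_S2: "eventually (\<lambda>n. 12 * exp (- (c * loglog n)) \<le> 13 * exp (- (c * loglog (Suc n)))) sequentially"
proof -
  have "eventually (\<lambda>n. exp (c * (loglog (Suc n) - loglog n)) < 13 / 12) sequentially"
    using exp_loglog_diff by (rule order_tendstoD) simp
  then show ?thesis
  proof eventually_elim
    case (elim n)
    have "exp (c * (loglog (Suc n) - loglog n)) * exp (- (c * loglog (Suc n))) \<le> 13 / 12 * exp (- (c * loglog (Suc n)))"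
      using elim by (intro mult_right_mono) auto
    also have "exp (c * (loglog (Suc n) - loglog n)) * exp (- (c * loglog (Suc n))) = exp (- (c * loglog n))"
      unfolding mult_exp_exp by (simp add: algebra_simps)
    finally show ?case by simp
  qed
qed

text \<open>A constant multiple of a p-series with exponent \<open>c\<close>; this is where the
  critical value 1 enters the survival argument.\<close>

lemma summable_exp_loglog:
  assumes "1 < c" shows "summable (\<lambda>m. exp (- (c * loglog (Suc m))))"
proof -
  have "exp (- (c * loglog (Suc m))) = ln (real L) powr (- c) * real (Suc m) powr (- c)" for m
  proof -
    have "ln (real (Suc m) * ln (real L)) = ln (real (Suc m)) + ln (ln (real L))"
      by (rule ln_mult_pos) (use lnL in auto)
    then have "- (c * loglog (Suc m)) = - c * ln (ln (real L)) + - c * ln (real (Suc m))"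
      unfolding loglog_eq by (simp only: algebra_simps)
    then show ?thesis using lnL by (simp only: exp_add) (simp add: powr_def)
  qed
  moreover have "summable (\<lambda>m. real (Suc m) powr (- c))"
    using assms summable_real_powr_iff[of "- c"] by (subst summable_Suc_iff) auto
  ultimately show ?thesis by (simp add: summable_mult)
qed

end

context hier_lattice
begin

text \<open>The order of choices matters. The exponents with 1 < c < r < r1 < q < a * \<theta>^2
  come first, then \<open>n0\<close>, beyond which the numerical conditions hold, and last the value
  \<open>H\<close> of the kernel up to \<open>n0\<close>, which may depend on everything before
  because finitely many levels do not affect the asymptotics.\<close>

lemma percolation:
  assumes a: "1 < a"
  shows "\<exists>j. (\<forall>n. 0 \<le> j n) \<and> eventually (\<lambda>n. 0 < loglog n \<and> j n = a * N * loglog n / N ^ (2 * n)) sequentially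
    \<and> 0 < measure (perc d L j) (perc_event d L j)"
proof -
  \<comment> \<open>The minimum with 3/2 keeps \<open>q\<close> below 2, so that
    \<open>q / 2 < 1 < r\<close>; \<theta> below makes \<open>a * \<theta>\<^sup>2\<close> the
    midpoint of \<open>q\<close> and \<open>a\<close>.\<close>
  define q where "q = (1 + min a (3 / 2)) / 2"
  have q: "1 < q" "q < a" "q < 2" using a by (auto simp: q_def min_def)
  define \<theta> where "\<theta> = sqrt ((q + a) / (2 * a))"
  have \<theta>2: "a * \<theta>\<^sup>2 = (q + a) / 2" using a q by (simp add: \<theta>_def field_simps)
  have \<theta>: "0 < \<theta>" "\<theta> < 1" using a q by (auto simp: \<theta>_def)
  define r where "r = 1 + (q - 1) / 3"
  define r1 where "r1 = 1 + 2 * (q - 1) / 3"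
  have r: "1 < r" "r < r1" "r1 < q" "q / 2 < r" using q by (auto simp: r_def r1_def field_simps)
  \<comment> \<open>Bounds the admissible loss \<open>r - c = q * \<rho> / \<theta>\<close>: the
    three terms preserve \<open>c > q / 2\<close>, \<open>c > r - q / (2 * N)\<close> and
    \<open>c > 1\<close>.\<close>
  define m where "m = min (min (r - q / 2) (q / (2 * N))) (r - 1)"
  have "0 < m" "m \<le> r - q / 2" "m \<le> q / (2 * N)" "m \<le> r - 1" using r q N0 by (auto simp: m_def)
  moreover define s where "s = m / 2"
  ultimately have s: "0 < s" "s < r - q / 2" "s < q / (2 * N)" "s < r - 1" by linarith+
  define \<rho> where "\<rho> = min 1 (s * \<theta> / q)"
  have \<rho>: "0 < \<rho>" "\<rho> \<le> 1" using s \<theta> q by (auto simp: \<rho>_def)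
  have "\<rho> \<le> s * \<theta> / q" by (simp add: \<rho>_def)
  then have \<rho>s: "q * \<rho> / \<theta> \<le> s" using \<theta> q by (simp add: field_simps)
  define c where "c = r - q * \<rho> / \<theta>"
  have c: "1 < c" "q / 2 < c" "r < c + q / (2 * N)" using \<rho>s s by (auto simp: c_def)
  define A where "A = (a * \<theta>\<^sup>2 - q) / 2 * \<rho>"
  define A' where "A' = \<rho> * (q - r1) / N"
  have A: "0 < A" "0 < A'" using \<theta>2 q \<rho> r N0 by (auto simp: A_def A'_def)
  define K where "K = (2::real) ^ nat \<lfloor>N / \<rho>\<rfloor>"
  define M where "M = 4 / (1 - \<theta>)\<^sup>2"
  note S1 = eventually_S1[OF A r(2) c(2,3), of K M]
  note S2 = eventually_S2[of c]
  have "eventually (\<lambda>n. 0 < loglog n) sequentially" using loglog_at_top by (simp add: filterlim_at_top_dense)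
  from eventually_conj[OF eventually_conj[OF S1 S2] this]
  obtain n1 where n1: "\<And>n. n1 \<le> n \<Longrightarrow> (exp (- (loglog (Suc n) * A)) + K * exp (- (loglog (Suc n) * A'))) * exp (- (r * loglog n))
      + K * exp (- (loglog (Suc n) * r1))
      + N * (M * (16 * exp (- (c * loglog n))))
        * (exp (q * loglog (Suc n) / 2) * exp (- (r * loglog n)) + exp (- (q * loglog (Suc n) / (2 * N))))
      \<le> exp (- (r * loglog (Suc n)))" "\<And>n. n1 \<le> n \<Longrightarrow> 12 * exp (- (c * loglog n)) \<le> 13 * exp (- (c * loglog (Suc n)))"
      "\<And>n. n1 \<le> n \<Longrightarrow> 0 < loglog n"
    unfolding eventually_sequentially by blast
  have "0 < (1 - \<theta>) / 4" using \<theta> by simp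
  \<comment> \<open>Half of the budget \<open>(1 - \<theta>) / 2\<close> for deaths goes to the tail
    of the series, the other half to the failure at the initial scale.\<close>
  then obtain n2 where n2: "\<And>m n. n2 \<le> m \<Longrightarrow> norm (\<Sum>m\<in>{m..<n}. exp (- (c * loglog (Suc m)))) < (1 - \<theta>) / 4"
    using summable_exp_loglog[OF c(1)] unfolding summable_Cauchy by blast
  define n0 where "n0 = max 1 (max n1 n2)"
  have n0: "1 \<le> n0" "n1 \<le> n0" "n2 \<le> n0" by (auto simp: n0_def)
  have l0: "0 < loglog n0" using n1(3) n0 by simp
  \<comment> \<open>Tolerated failure at \<open>n0\<close>: the terms serve \<open>Phi\<close>, the
    budget for deaths and the variance. The first is positive because \<open>r < q\<close> and
    \<open>loglog n0\<close> is positive.\<close>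
  define e where "e = min (min (exp (- (r * loglog n0)) - exp (- (q * loglog n0))) ((1 - \<theta>) / 4)) (16 * exp (- (c * loglog n0)))"
  have "r * loglog n0 < q * loglog n0" using l0 r by simp
  then have e0: "0 < e" using \<theta> by (simp add: e_def)
  define Mx where "Mx = (2::real) ^ (L ^ d) ^ n0"
  have Mx: "0 < Mx" by (simp add: Mx_def)
  \<comment> \<open>Solves \<open>Mx * exp (- H) \<le> e\<close>; the summand 1 keeps
    \<open>H\<close> nonnegative.\<close>
  define H where "H = ln (Mx / e + 1)"
  have H0: "0 \<le> H" using Mx e0 by (simp add: H_def)
  have He: "Mx * exp (- H) \<le> e"
  proof -
    have "0 < Mx / e + 1" using Mx e0 by (simp add: add_pos_pos)
    then have "Mx * exp (- H) = Mx / (Mx / e + 1)" by (simp add: H_def exp_minus divide_inverse)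
    also have "\<dots> \<le> Mx / (Mx / e)" using Mx e0 by (intro divide_left_mono) (auto simp: add_pos_pos)
    also have "\<dots> = e" using Mx e0 by simp
    finally show ?thesis .
  qed
  define j where "j n = (if n \<le> n0 then H else a * N * loglog n / N ^ (2 * n))" for n
  have j0: "0 \<le> j n" for n
    using H0 a N0 n1(3)[of n] n0 by (auto simp: j_def intro!: divide_nonneg_nonneg mult_nonneg_nonneg)
  interpret hier_supercritical d L j a \<theta> \<rho> q r1 n0
  proof
    show "0 \<le> j n" for n by (rule j0)
    show "n0 \<le> n \<Longrightarrow> j (Suc n) = a * N * loglog (Suc n) / N ^ (2 * Suc n)" for n by (simp add: j_def)
    show "n0 \<le> n \<Longrightarrow> 0 \<le> loglog n" for n using n1(3)[of n] n0 by simp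
    show "q \<le> a * \<theta>\<^sup>2" using \<theta>2 q by simp
  qed (use \<theta> \<rho> r n0 in auto)
  have jH: "l \<le> n0 \<Longrightarrow> j l = H" for l by (simp add: j_def)
  note base = base_case[OF jH, folded Mx_def]
  have surv: "\<forall>v\<in>V. Phi n v \<le> exp (- (r * loglog n)) \<and> death_prob n v \<le> e + (\<Sum>m\<in>{n0..<n}. exp (- (c * loglog (Suc m))))
    \<and> dead_variance n (B n v) \<le> 16 * exp (- (c * loglog n))" if n: "n0 \<le> n" for n
  proof (rule survival[OF \<theta>(2) c_def _ _ _ _ _ _ n])
    show "contraction (Suc n) * exp (- (r * loglog n)) + absorb_factor * exp (- (loglog (Suc n) * r1))
      + N * (4 / (1 - \<theta>)\<^sup>2 * (16 * exp (- (c * loglog n))))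
        * (exp (q * loglog (Suc n) / 2) * exp (- (r * loglog n)) + exp (- (q * loglog (Suc n) / (2 * N))))
      \<le> exp (- (r * loglog (Suc n)))" if "n0 \<le> n" for n
      using n1(1)[of n] that n0 unfolding contraction_def absorb_factor_def A_def A'_def K_def M_def by simp
    show "12 * exp (- (c * loglog n)) \<le> 13 * exp (- (c * loglog (Suc n)))" if "n0 \<le> n" for n
      using n1(2)[of n] that n0 by simp
    show "e + (\<Sum>m\<in>{n0..<n}. exp (- (c * loglog (Suc m)))) \<le> (1 - \<theta>) / 2" for n
    proof -
      have "(\<Sum>m\<in>{n0..<n}. exp (- (c * loglog (Suc m)))) \<le> (1 - \<theta>) / 4" using n2[of n0 n] n0 by simp
      moreover have "e \<le> (1 - \<theta>) / 4" unfolding e_def by (rule min.coboundedI1[OF min.cobounded2])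
      ultimately show ?thesis by linarith
    qed
    fix v assume v: "v \<in> V"
    have "e \<le> exp (- (r * loglog n0)) - exp (- (q * loglog n0))" by (simp add: e_def)
    then show "Phi n0 v \<le> exp (- (r * loglog n0))" using base(1)[OF _ v] He by force
    show "death_prob n0 v \<le> e" using base(2)[OF _ v] He by force
    have "e \<le> 16 * exp (- (c * loglog n0))" by (simp add: e_def)
    then show "dead_variance n0 (B n0 v) \<le> 16 * exp (- (c * loglog n0))" using base(3)[OF _ v] He by force
  qed
  have "death_prob n O0 \<le> 1 / 2" if n: "n0 \<le> n" for n
  proof -
    have "death_prob n O0 \<le> e + (\<Sum>m\<in>{n0..<n}. exp (- (c * loglog (Suc m))))" using surv[OF n] by simp
    also have "\<dots> \<le> (1 - \<theta>) / 4 + (1 - \<theta>) / 4"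
    proof (rule add_mono)
      show "e \<le> (1 - \<theta>) / 4" unfolding e_def by (rule min.coboundedI1[OF min.cobounded2])
    qed (use n2[of n0 n] n0 in simp)
    finally show ?thesis using \<theta> by simp
  qed
  then have "1 / 2 \<le> measure (perc d L j) (perc_event d L j)" by (rule alive_percolates)
  moreover have "eventually (\<lambda>n. 0 < loglog n \<and> j n = a * N * loglog n / N ^ (2 * n)) sequentially"
    using eventually_gt_at_top[of n0] by eventually_elim (use n1(3) n0 in \<open>auto simp: j_def\<close>)
  ultimately show ?thesis using j0 by (intro exI[of _ j]) auto
qed

end

theorem theorem1p3:
  fixes d L :: nat
  assumes "1 \<le> d" and "2 \<le> L"
  shows "(\<forall>a::real. a > 1 \<longrightarrow>
            (\<exists>j :: nat \<Rightarrow> real. (\<forall>n. 0 \<le> j n) \<and>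
               (\<lambda>n. j n / (a * real L ^ d * ln (ln (real L ^ n)) / (real L ^ n) ^ (2 * d)))
                  \<longlonglongrightarrow> 1 \<and>
               measure (perc d L j) (perc_event d L j) > 0))
       \<and> (\<forall>j :: nat \<Rightarrow> real. (\<forall>n. 0 \<le> j n) \<longrightarrow>
            limsup (\<lambda>n. ereal ((real L ^ n) ^ (2 * d) / (real L ^ d * ln (ln (real L ^ n))) * j n)) \<le> 1
            \<longrightarrow> perc_event d L j \<in> sets (perc d L j) \<and> measure (perc d L j) (perc_event d L j) = 0)"
proof (intro conjI allI impI)
  interpret hier_lattice d L using assms by unfold_locales
  have pow: "(real L ^ n) ^ (2 * d) = (real L ^ d) ^ (2 * n)" for n
    by (simp only: power_mult[symmetric] mult_ac)
  fix a :: real assume "1 < a"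
  from percolation[OF this] obtain j where j: "\<forall>n. 0 \<le> j n"
    "eventually (\<lambda>n. 0 < loglog n \<and> j n = a * real L ^ d * loglog n / (real L ^ d) ^ (2 * n)) sequentially"
    "0 < measure (perc d L j) (perc_event d L j)" by blast
  have "eventually (\<lambda>n. j n / (a * real L ^ d * ln (ln (real L ^ n)) / (real L ^ n) ^ (2 * d)) = 1) sequentially"
    using j(2)
  proof eventually_elim
    case (elim n)
    have "a * real L ^ d * loglog n / (real L ^ d) ^ (2 * n) \<noteq> 0"
      using elim \<open>1 < a\<close> assms by simp
    then show ?case using elim unfolding pow loglog_def[symmetric] by simp
  qed
  then have "(\<lambda>n. j n / (a * real L ^ d * ln (ln (real L ^ n)) / (real L ^ n) ^ (2 * d))) \<longlonglongrightarrow> 1"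
    by (rule tendsto_eventually)
  then show "\<exists>j :: nat \<Rightarrow> real. (\<forall>n. 0 \<le> j n) \<and>
       (\<lambda>n. j n / (a * real L ^ d * ln (ln (real L ^ n)) / (real L ^ n) ^ (2 * d))) \<longlonglongrightarrow> 1 \<and>
       measure (perc d L j) (perc_event d L j) > 0" using j by blast
next
  fix j :: "nat \<Rightarrow> real"
  assume j: "\<forall>n. 0 \<le> j n"
    and ls: "limsup (\<lambda>n. ereal ((real L ^ n) ^ (2 * d) / (real L ^ d * ln (ln (real L ^ n))) * j n)) \<le> 1"
  interpret hier_percolation d L j using assms j by unfold_locales auto
  have pow: "(real L ^ n) ^ (2 * d) = (real L ^ d) ^ (2 * n)" for n
    by (simp only: power_mult[symmetric] mult_ac)
  show "perc_event d L j \<in> sets (perc d L j)" by (rule perc_event_sets)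
  show "measure (perc d L j) (perc_event d L j) = 0"
  proof (rule no_percolation)
    fix \<epsilon> :: real assume "0 < \<epsilon>"
    then have "limsup (\<lambda>n. ereal ((real L ^ n) ^ (2 * d) / (real L ^ d * ln (ln (real L ^ n))) * j n)) < ereal (1 + \<epsilon>)"
      using ls by (auto intro: le_less_trans simp: one_ereal_def)
    then have "eventually (\<lambda>n. ereal ((real L ^ n) ^ (2 * d) / (real L ^ d * ln (ln (real L ^ n))) * j n) < ereal (1 + \<epsilon>)) sequentially"
      by (rule Limsup_lessD)
    \<comment> \<open>For small \<open>n\<close> the iterated logarithm can be negative or zero, so
      the denominator can be cleared only eventually.\<close>
    moreover have "eventually (\<lambda>n. 0 < loglog n) sequentially" using loglog_at_top by (simp add: filterlim_at_top_dense)
    ultimately show "eventually (\<lambda>n. j n \<le> (1 + \<epsilon>) * real L ^ d * loglog n / (real L ^ d) ^ (2 * n)) sequentially"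
    proof eventually_elim
      case (elim n)
      have P: "0 < real L ^ d * loglog n" "0 < (real L ^ d) ^ (2 * n)" using elim N0 by simp_all
      have "(real L ^ d) ^ (2 * n) / (real L ^ d * loglog n) * j n \<le> 1 + \<epsilon>"
        using elim(1) unfolding pow loglog_def[symmetric] by simp
      then have "(real L ^ d) ^ (2 * n) * j n \<le> (1 + \<epsilon>) * (real L ^ d * loglog n)"
        using P(1) by (simp only: times_divide_eq_left pos_divide_le_eq)
      then show ?case using P(2) by (simp only: pos_le_divide_eq mult_ac)
    qed
  qed
qed

end
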